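(* Let $K\subset\mathbb{R}^n$ be a convex body, and let $C=\frac12(K+(-K))$. For $k=1,\ldots,n$, the defect $\mathcal A_k(K)=W_{n-k}(C)-W_{n-k}(K)$ satisfies $$0\leqslant\mathcal A_k(K)\leqslant\left(2^{-k}\binom{2k}{k}-1\right)W_{n-k}(K).$$ For $n=k$, the upper constant is sharp and equality in the upper bound is attained by simplices.
   Context: A convex body in $\mathbb{R}^n$ is a compact convex set with non-empty interior. $B^n$ is the Euclidean unit ball. $V$ is the mixed volume, normalized by $V(K,\ldots,K)=\mathrm{Vol}_n(K)$, and the quermassintegrals are $W_j(K)=V(K^{[n-j]},(B^n)^{[j]})$, where $[r]$ denotes repetition $r$ times. *)

theory Defs
  imports "HOL-Analysis.Analysis" "HOL-Library.Set_Algebras" "HOL-Library.Multiset"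
begin

definition convex_body :: "(real^'n) set \<Rightarrow> bool" where
  "convex_body K \<longleftrightarrow> compact K \<and> convex K \<and> interior K \<noteq> {}"

abbreviation vol :: "(real^'n) set \<Rightarrow> real" where
  "vol K \<equiv> measure lebesgue K"

text \<open>
  Minkowski's expansion: for non-negative \<open>l\<^sub>0, \<dots>, l\<^sub>n\<^sub>-\<^sub>1\<close>,
  the volume of \<open>l\<^sub>0 K\<^sub>0 + \<dots> + l\<^sub>n\<^sub>-\<^sub>1 K\<^sub>n\<^sub>-\<^sub>1\<close> is the sum of
  \<open>c(i\<^sub>1, \<dots>, i\<^sub>n) l(i\<^sub>1) \<cdots> l(i\<^sub>n)\<close> over all index tuples, with coefficients \<open>c\<close> symmetric
  in their arguments. Tuples are lists of length \<open>n\<close>; the sum of sets is the Minkowski sum.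
\<close>

definition volume_coeffs :: "(real^'n) set list \<Rightarrow> (nat list \<Rightarrow> real) \<Rightarrow> bool" where
  "volume_coeffs Ks c \<longleftrightarrow>
     (\<forall>ix jx. mset ix = mset jx \<longrightarrow> c ix = c jx) \<and>
     (\<forall>l. (\<forall>i. 0 \<le> l i) \<longrightarrow>
        vol (\<Sum>i<CARD('n). (\<lambda>x. l i *\<^sub>R x) ` (Ks ! i)) =
        (\<Sum>ix | length ix = CARD('n) \<and> set ix \<subseteq> {..<CARD('n)}.
            c ix * prod_list (map l ix)))"

text \<open>
  The mixed volume \<open>V(K\<^sub>0, \<dots>, K\<^sub>n\<^sub>-\<^sub>1)\<close> is the coefficient \<open>c(0, \<dots>, n-1)\<close> of that expansion.
  It is determined by the bodies (\<open>volume_coeffs_unique\<close>) and normalized by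
  \<open>V(K, \<dots>, K) = vol K\<close> (\<open>mixed_volume_diag\<close>). The argument is meant to be a list of exactly
  \<open>n\<close> convex bodies.
\<close>

definition mixed_volume :: "(real^'n) set list \<Rightarrow> real" where
  "mixed_volume Ks = (THE v. \<exists>c. volume_coeffs Ks c \<and> v = c [0..<CARD('n)])"

definition quermassintegral :: "nat \<Rightarrow> (real^'n) set \<Rightarrow> real" where
  "quermassintegral j K =
     mixed_volume (replicate (CARD('n) - j) K @ replicate j (cball 0 1))"

text \<open>The reflected body is \<open>uminus ` K\<close>, since \<open>- K\<close> denotes the set complement; \<open>+\<close> is
  the Minkowski sum.\<close>

definition symmetrization :: "(real^'n) set \<Rightarrow> (real^'n) set" where
  "symmetrization K = (\<lambda>x. (1/2) *\<^sub>R x) ` (K + uminus ` K)"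

definition defect :: "nat \<Rightarrow> (real^'n) set \<Rightarrow> real" where
  "defect k K = quermassintegral (CARD('n) - k) (symmetrization K)
              - quermassintegral (CARD('n) - k) K"

lemma subset_sums_zero_imp:
  fixes d :: "nat list \<Rightarrow> real"
  assumes z: "\<And>S. S \<subseteq> {..<n} \<Longrightarrow> (\<Sum>ix | length ix = n \<and> set ix \<subseteq> S. d ix) = 0"
    and "S \<subseteq> {..<n}"
  shows "(\<Sum>ix | length ix = n \<and> set ix = S. d ix) = 0"
  using \<open>S \<subseteq> {..<n}\<close>
proof (induction "card S" arbitrary: S rule: less_induct)
  case less
  have fS: "finite S" using less.prems by (rule finite_subset) simp
  let ?A = "{ix. length ix = n \<and> set ix \<subseteq> S}"
  have fA: "finite ?A"
    by (rule finite_subset[OF _ finite_lists_length_eq[OF fS, of n]]) auto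
  have "0 = (\<Sum>ix\<in>?A. d ix)" using z[OF less.prems] by simp
  also have "\<dots> = (\<Sum>T\<in>Pow S. \<Sum>ix\<in>{ix \<in> ?A. set ix = T}. d ix)"
  proof (rule sum.group[symmetric])
    show "finite ?A" by (rule fA)
    show "finite (Pow S)" using fS by simp
    show "set ` ?A \<subseteq> Pow S" by blast
  qed
  also have "\<dots> = (\<Sum>T\<in>Pow S. \<Sum>ix | length ix = n \<and> set ix = T. d ix)"
  proof (rule sum.cong[OF refl])
    fix T assume "T \<in> Pow S"
    then have "{ix \<in> ?A. set ix = T} = {ix. length ix = n \<and> set ix = T}" by blast
    then show "sum d {ix \<in> ?A. set ix = T} = sum d {ix. length ix = n \<and> set ix = T}" by simp
  qed
  also have "\<dots> = (\<Sum>T\<in>{S}. \<Sum>ix | length ix = n \<and> set ix = T. d ix)"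
  proof (rule sum.mono_neutral_right)
    show "\<forall>T\<in>Pow S - {S}. (\<Sum>ix | length ix = n \<and> set ix = T. d ix) = 0"
    proof
      fix T assume "T \<in> Pow S - {S}"
      then have "T \<subset> S" by auto
      then show "(\<Sum>ix | length ix = n \<and> set ix = T. d ix) = 0"
        using less.hyps[OF psubset_card_mono[OF fS \<open>T \<subset> S\<close>]] less.prems by blast
    qed
    show "finite (Pow S)" using fS by simp
    show "{S} \<subseteq> Pow S" by simp
  qed
  finally show ?case by simp
qed

lemma volume_coeffs_unique:
  fixes Ks :: "(real^'n) set list"
  assumes c: "volume_coeffs Ks c" and c': "volume_coeffs Ks c'"
  shows "c [0..<CARD('n)] = c' [0..<CARD('n)]"
proof -
  let ?n = "CARD('n)"
  define d where "d ix = c ix - c' ix" for ix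
  let ?A = "{ix. length ix = ?n \<and> set ix \<subseteq> {..<?n}}"
  have fA: "finite ?A"
    by (rule finite_subset[OF _ finite_lists_length_eq[of "{..<?n}" ?n]]) auto
  have ind: "prod_list (map (\<lambda>i. if i \<in> S then 1 else 0) ix) = (if set ix \<subseteq> S then 1 else (0::real))"
    for S and ix :: "nat list"
    by (induction ix) auto
  have sub: "(\<Sum>ix | length ix = ?n \<and> set ix \<subseteq> S. d ix) = 0" if S: "S \<subseteq> {..<?n}" for S
  proof -
    define l where "l = (\<lambda>i::nat. if i \<in> S then 1 else (0::real))"
    have l: "\<forall>i. 0 \<le> l i" by (simp add: l_def)
    have "vol (\<Sum>i<?n. (\<lambda>x. l i *\<^sub>R x) ` (Ks ! i)) = (\<Sum>ix\<in>?A. c ix * prod_list (map l ix))"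
      using c l unfolding volume_coeffs_def by blast
    moreover have "vol (\<Sum>i<?n. (\<lambda>x. l i *\<^sub>R x) ` (Ks ! i)) =
        (\<Sum>ix\<in>?A. c' ix * prod_list (map l ix))"
      using c' l unfolding volume_coeffs_def by blast
    ultimately have "(\<Sum>ix\<in>?A. c ix * prod_list (map l ix)) =
        (\<Sum>ix\<in>?A. c' ix * prod_list (map l ix))"
      by simp
    then have "0 = (\<Sum>ix\<in>?A. d ix * prod_list (map l ix))"
      by (simp add: d_def left_diff_distrib sum_subtractf)
    also have "\<dots> = (\<Sum>ix\<in>?A. if set ix \<subseteq> S then d ix else 0)"
      by (intro sum.cong refl) (simp add: l_def ind)
    also have "\<dots> = (\<Sum>ix\<in>{ix\<in>?A. set ix \<subseteq> S}. d ix)"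
      using sum.inter_filter[OF fA, of d "\<lambda>ix. set ix \<subseteq> S"] by (rule sym)
    also have "{ix\<in>?A. set ix \<subseteq> S} = {ix. length ix = ?n \<and> set ix \<subseteq> S}"
      using S by auto
    finally show ?thesis by simp
  qed
  let ?P = "{ix. length ix = ?n \<and> set ix = {..<?n}}"
  have fP: "finite ?P" by (rule finite_subset[OF _ fA]) auto
  have eq: "d ix = d [0..<?n]" if "ix \<in> ?P" for ix
  proof -
    have "distinct ix" using that by (simp add: card_distinct)
    then have "mset ix = mset [0..<?n]"
      using that set_eq_iff_mset_eq_distinct[of ix "[0..<?n]"] by (auto simp: atLeast0LessThan)
    then have "c ix = c [0..<?n]" "c' ix = c' [0..<?n]"
      using c c' unfolding volume_coeffs_def by blast+
    then show ?thesis by (simp add: d_def)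
  qed
  have "0 = (\<Sum>ix\<in>?P. d ix)"
    using subset_sums_zero_imp[OF sub, of "{..<?n}"] by simp
  also have "\<dots> = real (card ?P) * d [0..<?n]"
    using sum.cong[OF refl eq, of ?P] by simp
  finally have "card ?P = 0 \<or> d [0..<?n] = 0" by auto
  moreover have "[0..<?n] \<in> ?P" by (auto simp: atLeast0LessThan)
  then have "card ?P \<noteq> 0" using fP by (metis card_0_eq empty_iff)
  ultimately have "d [0..<?n] = 0" by blast
  then show ?thesis by (simp add: d_def)
qed

lemma mixed_volume_eq:
  fixes Ks :: "(real^'n) set list"
  assumes "volume_coeffs Ks c"
  shows "mixed_volume Ks = c [0..<CARD('n)]"
  unfolding mixed_volume_def
proof (rule the_equality)
  show "\<exists>c'. volume_coeffs Ks c' \<and> c [0..<CARD('n)] = c' [0..<CARD('n)]"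
    using assms by (intro exI[of _ c] conjI refl)
next
  fix v assume "\<exists>c'. volume_coeffs Ks c' \<and> v = c' [0..<CARD('n)]"
  then obtain c' where "volume_coeffs Ks c'" and v: "v = c' [0..<CARD('n)]"
    by (elim exE conjE)
  then show "v = c [0..<CARD('n)]"
    using volume_coeffs_unique[OF _ assms, of c'] by simp
qed

lemma scaleR_sum_convex:
  fixes K :: "(real^'n) set"
  assumes "convex K" "0 \<le> a" "0 \<le> b"
  shows "(\<lambda>x. a *\<^sub>R x) ` K + (\<lambda>x. b *\<^sub>R x) ` K = (\<lambda>x. (a + b) *\<^sub>R x) ` K"
proof (intro equalityI subsetI)
  fix z assume "z \<in> (\<lambda>x. a *\<^sub>R x) ` K + (\<lambda>x. b *\<^sub>R x) ` K"
  then obtain x y where xy: "x \<in> K" "y \<in> K" "z = a *\<^sub>R x + b *\<^sub>R y"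
    by (auto elim!: set_plus_elim)
  show "z \<in> (\<lambda>x. (a + b) *\<^sub>R x) ` K"
  proof (cases "a + b = 0")
    case True
    then have "a = 0" "b = 0" using assms by auto
    then show ?thesis using xy by auto
  next
    case False
    have "(a / (a + b)) *\<^sub>R x + (b / (a + b)) *\<^sub>R y \<in> K"
      using assms xy False by (intro convexD) (auto simp: add_divide_distrib[symmetric])
    moreover have "z = (a + b) *\<^sub>R ((a / (a + b)) *\<^sub>R x + (b / (a + b)) *\<^sub>R y)"
      using False xy by (simp add: scaleR_add_right)
    ultimately show ?thesis by blast
  qed
next
  fix z assume "z \<in> (\<lambda>x. (a + b) *\<^sub>R x) ` K"
  then show "z \<in> (\<lambda>x. a *\<^sub>R x) ` K + (\<lambda>x. b *\<^sub>R x) ` K"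
    by (auto simp: scaleR_add_left)
qed

lemma sum_scaleR_convex:
  fixes K :: "(real^'n) set"
  assumes "convex K" "K \<noteq> {}" "finite I" "\<And>i. 0 \<le> l i"
  shows "(\<Sum>i\<in>I. (\<lambda>x. l i *\<^sub>R x) ` K) = (\<lambda>x. (\<Sum>i\<in>I. l i) *\<^sub>R x) ` K"
  using assms(3)
proof (induction I rule: finite_induct)
  case empty
  show ?case using assms(2) by (auto simp: set_zero)
next
  case (insert j I)
  have "0 \<le> sum l I" by (simp add: assms(4) sum_nonneg)
  then have "(\<lambda>x. l j *\<^sub>R x) ` K + (\<lambda>x. sum l I *\<^sub>R x) ` K = (\<lambda>x. (l j + sum l I) *\<^sub>R x) ` K"
    using scaleR_sum_convex[OF assms(1)] assms(4) by simp
  then show ?case using insert by simp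
qed

lemma mixed_volume_diag:
  fixes K :: "(real^'n) set"
  assumes "convex K" "K \<noteq> {}"
  shows "mixed_volume (replicate (CARD('n)) K) = vol K"
proof -
  let ?n = "CARD('n)"
  have pw: "(\<Sum>ix | length ix = m \<and> set ix \<subseteq> {..<N}. prod_list (map l ix)) = (\<Sum>i<N. l i) ^ m"
    for m N and l :: "nat \<Rightarrow> real"
  proof (induction m)
    case 0
    have "{ix::nat list. ix = [] \<and> set ix \<subseteq> {..<N}} = {[]}" by auto
    then show ?case by simp
  next
    case (Suc m)
    let ?B = "{ix. length ix = m \<and> set ix \<subseteq> {..<N}}"
    have "{ix. length ix = Suc m \<and> set ix \<subseteq> {..<N}} = (\<lambda>(i, ix). i # ix) ` ({..<N} \<times> ?B)"
      by (auto simp: length_Suc_conv image_iff)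
    moreover have "inj_on (\<lambda>(i, ix). i # ix) ({..<N} \<times> ?B)" by (auto simp: inj_on_def)
    ultimately have "(\<Sum>ix | length ix = Suc m \<and> set ix \<subseteq> {..<N}. prod_list (map l ix)) =
        (\<Sum>(i, ix)\<in>{..<N} \<times> ?B. l i * prod_list (map l ix))"
      by (simp add: sum.reindex case_prod_unfold)
    also have "\<dots> = (\<Sum>i<N. l i) * (\<Sum>ix\<in>?B. prod_list (map l ix))"
      by (simp add: sum.cartesian_product[symmetric] sum_product)
    finally show ?case using Suc.IH by simp
  qed
  have "volume_coeffs (replicate ?n K) (\<lambda>_. vol K)"
    unfolding volume_coeffs_def
  proof (intro conjI allI impI refl)
    fix l :: "nat \<Rightarrow> real" assume l: "\<forall>i. 0 \<le> l i"
    have "(\<Sum>i<?n. (\<lambda>x. l i *\<^sub>R x) ` (replicate ?n K ! i)) = (\<lambda>x. (\<Sum>i<?n. l i) *\<^sub>R x) ` K"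
      using sum_scaleR_convex[OF assms, of "{..<?n}" l] l by simp
    moreover have "measure lebesgue ((\<lambda>x. (\<Sum>i<?n. l i) *\<^sub>R x) ` K) = (\<Sum>i<?n. l i) ^ ?n * vol K"
      using measure_lebesgue_affine[of "\<Sum>i<?n. l i" 0 K] l
      by (simp add: sum_nonneg)
    ultimately show "vol (\<Sum>i<?n. (\<lambda>x. l i *\<^sub>R x) ` (replicate ?n K ! i)) =
       (\<Sum>ix | length ix = ?n \<and> set ix \<subseteq> {..<?n}. vol K * prod_list (map l ix))"
      by (simp add: sum_distrib_left[symmetric] pw)
  qed
  then show ?thesis by (rule mixed_volume_eq)
qed

end

theory Submission imports Defs "HOL-Real_Asymp.Real_Asymp" begin

text \<open>
  Everything is read off the volume of \<open>K + t Z\<close> for zonotopes \<open>Z\<close>. For a segment \<open>I\<close> the volume of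
  \<open>K + t I\<close> is affine in \<open>t\<close>, so for a sum \<open>Z\<close> of segments \<open>I\<^sub>i\<close> (\<open>i \<in> M\<close>) it is a polynomial
  \<open>\<Sum>a\<^sub>S(K) t\<^bsup>|S|\<^esup>\<close> over \<open>S \<subseteq> M\<close>, where \<open>a\<^sub>S(K)\<close> is the leading coefficient of the volume of
  \<open>K + t Z\<^sub>S\<close>, \<open>Z\<^sub>S\<close> the sum of the segments in \<open>S\<close>. These coefficients replace the volumes of
  projections in Kubota's formula. Since \<open>C + t Z\<^sub>S\<close> is the symmetrization of \<open>K + t Z\<^sub>S\<close>, the
  Brunn--Minkowski inequality gives \<open>a\<^sub>S(K) \<le> a\<^sub>S(C)\<close>. For the upper bound the Rogers--Shephard
  covariogram argument is run on \<open>K + t Z\<^sub>S\<close> and \<open>K + \<tau> Z\<^sub>S\<close> with \<open>\<tau>\<close> much smaller than \<open>t\<close>, and both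
  parameters tend to infinity. The ball is a limit of zonotopes, namely of Riemann sums of
  \<open>\<integral>|w \<bullet> x| dx\<close> over the ball; hence the Steiner polynomial of \<open>K\<close> exists and its coefficients, the
  quermassintegrals up to binomial factors, inherit both inequalities. For a simplex the
  intersections \<open>S \<inter> (x + S)\<close> are homothets of \<open>S\<close>, so the covariogram argument is an equality.
\<close>

section \<open>The Brunn--Minkowski inequality\<close>

text \<open>Applied as it stands to \<open>K + t Z\<close>, the Rogers--Shephard argument would give
  the constant binom(2n, n). The constant for k comes from the fact that only k of the n dimensions
  scale with K: vol(s K + t Z) >= \<alpha> t^j s^k with j + k = n, where \<alpha> is the leading
  coefficient and j the number of segments. Weighting the layers r (K - K) + (t - \<tau>) Z by k (1
  - r)^(k-1) produces the Beta integral k B(k+1, k) = 1 / binom(2k, k), and 2^k appears when K - K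
  is written as 2 C. Two scales are used because \<tau> = t would remove the summand (t - \<tau>) Z
  that keeps the layers large, while for \<tau> = o(t) the loss (1 - \<tau>/t)^j disappears in the
  limit.

  The inequalities hold for each S separately, so they survive summation over all S with |S| = j.
  Since the mixed volume is a definite description, the whole expansion for K, ..., K, B, ..., B has
  to be exhibited, including the boundary case where K gets the factor 0; it is obtained from the
  Steiner polynomial by counting index words.\<close>

abbreviation dil :: "real \<Rightarrow> 'a::real_vector set \<Rightarrow> 'a set" where
  "dil t A \<equiv> (\<lambda>x. t *\<^sub>R x) ` A"

lemma compact_set_plus:
  fixes A B :: "'a::real_normed_vector set"
  assumes "compact A" "compact B" shows "compact (A + B)"
proof -
  have "A + B = (\<Union>x\<in>A. \<Union>y\<in>B. {x + y})" by (auto simp: set_plus_def)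
  then show ?thesis using compact_sums'[OF assms] by simp
qed

lemma dil_set_plus: "dil t (A + B) = dil t A + dil t B"
  by (force simp: set_plus_def scaleR_add_right image_iff)

lemma dil_dil: "dil s (dil t A) = dil (s * t) A"
  by (simp add: image_image)

lemma measure_dil:
  fixes A :: "'a::euclidean_space set"
  assumes "0 \<le> t" shows "measure lebesgue (dil t A) = t ^ DIM('a) * measure lebesgue A"
  using measure_lebesgue_affine[of t 0 A] assms by simp

lemma measure_mono_compact:
  fixes A B :: "'a::euclidean_space set"
  assumes "A \<subseteq> B" "compact A" "compact B"
  shows "measure lebesgue A \<le> measure lebesgue B"
  by (rule measure_mono_fmeasurable)
    (use assms in \<open>auto simp: lmeasurable_compact fmeasurableD\<close>)

section \<open>Cutting a compact set by coordinate half-spaces\<close>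

lemma measure_half_space_split:
  fixes F :: "'a::euclidean_space set"
  assumes "F \<in> lmeasurable" "i \<in> Basis"
  shows "measure lebesgue F = measure lebesgue (F \<inter> {x. x \<bullet> i \<le> c}) + measure lebesgue (F \<inter> {x. c \<le> x \<bullet> i})"
proof -
  have 1: "F \<inter> {x. x \<bullet> i \<le> c} \<in> lmeasurable" "F \<inter> {x. c \<le> x \<bullet> i} \<in> lmeasurable"
    using assms by (auto intro!: fmeasurable_Int_fmeasurable simp: lborelD closed_halfspace_component_le closed_halfspace_component_ge borel_closed)
  have "negligible {x. x \<bullet> i = c}"
    using negligible_standard_hyperplane[OF assms(2)] .
  then have "negligible ((F \<inter> {x. x \<bullet> i \<le> c}) \<inter> (F \<inter> {x. c \<le> x \<bullet> i}))"
    by (rule negligible_subset) auto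
  moreover have "F = (F \<inter> {x. x \<bullet> i \<le> c}) \<union> (F \<inter> {x. c \<le> x \<bullet> i})" by auto
  ultimately show ?thesis
    using measure_Un3[OF 1] negligible_imp_measure0 by (metis diff_zero)
qed

text \<open>Moving the cut changes the volume by that of the slab of \<open>F\<close> between the
  two hyperplanes, and a thin slab of a bounding box has arbitrarily small volume.\<close>

lemma continuous_on_measure_half_space:
  fixes F :: "'a::euclidean_space set"
  assumes F: "compact F" and i: "i \<in> Basis"
  shows "continuous_on UNIV (\<lambda>c. measure lebesgue (F \<inter> {x. x \<bullet> i \<le> c}))"
proof -
  obtain a b where ab: "F \<subseteq> cbox a b"
    using bounded_subset_cbox_symmetric[OF compact_imp_bounded[OF F]] by blast
  have cp: "compact (F \<inter> {x. x \<bullet> i \<le> c})" for c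
    using F by (intro compact_Int_closed closed_halfspace_component_le)
  have key: "measure lebesgue (F \<inter> {x. x \<bullet> i \<le> d}) - measure lebesgue (F \<inter> {x. x \<bullet> i \<le> c}) \<le>
      measure lebesgue (F \<inter> {x. c \<le> x \<bullet> i \<and> x \<bullet> i \<le> d})" if "c \<le> d" for c d
  proof -
    have 1: "F \<inter> {x. c \<le> x \<bullet> i \<and> x \<bullet> i \<le> d} = F \<inter> {x. x \<bullet> i \<le> d} \<inter> {x. c \<le> x \<bullet> i}" by auto
    have 2: "F \<inter> {x. x \<bullet> i \<le> d} \<inter> {x. x \<bullet> i \<le> c} = F \<inter> {x. x \<bullet> i \<le> c}" using that by auto
    show ?thesis
      using measure_half_space_split[OF lmeasurable_compact[OF cp[of d]] i, of c] unfolding 1 2 by simp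
  qed
  have mono: "measure lebesgue (F \<inter> {x. x \<bullet> i \<le> c}) \<le> measure lebesgue (F \<inter> {x. x \<bullet> i \<le> d})"
    if "c \<le> d" for c d
    by (rule measure_mono_compact) (use cp that in auto)
  show ?thesis
  proof (rule continuous_at_imp_continuous_on, intro ballI)
    fix c :: real
    show "isCont (\<lambda>c. measure lebesgue (F \<inter> {x. x \<bullet> i \<le> c})) c"
    unfolding continuous_at_eps_delta
    proof (intro allI impI)
      fix e :: real assume "0 < e"
      then obtain d where d: "0 < d" "measure lborel (cbox a b \<inter> {x. \<bar>x\<bullet>i - c\<bar> \<le> d}) < e"
        using content_doublesplit[OF _ i] by metis
      have slab: "measure lebesgue (F \<inter> {x. p \<le> x \<bullet> i \<and> x \<bullet> i \<le> q}) < e"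
        if "c - d \<le> p" "q \<le> c + d" for p q
      proof -
        have "{x. \<bar>x\<bullet>i - c\<bar> \<le> d} = {x. x \<bullet> i \<le> c + d} \<inter> {x. c - d \<le> x \<bullet> i}" by auto
        then have "closed {x. \<bar>x\<bullet>i - c\<bar> \<le> d}"
          by (simp add: closed_Int closed_halfspace_component_le closed_halfspace_component_ge)
        then have c1: "compact (cbox a b \<inter> {x. \<bar>x\<bullet>i - c\<bar> \<le> d})"
          by (intro compact_Int_closed compact_cbox)
        have c2: "compact (F \<inter> ({x. x \<bullet> i \<le> q} \<inter> {x. p \<le> x \<bullet> i}))"
          by (intro compact_Int_closed F closed_Int closed_halfspace_component_le closed_halfspace_component_ge)
        have "F \<inter> {x. p \<le> x \<bullet> i \<and> x \<bullet> i \<le> q} = F \<inter> ({x. x \<bullet> i \<le> q} \<inter> {x. p \<le> x \<bullet> i})" by auto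
        then have "measure lebesgue (F \<inter> {x. p \<le> x \<bullet> i \<and> x \<bullet> i \<le> q}) \<le>
             measure lebesgue (cbox a b \<inter> {x. \<bar>x\<bullet>i - c\<bar> \<le> d})"
          using measure_mono_compact[OF _ c2 c1] ab that by fastforce
        also have "\<dots> = measure lborel (cbox a b \<inter> {x. \<bar>x\<bullet>i - c\<bar> \<le> d})"
          using c1 by (simp add: borel_compact)
        finally show ?thesis using d by simp
      qed
      show "\<exists>d>0. \<forall>x'. dist x' c < d \<longrightarrow> dist (measure lebesgue (F \<inter> {x. x \<bullet> i \<le> x'})) (measure lebesgue (F \<inter> {x. x \<bullet> i \<le> c})) < e"
      proof (intro exI[of _ d] conjI allI impI d(1))
        fix x' assume "dist x' c < d"
        then have x': "\<bar>x' - c\<bar> < d" by (simp add: dist_real_def)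
        show "dist (measure lebesgue (F \<inter> {x. x \<bullet> i \<le> x'})) (measure lebesgue (F \<inter> {x. x \<bullet> i \<le> c})) < e"
        proof (cases "x' \<le> c")
          case True
          then show ?thesis using key[of x' c] mono[of x' c] slab[of x' c] x' d by (simp add: dist_real_def)
        next
          case False
          then show ?thesis using key[of c x'] mono[of c x'] slab[of c x'] x' d by (simp add: dist_real_def)
        qed
      qed
    qed
  qed
qed

lemma half_space_cut:
  fixes F :: "'a::euclidean_space set"
  assumes F: "compact F" and i: "i \<in> Basis" and v: "0 \<le> v" "v \<le> measure lebesgue F"
  obtains c where "measure lebesgue (F \<inter> {x. x \<bullet> i \<le> c}) = v"
proof -
  obtain a where a: "F \<subseteq> cbox (-a) a"
    using bounded_subset_cbox_symmetric[OF compact_imp_bounded[OF F]] by blast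
  \<comment> \<open>The extra 1 makes the cut at \<open>-R\<close> empty, so that the intermediate
    value theorem starts from volume 0.\<close>
  define R where "R = \<bar>a \<bullet> i\<bar> + 1"
  have R: "-R < x \<bullet> i \<and> x \<bullet> i \<le> R" if "x \<in> F" for x
    using that a i unfolding R_def by (force simp: mem_box)
  have "F \<inter> {x. x \<bullet> i \<le> -R} = {}" "F \<inter> {x. x \<bullet> i \<le> R} = F"
    using R by (force, blast)
  then have "\<exists>c\<ge>-R. c \<le> R \<and> measure lebesgue (F \<inter> {x. x \<bullet> i \<le> c}) = v"
    using v continuous_on_subset[OF continuous_on_measure_half_space[OF F i]]
    by (intro IVT') (auto simp: R_def)
  then show ?thesis using that by blast
qed

section \<open>Finite families of non-overlapping boxes and the Hadwiger--Ohmann induction\<close>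

text \<open>Nonempty interiors make a nonempty family have positive volume, so that volume ratios
  can be formed. Only the interiors are disjoint, since the pieces of a cut share faces with their
  neighbours.\<close>

definition box_family :: "'a::euclidean_space set set \<Rightarrow> bool" where
  "box_family D \<longleftrightarrow> finite D \<and> (\<forall>d\<in>D. interior d \<noteq> {} \<and> (\<exists>a b. d = cbox a b)) \<and>
     pairwise (\<lambda>A B. interior A \<inter> interior B = {}) D"

lemma box_family_compact: "box_family D \<Longrightarrow> compact (\<Union>D)"
  unfolding box_family_def by (intro compact_Union) auto

lemma box_family_measure_pos:
  fixes D :: "'a::euclidean_space set set"
  assumes "box_family D" "D \<noteq> {}" shows "0 < measure lebesgue (\<Union>D)"
proof -
  obtain d where d1: "d \<in> D" using assms(2) by blast
  then obtain a b where "d = cbox a b" "interior d \<noteq> {}"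
    using assms(1) unfolding box_family_def by metis
  note d = d1 this
  have "box a b \<noteq> {}" using d by simp
  then have "0 < measure lborel (cbox a b)" using content_lt_nz[of a b] content_eq_0_interior[of a b] by simp
  also have "measure lborel (cbox a b) = measure lebesgue d" using d by simp
  also have "\<dots> \<le> measure lebesgue (\<Union>D)"
    by (rule measure_mono_compact[OF _ _ box_family_compact[OF assms(1)]])
       (use d(1) in blast, simp only: d(2) compact_cbox)
  finally show ?thesis .
qed

text \<open>Flat pieces are discarded: this keeps the result a \<open>box_family\<close> and lets
  the number of boxes drop, which drives the induction.\<close>

definition box_cut :: "'a::euclidean_space set \<Rightarrow> 'a set set \<Rightarrow> 'a set set" where
  "box_cut H D = {d \<in> (\<lambda>d. d \<inter> H) ` D. interior d \<noteq> {}}"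

text \<open>Each box leaves at most one piece on the chosen side, and a box whose piece is flat
  leaves none. The discarded pieces are finitely many boxes without interior, hence
  negligible.\<close>

lemma box_family_cut:
  fixes D :: "'a::euclidean_space set set"
  assumes D: "box_family D" and H: "H = {x. x \<bullet> i \<le> c} \<or> H = {x. c \<le> x \<bullet> i}" and i: "i \<in> Basis"
  defines "D' \<equiv> box_cut H D"
  shows "box_family D'" "\<Union>D' \<subseteq> \<Union>D \<inter> H"
    "measure lebesgue (\<Union>D') = measure lebesgue (\<Union>D \<inter> H)"
    "card D' \<le> card D"
    "e \<in> D \<Longrightarrow> interior (e \<inter> H) = {} \<Longrightarrow> card D' < card D"
proof -
  note D'_def = D'_def[unfolded box_cut_def]
  have fin: "finite D" using D by (simp add: box_family_def)
  have box: "\<exists>a b. d \<inter> H = cbox a b" if d: "d \<in> D" for d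
  proof -
    obtain a b where "d = cbox a b" using d D unfolding box_family_def by metis
    then have "d \<inter> {x. x \<bullet> i \<le> c} = cbox a (\<Sum>j\<in>Basis. (if j = i then min (b\<bullet>i) c else b\<bullet>j) *\<^sub>R j)"
      "d \<inter> {x. c \<le> x \<bullet> i} = cbox (\<Sum>j\<in>Basis. (if j = i then max (a\<bullet>i) c else a\<bullet>j) *\<^sub>R j) b"
      using interval_split[OF i, of a b c] by simp_all
    then show ?thesis using H by blast
  qed
  have pw: "interior A \<inter> interior B = {}" if "A \<in> D'" "B \<in> D'" "A \<noteq> B" for A B
  proof -
    obtain d e where de: "d \<in> D" "e \<in> D" "A = d \<inter> H" "B = e \<inter> H" using \<open>A \<in> D'\<close> \<open>B \<in> D'\<close> by (auto simp: D'_def)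
    then have "interior d \<inter> interior e = {}"
      using D \<open>A \<noteq> B\<close> unfolding box_family_def pairwise_def by metis
    moreover have "interior A \<subseteq> interior d" "interior B \<subseteq> interior e"
      using de by (simp_all add: interior_mono)
    ultimately show ?thesis by blast
  qed
  show bf: "box_family D'"
    unfolding box_family_def
    using fin box pw by (auto simp: D'_def pairwise_def)
  show sub: "\<Union>D' \<subseteq> \<Union>D \<inter> H" by (auto simp: D'_def)
  have closedH: "closed H" using H by (auto simp: closed_halfspace_component_le closed_halfspace_component_ge)
  define N where "N = \<Union>{d \<in> (\<lambda>d. d \<inter> H) ` D. interior d = {}}"
  have "negligible N" unfolding N_def
  proof (rule negligible_Union)
    show "finite {d \<in> (\<lambda>d. d \<inter> H) ` D. interior d = {}}" using fin by simp
    fix t assume t: "t \<in> {d \<in> (\<lambda>d. d \<inter> H) ` D. interior d = {}}"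
    then obtain d where "d \<in> D" "t = d \<inter> H" by blast
    then obtain a b where "t = cbox a b" using box by metis
    then show "negligible t" using t negligible_interval(1)[of a b] by simp
  qed
  moreover have "x \<in> N" if x: "x \<in> \<Union>D \<inter> H" "x \<notin> \<Union>D'" for x
  proof -
    obtain d where d: "d \<in> D" "x \<in> d \<inter> H" using x(1) by blast
    then have "interior (d \<inter> H) = {}" using x(2) unfolding D'_def by blast
    then show ?thesis unfolding N_def using d by blast
  qed
  then have "(\<Union>D \<inter> H - \<Union>D') \<union> (\<Union>D' - \<Union>D \<inter> H) \<subseteq> N" using sub by blast
  ultimately have neg: "negligible ((\<Union>D \<inter> H - \<Union>D') \<union> (\<Union>D' - \<Union>D \<inter> H))" by (rule negligible_subset)
  have "\<Union>D \<inter> H \<in> lmeasurable"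
    by (intro lmeasurable_compact compact_Int_closed box_family_compact D closedH)
  then show "measure lebesgue (\<Union>D') = measure lebesgue (\<Union>D \<inter> H)"
    using measure_negligible_symdiff neg by blast
  have "card D' \<le> card ((\<lambda>d. d \<inter> H) ` D)" unfolding D'_def using fin by (intro card_mono) auto
  then show "card D' \<le> card D" using card_image_le[OF fin, of "\<lambda>d. d \<inter> H"] by linarith
  show "card D' < card D" if "e \<in> D" "interior (e \<inter> H) = {}"
  proof -
    have "D' \<subseteq> (\<lambda>d. d \<inter> H) ` (D - {e})" using that by (auto simp: D'_def)
    then have "card D' \<le> card (D - {e})"
      using fin by (meson card_image_le card_mono finite_Diff finite_imageI le_trans)
    then show ?thesis using that fin by (metis card_Diff1_less le_less_trans)
  qed
qed

text \<open>The half sum contains the box whose corners are the averaged corners; its edges are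
  arithmetic means, so the arithmetic-geometric mean inequality applies in each coordinate.\<close>

lemma box_half_sum_measure:
  fixes a b c d :: "'a::euclidean_space"
  assumes "box a b \<noteq> {}" "box c d \<noteq> {}"
  shows "sqrt (measure lebesgue (cbox a b) * measure lebesgue (cbox c d)) \<le>
         measure lebesgue (dil (1/2) (cbox a b + cbox c d))"
proof -
  have ab: "a \<bullet> i < b \<bullet> i" "c \<bullet> i < d \<bullet> i" if "i \<in> Basis" for i
    using assms that by (auto simp: box_ne_empty)
  have sub: "cbox ((1/2) *\<^sub>R (a + c)) ((1/2) *\<^sub>R (b + d)) \<subseteq> dil (1/2) (cbox a b + cbox c d)"
  proof
    fix z assume z: "z \<in> cbox ((1/2) *\<^sub>R (a + c)) ((1/2) *\<^sub>R (b + d))"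
    \<comment> \<open>In each coordinate the offset of \<open>2 z\<close> from \<open>a + c\<close>
      is split between \<open>x\<close> and \<open>y\<close> in the ratio of the two edge lengths,
      so neither leaves its box.\<close>
    define x where "x = (\<Sum>i\<in>Basis. (a \<bullet> i + (z \<bullet> i - (a \<bullet> i + c \<bullet> i) / 2) * (2 * (b \<bullet> i - a \<bullet> i) / (b \<bullet> i - a \<bullet> i + (d \<bullet> i - c \<bullet> i)))) *\<^sub>R i)"
    define y where "y = 2 *\<^sub>R z - x"
    have "x \<in> cbox a b \<and> y \<in> cbox c d"
      unfolding mem_box ball_conj_distrib[symmetric]
    proof (intro ballI conjI)
      fix i :: 'a assume i: "i \<in> Basis"
      define p where "p = b \<bullet> i - a \<bullet> i"
      define q where "q = d \<bullet> i - c \<bullet> i"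
      define w where "w = z \<bullet> i - (a \<bullet> i + c \<bullet> i) / 2"
      have pq: "0 < p" "0 < q" using ab[OF i] by (auto simp: p_def q_def)
      have w: "0 \<le> w" "2 * w \<le> p + q" using z i by (auto simp: mem_box w_def p_def q_def inner_simps field_simps)
      have xi: "x \<bullet> i = a \<bullet> i + w * (2 * p / (p + q))"
        using i by (simp add: x_def w_def p_def q_def)
      have yi: "y \<bullet> i = c \<bullet> i + w * (2 * q / (p + q))"
      proof -
        have "y \<bullet> i = c \<bullet> i + 2 * w - w * (2 * p / (p + q))"
          by (simp add: y_def inner_diff_left xi w_def field_simps)
        also have "2 * w = w * (2 * p / (p + q)) + w * (2 * q / (p + q))"
        proof -
          have e: "2 * p / (p + q) + 2 * q / (p + q) = 2"
            using pq by (simp add: divide_simps)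
          show ?thesis unfolding distrib_left[symmetric] e by simp
        qed
        finally show ?thesis by simp
      qed
      have le: "w * (2 * r / (p + q)) \<le> r" if "0 < r" for r
        using w pq that mult_right_mono[OF w(2), of r] by (simp add: field_simps)
      show "a \<bullet> i \<le> x \<bullet> i" "c \<bullet> i \<le> y \<bullet> i" using xi yi w pq by auto
      show "x \<bullet> i \<le> b \<bullet> i" "y \<bullet> i \<le> d \<bullet> i" using xi yi le[of p] le[of q] pq by (auto simp: p_def q_def)
    qed
    moreover have "z = (1/2) *\<^sub>R (x + y)" by (simp add: y_def)
    ultimately show "z \<in> dil (1/2) (cbox a b + cbox c d)" by blast
  qed
  have "sqrt (measure lebesgue (cbox a b) * measure lebesgue (cbox c d)) =
     sqrt (\<Prod>i\<in>Basis. (b \<bullet> i - a \<bullet> i) * (d \<bullet> i - c \<bullet> i))"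
    using ab by (simp add: less_imp_le inner_diff_left prod.distrib)
  also have "\<dots> = (\<Prod>i\<in>Basis. sqrt ((b \<bullet> i - a \<bullet> i) * (d \<bullet> i - c \<bullet> i)))"
    by (induction rule: infinite_finite_induct) (auto simp: real_sqrt_mult)
  also have "\<dots> \<le> (\<Prod>i\<in>Basis. ((1/2) *\<^sub>R (b + d) - (1/2) *\<^sub>R (a + c)) \<bullet> i)"
  proof (intro prod_mono conjI)
    fix i :: 'a assume i: "i \<in> Basis"
    show "sqrt ((b \<bullet> i - a \<bullet> i) * (d \<bullet> i - c \<bullet> i)) \<le> ((1/2) *\<^sub>R (b + d) - (1/2) *\<^sub>R (a + c)) \<bullet> i"
      using arith_geo_mean_sqrt[of "b \<bullet> i - a \<bullet> i" "d \<bullet> i - c \<bullet> i"] ab[OF i] by (simp add: inner_simps field_simps)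
  qed (use ab in \<open>auto intro!: mult_nonneg_nonneg simp: less_imp_le\<close>)
  also have "\<dots> = measure lebesgue (cbox ((1/2) *\<^sub>R (a + c)) ((1/2) *\<^sub>R (b + d)))"
  proof -
    have "\<forall>i\<in>Basis. ((1/2) *\<^sub>R (a + c)) \<bullet> i \<le> ((1/2) *\<^sub>R (b + d)) \<bullet> i"
      using ab by (force simp: inner_simps)
    then show ?thesis by simp
  qed
  also have "\<dots> \<le> measure lebesgue (dil (1/2) (cbox a b + cbox c d))"
    by (intro measure_mono_compact sub compact_scaling compact_set_plus) auto
  finally show ?thesis .
qed

text \<open>
  A hyperplane separating two boxes of \<open>D\<close> is matched by a parallel one cutting \<open>E\<close> in the same volume
  ratio; the half sums of corresponding pieces lie on different sides of the hyperplane midway.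
\<close>

lemma hadwiger_ohmann_step:
  fixes D E :: "'a::euclidean_space set set"
  assumes D: "box_family D" and E: "box_family E" and ne: "E \<noteq> {}" and card2: "2 \<le> card D"
    and IH: "\<And>D' E' :: 'a set set. \<lbrakk>card D' + card E' < card D + card E; box_family D'; box_family E'; D' \<noteq> {}; E' \<noteq> {}\<rbrakk>
      \<Longrightarrow> sqrt (measure lebesgue (\<Union>D') * measure lebesgue (\<Union>E')) \<le> measure lebesgue (dil (1/2) (\<Union>D' + \<Union>E'))"
  shows "sqrt (measure lebesgue (\<Union>D) * measure lebesgue (\<Union>E)) \<le> measure lebesgue (dil (1/2) (\<Union>D + \<Union>E))"
proof -
  have "\<exists>d e i c. d \<in> D \<and> e \<in> D \<and> i \<in> Basis \<and> d \<subseteq> {x. x \<bullet> i \<le> c} \<and> e \<subseteq> {x. c \<le> x \<bullet> i}"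
  proof -
    have "finite D" "\<not> card D \<le> Suc 0" using D card2 by (auto simp: box_family_def)
    then obtain d e where de: "d \<in> D" "e \<in> D" "d \<noteq> e"
      using card_le_Suc0_iff_eq[of D] by auto
    obtain a b where d: "d = cbox a b" "box a b \<noteq> {}" using D de(1) unfolding box_family_def by (metis interior_cbox)
    obtain a' b' where e: "e = cbox a' b'" "box a' b' \<noteq> {}" using D de(2) unfolding box_family_def by (metis interior_cbox)
    have "interior d \<inter> interior e = {}" using D de unfolding box_family_def pairwise_def by blast
    then have "box a b \<inter> box a' b' = {}" using d e by simp
    then obtain i where i: "i \<in> Basis" and "b\<bullet>i \<le> a'\<bullet>i \<or> b'\<bullet>i \<le> a\<bullet>i"
      unfolding disjoint_interval using d(2) e(2) unfolding box_ne_empty by fastforce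
    then consider "b\<bullet>i \<le> a'\<bullet>i" | "b'\<bullet>i \<le> a\<bullet>i" by blast
    then show ?thesis
    proof cases
      case 1
      have "d \<subseteq> {x. x \<bullet> i \<le> b\<bullet>i}" "e \<subseteq> {x. b\<bullet>i \<le> x \<bullet> i}"
        using 1 i d e by (force simp: mem_box)+
      then show ?thesis using de i by blast
    next
      case 2
      have "e \<subseteq> {x. x \<bullet> i \<le> b'\<bullet>i}" "d \<subseteq> {x. b'\<bullet>i \<le> x \<bullet> i}"
        using 2 i d e by (force simp: mem_box)+
      then show ?thesis using de i by blast
    qed
  qed
  then obtain d e i c where de: "d \<in> D" "e \<in> D" and i: "i \<in> Basis"
    and dc: "d \<subseteq> {x. x \<bullet> i \<le> c}" and ec: "e \<subseteq> {x. c \<le> x \<bullet> i}" by blast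
  define L where "L = (\<lambda>c::real. {x::'a. x \<bullet> i \<le> c})"
  define U where "U = (\<lambda>c::real. {x::'a. c \<le> x \<bullet> i})"
  have LU: "L c = {x. x \<bullet> i \<le> c}" "U c = {x. c \<le> x \<bullet> i}" for c by (simp_all add: L_def U_def)
  have cutL: "box_family (box_cut (L c) F)" "\<Union>(box_cut (L c) F) \<subseteq> \<Union>F \<inter> L c"
    "measure lebesgue (\<Union>(box_cut (L c) F)) = measure lebesgue (\<Union>F \<inter> L c)" "card (box_cut (L c) F) \<le> card F"
    and cutL': "\<And>e. e \<in> F \<Longrightarrow> interior (e \<inter> L c) = {} \<Longrightarrow> card (box_cut (L c) F) < card F"
    if "box_family F" for F c
    by (rule box_family_cut[OF that disjI1[OF LU(1)] i]; assumption)+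
  have cutU: "box_family (box_cut (U c) F)" "\<Union>(box_cut (U c) F) \<subseteq> \<Union>F \<inter> U c"
    "measure lebesgue (\<Union>(box_cut (U c) F)) = measure lebesgue (\<Union>F \<inter> U c)" "card (box_cut (U c) F) \<le> card F"
    and cutU': "\<And>e. e \<in> F \<Longrightarrow> interior (e \<inter> U c) = {} \<Longrightarrow> card (box_cut (U c) F) < card F"
    if "box_family F" for F c
    by (rule box_family_cut[OF that disjI2[OF LU(2)] i]; assumption)+
  have hyp: "interior S = {}" if "S \<subseteq> {x. x \<bullet> i = c}" for S c
  proof -
    have "interior {x. i \<bullet> x = c} = {}" using i by (intro interior_hyperplane) auto
    then show ?thesis using interior_mono[OF that] by (simp add: inner_commute)
  qed
  have int: "interior d \<noteq> {}" "interior e \<noteq> {}" using D de by (auto simp: box_family_def)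
  \<comment> \<open>\<open>e\<close> meets the lower half-space only inside the hyperplane, so it
    disappears from that cut; \<open>d\<close> likewise disappears from the upper one. Cutting
    \<open>E\<close> does not increase its number of boxes, so the induction hypothesis applies on
    both sides.\<close>
  have cardL: "card (box_cut (L c) D) < card D"
    by (rule cutL'[OF D de(2) hyp[of _ c]]) (use ec in \<open>force simp: LU\<close>)
  have cardU: "card (box_cut (U c) D) < card D"
    by (rule cutU'[OF D de(1) hyp[of _ c]]) (use dc in \<open>force simp: LU\<close>)
  have "d = d \<inter> L c" "e = e \<inter> U c" using dc ec by (auto simp: LU)
  then have neDL: "box_cut (L c) D \<noteq> {}" and neDU: "box_cut (U c) D \<noteq> {}" using int de unfolding box_cut_def by blast+
  define m where "m = measure lebesgue (\<Union>D)"
  define M where "M = measure lebesgue (\<Union>E)"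
  define m1 where "m1 = measure lebesgue (\<Union>(box_cut (L c) D))"
  define m2 where "m2 = measure lebesgue (\<Union>(box_cut (U c) D))"
  have m_pos: "0 < m1" "0 < m2" "0 < M"
    unfolding m1_def m2_def M_def using box_family_measure_pos cutL(1)[OF D] cutU(1)[OF D] neDL neDU E ne by blast+
  have m_eq: "m = m1 + m2"
    using measure_half_space_split[OF lmeasurable_compact[OF box_family_compact[OF D]] i, of c]
    unfolding m_def m1_def m2_def cutL(3)[OF D] cutU(3)[OF D] unfolding LU .
  obtain c' where c': "measure lebesgue (\<Union>E \<inter> L c') = M * m1 / m"
  proof (rule half_space_cut[OF box_family_compact[OF E] i])
    show "0 \<le> M * m1 / m" using m_pos m_eq by simp
    show "M * m1 / m \<le> measure lebesgue (\<Union>E)" using m_pos m_eq by (simp add: M_def[symmetric] field_simps)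
  qed (simp add: LU)
  have M1: "measure lebesgue (\<Union>(box_cut (L c') E)) = M * m1 / m" using c' cutL(3)[OF E] by simp
  have M2: "measure lebesgue (\<Union>(box_cut (U c') E)) = M * m2 / m"
  proof -
    have "M = M * m1 / m + measure lebesgue (\<Union>(box_cut (U c') E))"
      using measure_half_space_split[OF lmeasurable_compact[OF box_family_compact[OF E]] i, of c']
      unfolding cutU(3)[OF E] using c' unfolding M_def[symmetric] LU by simp
    moreover have "M * m1 / m + M * m2 / m = M * m / m" unfolding m_eq by (simp add: distrib_left add_divide_distrib)
    moreover have "M * m / m = M" using m_pos m_eq by simp
    ultimately show ?thesis by linarith
  qed
  have neEL: "box_cut (L c') E \<noteq> {}" and neEU: "box_cut (U c') E \<noteq> {}"
    using M1 M2 m_pos m_eq by auto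
  \<comment> \<open>A piece of volume \<open>u\<close> is matched with one of volume
    \<open>M * u / m\<close>, and their geometric mean is linear in \<open>u\<close>. The two pieces
    therefore add up to sqrt(m M) without loss.\<close>
  have sq: "sqrt (u * (M * u / m)) = u * sqrt (M / m)" if "0 < u" for u
  proof -
    have "u * (M * u / m) = u\<^sup>2 * (M / m)" by (simp add: power2_eq_square)
    then have "sqrt (u * (M * u / m)) = sqrt (u\<^sup>2 * (M / m))" by (rule arg_cong)
    also have "\<dots> = sqrt (u\<^sup>2) * sqrt (M / m)" by (rule real_sqrt_mult)
    also have "sqrt (u\<^sup>2) = u" using that by simp
    finally show ?thesis .
  qed
  let ?T = "dil (1/2) (\<Union>D + \<Union>E)"
  have cT: "compact ?T" by (intro compact_scaling compact_set_plus box_family_compact D E)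
  have cTL: "compact (?T \<inter> L ((c + c') / 2))" and cTU: "compact (?T \<inter> U ((c + c') / 2))"
    unfolding LU by (intro compact_Int_closed cT closed_halfspace_component_le closed_halfspace_component_ge)+
  have "sqrt (m * M) = (m1 + m2) * sqrt (M / m)"
    using m_pos m_eq real_sqrt_mult[of "m\<^sup>2" "M / m"] by (simp add: power2_eq_square)
  also have "\<dots> = sqrt (m1 * (M * m1 / m)) + sqrt (m2 * (M * m2 / m))"
    using sq m_pos by (simp add: distrib_right)
  also have "sqrt (m1 * (M * m1 / m)) \<le> measure lebesgue (dil (1/2) (\<Union>(box_cut (L c) D) + \<Union>(box_cut (L c') E)))"
    unfolding m1_def M1[symmetric, unfolded m1_def]
    by (rule IH) (use cardL cutL[OF D] cutL[OF E] neDL neEL in \<open>auto intro: add_less_le_mono\<close>)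
  also have "\<dots> \<le> measure lebesgue (?T \<inter> L ((c + c') / 2))"
  proof (rule measure_mono_compact[OF _ _ cTL])
    show "dil (1/2) (\<Union>(box_cut (L c) D) + \<Union>(box_cut (L c') E)) \<subseteq> ?T \<inter> L ((c + c') / 2)"
    proof
      fix z assume "z \<in> dil (1/2) (\<Union>(box_cut (L c) D) + \<Union>(box_cut (L c') E))"
      then obtain x y where "x \<in> \<Union>(box_cut (L c) D)" "y \<in> \<Union>(box_cut (L c') E)" and z: "z = (1/2) *\<^sub>R (x + y)"
        by (elim imageE set_plus_elim) metis
      then have "x \<in> \<Union>D \<inter> L c" "y \<in> \<Union>E \<inter> L c'"
        using cutL(2)[OF D, of c] cutL(2)[OF E, of c'] by (metis subsetD)+
      then show "z \<in> ?T \<inter> L ((c + c') / 2)" using z by (auto simp: LU inner_simps)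
    qed
    show "compact (dil (1/2) (\<Union>(box_cut (L c) D) + \<Union>(box_cut (L c') E)))"
      by (intro compact_scaling compact_set_plus box_family_compact cutL D E)
  qed
  also have "sqrt (m2 * (M * m2 / m)) \<le> measure lebesgue (dil (1/2) (\<Union>(box_cut (U c) D) + \<Union>(box_cut (U c') E)))"
    unfolding m2_def M2[symmetric, unfolded m2_def]
    by (rule IH) (use cardU cutU[OF D] cutU[OF E] neDU neEU in \<open>auto intro: add_less_le_mono\<close>)
  also have "\<dots> \<le> measure lebesgue (?T \<inter> U ((c + c') / 2))"
  proof (rule measure_mono_compact[OF _ _ cTU])
    show "dil (1/2) (\<Union>(box_cut (U c) D) + \<Union>(box_cut (U c') E)) \<subseteq> ?T \<inter> U ((c + c') / 2)"
    proof
      fix z assume "z \<in> dil (1/2) (\<Union>(box_cut (U c) D) + \<Union>(box_cut (U c') E))"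
      then obtain x y where "x \<in> \<Union>(box_cut (U c) D)" "y \<in> \<Union>(box_cut (U c') E)" and z: "z = (1/2) *\<^sub>R (x + y)"
        by (elim imageE set_plus_elim) metis
      then have "x \<in> \<Union>D \<inter> U c" "y \<in> \<Union>E \<inter> U c'"
        using cutU(2)[OF D, of c] cutU(2)[OF E, of c'] by (metis subsetD)+
      then show "z \<in> ?T \<inter> U ((c + c') / 2)" using z by (auto simp: LU inner_simps)
    qed
    show "compact (dil (1/2) (\<Union>(box_cut (U c) D) + \<Union>(box_cut (U c') E)))"
      by (intro compact_scaling compact_set_plus box_family_compact cutU D E)
  qed
  also have "measure lebesgue (?T \<inter> L ((c + c') / 2)) + measure lebesgue (?T \<inter> U ((c + c') / 2)) = measure lebesgue ?T"
    unfolding LU by (rule measure_half_space_split[OF lmeasurable_compact[OF cT] i, symmetric])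
  finally show ?thesis by (simp add: m_def M_def)
qed

text \<open>Induction on the total number of boxes. Whichever family still has two boxes is the one
  to be separated, by the symmetry of the claim; two single boxes remain as the base case.\<close>

theorem hadwiger_ohmann:
  fixes D E :: "'a::euclidean_space set set"
  assumes "box_family D" "box_family E" "D \<noteq> {}" "E \<noteq> {}"
  shows "sqrt (measure lebesgue (\<Union>D) * measure lebesgue (\<Union>E)) \<le> measure lebesgue (dil (1/2) (\<Union>D + \<Union>E))"
  using assms
proof (induction "card D + card E" arbitrary: D E rule: less_induct)
  case less
  have "card D \<noteq> 0" "card E \<noteq> 0" using less.prems by (auto simp: box_family_def)
  then consider "2 \<le> card D" | "2 \<le> card E" | "card D = 1" "card E = 1" by linarith
  then show ?case
  proof cases
    case 1
    show ?thesis by (rule hadwiger_ohmann_step[OF less.prems(1,2,4) 1 less.hyps])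
  next
    case 2
    have "sqrt (measure lebesgue (\<Union>E) * measure lebesgue (\<Union>D)) \<le> measure lebesgue (dil (1/2) (\<Union>E + \<Union>D))"
      by (rule hadwiger_ohmann_step[OF less.prems(2,1,3) 2], rule less.hyps)
        (simp_all add: add.commute)
    then show ?thesis by (simp add: add.commute mult.commute)
  next
    case 3
    then obtain d e where "D = {d}" "E = {e}" by (auto simp: card_1_singleton_iff)
    moreover from this obtain a b a' b' where "d = cbox a b" "box a b \<noteq> {}" "e = cbox a' b'" "box a' b' \<noteq> {}"
      using less.prems(1,2) unfolding box_family_def by (metis interior_cbox singletonI)
    ultimately show ?thesis using box_half_sum_measure[of a b a' b'] by simp
  qed
qed

section \<open>From boxes to convex bodies\<close>

lemma open_inner_box_family:
  fixes G :: "'a::euclidean_space set"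
  assumes "open G" "bounded G" "0 \<le> v" "v < measure lebesgue G"
  obtains D where "box_family D" "D \<noteq> {}" "\<Union>D \<subseteq> G" "v < measure lebesgue (\<Union>D)"
proof -
  obtain w where w: "G \<subseteq> cbox (-w) w" using bounded_subset_cbox_symmetric assms(2) by blast
  have "G \<noteq> {}" using assms by auto
  then obtain x where "x \<in> G" by blast
  then have "x \<in> cbox (-w) w" using w by blast
  \<comment> \<open>Enlarging by \<open>One\<close> yields an open box that is visibly nonempty, as
    the covering lemma requires.\<close>
  then have "x \<in> box (-w - One) (w + One)"
    by (force simp: mem_box inner_simps)
  then have bne: "box (-w - One) (w + One) \<noteq> {}" by blast
  have w': "G \<subseteq> cbox (-w - One) (w + One)"
    using w by (fastforce simp: mem_box inner_simps)
  \<comment> \<open>Every point of \<open>G\<close> gets \<open>G\<close> itself as its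
    neighbourhood; each covering box is controlled by a point of \<open>G\<close> and so lies inside
    \<open>G\<close>.\<close>
  have g: "gauge (\<lambda>x. if x \<in> G then G else UNIV)" using assms(1) by (auto simp: gauge_def)
  obtain \<D> where \<D>: "countable \<D>"
    "\<And>K. K \<in> \<D> \<Longrightarrow> interior K \<noteq> {} \<and> (\<exists>c d. K = cbox c d)"
    "pairwise (\<lambda>A B. interior A \<inter> interior B = {}) \<D>"
    "\<And>K. K \<in> \<D> \<Longrightarrow> \<exists>x \<in> G \<inter> K. K \<subseteq> (if x \<in> G then G else UNIV)"
    "G \<subseteq> \<Union>\<D>"
    using covering_lemma[OF w' bne g] by metis
  have eq: "\<Union>\<D> = G" using \<D>(4,5) by fastforce
  then have ne: "\<D> \<noteq> {}" using \<open>G \<noteq> {}\<close> by auto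
  define F where "F n = from_nat_into \<D> ` {..n}" for n :: nat
  have F: "F n \<subseteq> \<D>" "finite (F n)" "F n \<noteq> {}" for n
    using from_nat_into[OF ne] by (auto simp: F_def)
  have bf: "box_family (F n)" for n
    unfolding box_family_def using F(1)[of n] F(2) \<D>(2) pairwise_subset[OF \<D>(3)] by blast
  have "(\<lambda>n. measure lebesgue (\<Union>(F n))) \<longlonglongrightarrow> measure lebesgue (\<Union>n. \<Union>(F n))"
  proof (rule Lim_measure_incseq)
    show "range (\<lambda>n. \<Union>(F n)) \<subseteq> sets lebesgue"
      using lmeasurable_compact[OF box_family_compact[OF bf]] by blast
    show "incseq (\<lambda>n. \<Union>(F n))" by (force simp: incseq_def F_def)
    have "(\<Union>n. \<Union>(F n)) \<subseteq> G" using F(1) eq by blast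
    moreover have "(\<Union>n. \<Union>(F n)) \<in> sets lebesgue"
      using lmeasurable_compact[OF box_family_compact[OF bf]] by blast
    ultimately have "emeasure lebesgue (\<Union>n. \<Union>(F n)) \<le> emeasure lebesgue G"
      using assms(1) by (intro emeasure_mono) auto
    then show "emeasure lebesgue (\<Union>n. \<Union>(F n)) \<noteq> \<infinity>"
      using fmeasurableD2[OF lmeasurable_open[OF assms(2,1)]] neq_top_trans by (simp add: infinity_ennreal_def)
  qed
  moreover have "(\<Union>n. \<Union>(F n)) = G"
  proof -
    have "(\<Union>n. F n) = range (from_nat_into \<D>)" by (auto simp: F_def)
    then have "(\<Union>n. F n) = \<D>" using range_from_nat_into[OF ne \<D>(1)] by simp
    then show ?thesis using eq by blast
  qed
  ultimately have "\<forall>\<^sub>F n in sequentially. v < measure lebesgue (\<Union>(F n))"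
    using assms(4) by (simp add: order_tendstoD)
  then obtain n where "v < measure lebesgue (\<Union>(F n))" by (auto simp: eventually_sequentially)
  then show ?thesis using that[OF bf F(3)] F(1) eq by blast
qed

text \<open>The geometric-mean form suits the later use, where \<open>B\<close> is the reflection of
  \<open>A\<close> and both volumes agree. The interior of a convex body carries its whole volume
  and is filled by box families up to any factor \<open>s < 1\<close>.\<close>

theorem brunn_minkowski_half:
  fixes A B :: "'a::euclidean_space set"
  assumes A: "compact A" "convex A" and B: "compact B" "convex B"
  shows "sqrt (measure lebesgue A * measure lebesgue B) \<le> measure lebesgue (dil (1/2) (A + B))"
proof (cases "measure lebesgue A = 0 \<or> measure lebesgue B = 0")
  case True
  then show ?thesis by auto
next
  case False
  then have pos: "0 < measure lebesgue A" "0 < measure lebesgue B"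
    by (auto simp: zero_less_measure_iff)
  have mi: "measure lebesgue (interior S) = measure lebesgue S" if "compact S" "convex S" for S :: "'a set"
    by (rule measure_interior[OF compact_imp_bounded[OF that(1)] negligible_convex_frontier[OF that(2)]])
  show ?thesis
  proof (rule field_le_mult_one_interval)
    fix s :: real assume s: "0 < s" "s < 1"
    have "0 \<le> s * measure lebesgue S" "s * measure lebesgue S < measure lebesgue (interior S)"
      if "0 < measure lebesgue S" "compact S" "convex S" for S :: "'a set"
      unfolding mi[OF that(2,3)] using s that(1) by simp_all
    note * = this
    have bdd: "bounded (interior A)" "bounded (interior B)"
      using A B bounded_subset[OF compact_imp_bounded interior_subset] by blast+
    obtain D where D: "box_family D" "D \<noteq> {}" "\<Union>D \<subseteq> interior A" "s * measure lebesgue A < measure lebesgue (\<Union>D)"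
      using open_inner_box_family[OF open_interior bdd(1) *[OF pos(1) A]] by blast
    obtain E where E: "box_family E" "E \<noteq> {}" "\<Union>E \<subseteq> interior B" "s * measure lebesgue B < measure lebesgue (\<Union>E)"
      using open_inner_box_family[OF open_interior bdd(2) *[OF pos(2) B]] by blast
    have "s * sqrt (measure lebesgue A * measure lebesgue B) = sqrt ((s * measure lebesgue A) * (s * measure lebesgue B))"
      using s by (simp add: real_sqrt_mult)
    also have "\<dots> \<le> sqrt (measure lebesgue (\<Union>D) * measure lebesgue (\<Union>E))"
      using D(4) E(4) s pos by (intro real_sqrt_le_mono mult_mono) auto
    also have "\<dots> \<le> measure lebesgue (dil (1/2) (\<Union>D + \<Union>E))"
      using hadwiger_ohmann D E by blast
    also have "\<dots> \<le> measure lebesgue (dil (1/2) (A + B))"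
    proof (rule measure_mono_compact)
      show "dil (1/2) (\<Union>D + \<Union>E) \<subseteq> dil (1/2) (A + B)"
        using D(3) E(3) interior_subset[of A] interior_subset[of B] by (intro image_mono set_plus_mono2) auto
    qed (intro compact_scaling compact_set_plus box_family_compact D E A B)+
    finally show "s * sqrt (measure lebesgue A * measure lebesgue B) \<le> measure lebesgue (dil (1/2) (A + B))" .
  qed
qed

section \<open>Sums with zonotopes\<close>

lemma measure_sum_translation:
  fixes A :: "'a::euclidean_space set"
  shows "measure lebesgue ({a} + A) = measure lebesgue A"
proof -
  have "{a} + A = (+) a ` A" by (auto simp: set_plus_def)
  then show ?thesis by (simp add: measure_translation)
qed

lemma dil_add_convex:
  fixes A :: "'a::real_vector set"
  assumes "convex A" "0 \<le> s" "0 \<le> t"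
  shows "dil s A + dil t A = dil (s + t) A"
proof (intro equalityI subsetI)
  fix z assume "z \<in> dil s A + dil t A"
  then obtain x y where xy: "x \<in> A" "y \<in> A" "z = s *\<^sub>R x + t *\<^sub>R y"
    by (auto elim!: set_plus_elim)
  show "z \<in> dil (s + t) A"
  proof (cases "s + t = 0")
    case True
    then have "s = 0" "t = 0" using assms by auto
    then show ?thesis using xy by auto
  next
    case False
    have "(s / (s + t)) *\<^sub>R x + (t / (s + t)) *\<^sub>R y \<in> A"
      using assms xy False by (intro convexD) (auto simp: add_divide_distrib[symmetric])
    moreover have "z = (s + t) *\<^sub>R ((s / (s + t)) *\<^sub>R x + (t / (s + t)) *\<^sub>R y)"
      using False xy by (simp add: scaleR_add_right)
    ultimately show ?thesis by blast
  qed
next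
  fix z assume "z \<in> dil (s + t) A"
  then show "z \<in> dil s A + dil t A" by (auto simp: scaleR_add_left)
qed

section \<open>The volume of a sum with one segment\<close>

text \<open>Cauchy's functional equation: monotonicity squeezes \<open>h (m t)\<close> between
  consecutive multiples of \<open>h 1\<close>, hence m |h t - t h 1| <= h 1 for every m.\<close>

lemma additive_mono_imp_linear:
  fixes h :: "real \<Rightarrow> real"
  assumes add: "\<And>s t. 0 \<le> s \<Longrightarrow> 0 \<le> t \<Longrightarrow> h (s + t) = h s + h t"
    and mono: "\<And>s t. 0 \<le> s \<Longrightarrow> s \<le> t \<Longrightarrow> h s \<le> h t" and t: "0 \<le> t"
  shows "h t = t * h 1"
proof -
  have h0: "h 0 = 0" using add[of 0 0] by simp
  have mult: "h (real m * s) = real m * h s" if "0 \<le> s" for m s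
  proof (induction m)
    case (Suc m)
    have "h (real m * s + s) = h (real m * s) + h s" using that by (intro add) auto
    then show ?case using Suc by (simp add: algebra_simps)
  qed (simp add: h0)
  have h1: "0 \<le> h 1" using mono[of 0 1] h0 by simp
  have "real m * \<bar>h t - t * h 1\<bar> \<le> h 1" for m :: nat
  proof -
    define k where "k = nat \<lfloor>real m * t\<rfloor>"
    have k: "real k \<le> real m * t" "real m * t \<le> real (Suc k)"
      using t by (simp_all add: k_def) linarith
    have "real k * h 1 \<le> h (real m * t)"
      using mono[of "real k * 1" "real m * t"] k mult[of 1 k] by simp
    moreover have "h (real m * t) \<le> real (Suc k) * h 1"
      using mono[of "real m * t" "real (Suc k) * 1"] k mult[of 1 "Suc k"] t by simp
    moreover have "real k * h 1 \<le> real m * t * h 1" "real m * t * h 1 \<le> real (Suc k) * h 1"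
      using k h1 by (intro mult_right_mono; simp)+
    moreover have "h (real m * t) = real m * h t" using mult t by simp
    moreover have "real (Suc k) * h 1 = real k * h 1 + h 1" by (simp add: algebra_simps)
    ultimately have "\<bar>real m * h t - real m * t * h 1\<bar> \<le> h 1" by linarith
    moreover have "real m * \<bar>h t - t * h 1\<bar> = \<bar>real m * h t - real m * t * h 1\<bar>"
      by (simp add: abs_mult[symmetric, of "real m", simplified] right_diff_distrib mult.assoc)
    ultimately show ?thesis by simp
  qed
  then have "\<bar>h t - t * h 1\<bar> = 0"
    using h1 by (intro real_archimedian_rdiv_eq_0[of _ "h 1"]) auto
  then show ?thesis by simp
qed

text \<open>The increment over the volume of \<open>L\<close> is additive in the length:
  \<open>L + I (s + t)\<close> is the union of \<open>L + I s\<close> and a translate of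
  \<open>L + I t\<close> that overlap in a translate of \<open>L\<close>. Being monotone as well,
  the increment is linear.\<close>

lemma measure_sum_ray_segment:
  fixes L :: "'a::euclidean_space set" and v :: 'a
  assumes L: "compact L" "convex L" and t: "0 \<le> t"
  defines "I \<equiv> \<lambda>t::real. (\<lambda>s. s *\<^sub>R v) ` {0..t}"
  shows "measure lebesgue (L + I t) = measure lebesgue L + t * (measure lebesgue (L + I 1) - measure lebesgue L)"
proof -
  have cI: "compact (I t)" for t unfolding I_def by (intro compact_continuous_image continuous_intros compact_Icc)
  have c: "compact (L + I t)" for t by (intro compact_set_plus L cI)
  have I0: "I 0 = {0}" by (auto simp: I_def)
  define h where "h t = measure lebesgue (L + I t) - measure lebesgue L" for t
  have "h t = t * h 1"
  proof (rule additive_mono_imp_linear[OF _ _ t])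
    fix s t :: real assume st: "0 \<le> s" "s \<le> t"
    have "L + I s \<subseteq> L + I t" using st unfolding I_def by (intro set_plus_mono2 image_mono) auto
    then show "h s \<le> h t" unfolding h_def using measure_mono_compact[OF _ c c] by force
  next
    fix s t :: real assume st: "0 \<le> s" "0 \<le> t"
    let ?A = "L + I s" and ?B = "{s *\<^sub>R v} + (L + I t)"
    have un: "L + I (s + t) = ?A \<union> ?B"
    proof (intro equalityI subsetI)
      fix z assume "z \<in> L + I (s + t)"
      then obtain l r where l: "l \<in> L" "0 \<le> r" "r \<le> s + t" "z = l + r *\<^sub>R v" by (auto simp: I_def elim!: set_plus_elim)
      show "z \<in> ?A \<union> ?B"
      proof (cases "r \<le> s")
        case True
        then have "r *\<^sub>R v \<in> I s" using l by (auto simp: I_def)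
        then show ?thesis using l(1,4) by blast
      next
        case False
        have "z = s *\<^sub>R v + (l + (r - s) *\<^sub>R v)" using l by (simp add: algebra_simps)
        moreover have "(r - s) *\<^sub>R v \<in> I t" unfolding I_def by (rule imageI) (use False l in auto)
        ultimately have "z = s *\<^sub>R v + (l + (r - s) *\<^sub>R v)" "(r - s) *\<^sub>R v \<in> I t" by blast+
        then show ?thesis using l(1) by blast
      qed
    next
      fix z assume "z \<in> ?A \<union> ?B"
      then show "z \<in> L + I (s + t)"
      proof
        assume "z \<in> ?A"
        moreover have "I s \<subseteq> I (s + t)" unfolding I_def by (rule image_mono) (use st in auto)
        ultimately show ?thesis using set_plus_mono2[of L L "I s" "I (s + t)"] by blast
      next
        assume "z \<in> ?B"
        then obtain l r where l: "l \<in> L" "0 \<le> r" "r \<le> t" "z = s *\<^sub>R v + (l + r *\<^sub>R v)"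
          by (auto simp: I_def set_plus_def)
        have "z = l + (s + r) *\<^sub>R v" using l by (simp add: algebra_simps)
        moreover have "(s + r) *\<^sub>R v \<in> I (s + t)" unfolding I_def by (rule imageI) (use st l in auto)
        ultimately show ?thesis using l(1) by blast
      qed
    qed
    \<comment> \<open>the only use of convexity: both translates meet exactly in a translate of \<open>L\<close>\<close>
    have int: "?A \<inter> ?B = {s *\<^sub>R v} + L"
    proof (intro equalityI subsetI)
      fix z assume "z \<in> ?A \<inter> ?B"
      then obtain l p k q where l: "l \<in> L" "0 \<le> p" "p \<le> s" "z = l + p *\<^sub>R v"
        and k: "k \<in> L" "0 \<le> q" "q \<le> t" "z = s *\<^sub>R v + (k + q *\<^sub>R v)"
        by (auto simp: I_def set_plus_def)
      have eq: "l = k + (s - p + q) *\<^sub>R v" using l(4) k(4) by (simp add: algebra_simps)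
      have "k + q *\<^sub>R v \<in> L"
      proof (cases "s - p + q = 0")
        case True
        then have "q = 0" using l k by linarith
        then show ?thesis using k by simp
      next
        case False
        \<comment> \<open>Since \<open>l\<close> is \<open>k\<close> moved by
          \<open>(s - p + q)\<close> along \<open>v\<close>, this weight places
          \<open>k + q *\<^sub>R v\<close> on the segment from \<open>k\<close> to
          \<open>l\<close>.\<close>
        define c where "c = q / (s - p + q)"
        have c: "0 \<le> c" "c \<le> 1" "c * (s - p + q) = q" using False l k by (auto simp: c_def)
        have "(1 - c) *\<^sub>R k + c *\<^sub>R l \<in> L" using l k c L(2) by (simp add: convex_alt)
        also have "(1 - c) *\<^sub>R k + c *\<^sub>R l = k + (c * (s - p + q)) *\<^sub>R v"
          unfolding eq by (simp add: algebra_simps)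
        finally show ?thesis by (simp add: c(3))
      qed
      then show "z \<in> {s *\<^sub>R v} + L" using k(4) by (auto simp: set_plus_def)
    next
      fix z assume "z \<in> {s *\<^sub>R v} + L"
      then obtain l where l: "l \<in> L" "z = s *\<^sub>R v + l" by (auto simp: set_plus_def)
      have "s *\<^sub>R v \<in> I s" "0 \<in> I t" using st by (auto simp: I_def)
      then show "z \<in> ?A \<inter> ?B" using l set_plus_intro[of l L "s *\<^sub>R v" "I s"] set_plus_intro[of l L 0 "I t"]
        by (auto simp: add.commute)
    qed
    have "measure lebesgue (?A \<union> ?B) = measure lebesgue ?A + measure lebesgue ?B - measure lebesgue (?A \<inter> ?B)"
      by (intro measure_Un3 lmeasurable_compact c compact_set_plus) auto
    then show "h (s + t) = h s + h t"
      unfolding un[symmetric] int measure_sum_translation h_def by simp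
  qed
  then show ?thesis by (simp add: h_def)
qed

text \<open>A centred segment is a translate of a ray segment in direction
  \<open>2 *\<^sub>R v\<close>, and translations do not change the volume.\<close>

lemma measure_sum_segment:
  fixes L :: "'a::euclidean_space set" and v :: 'a
  assumes L: "compact L" "convex L" and t: "0 \<le> t"
  defines "J \<equiv> closed_segment (-v) v"
  shows "measure lebesgue (L + dil t J) = measure lebesgue L + t * (measure lebesgue (L + J) - measure lebesgue L)"
proof -
  define I where "I t = (\<lambda>s. s *\<^sub>R (2 *\<^sub>R v)) ` {0..t}" for t :: real
  have "dil t J = {- (t *\<^sub>R v)} + I t" if "0 \<le> t" for t
  proof (intro equalityI subsetI)
    fix z assume "z \<in> dil t J"
    then obtain u where u: "0 \<le> u" "u \<le> 1" "z = t *\<^sub>R ((1 - u) *\<^sub>R (-v) + u *\<^sub>R v)" by (auto simp: J_def in_segment)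
    then have "z = - (t *\<^sub>R v) + (t * u) *\<^sub>R (2 *\<^sub>R v)" by (simp add: algebra_simps) (simp add: scaleR_2[symmetric])
    moreover have "(t * u) *\<^sub>R (2 *\<^sub>R v) \<in> I t" using u that by (auto simp: I_def mult_left_le)
    ultimately show "z \<in> {- (t *\<^sub>R v)} + I t" by blast
  next
    fix z assume "z \<in> {- (t *\<^sub>R v)} + I t"
    then obtain s where s: "0 \<le> s" "s \<le> t" "z = - (t *\<^sub>R v) + s *\<^sub>R (2 *\<^sub>R v)" by (auto simp: I_def set_plus_def)
    define u where "u = s / t"
    have u: "0 \<le> u" "u \<le> 1" "s = t * u" using s that by (auto simp: u_def divide_le_eq_1)
    have "z = t *\<^sub>R ((1 - u) *\<^sub>R (-v) + u *\<^sub>R v)" unfolding s(3) u(3)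
      by (simp add: algebra_simps) (simp add: scaleR_2[symmetric])
    moreover have "(1 - u) *\<^sub>R (-v) + u *\<^sub>R v \<in> J" using u by (auto simp: J_def in_segment)
    ultimately show "z \<in> dil t J" by blast
  qed
  then have *: "measure lebesgue (L + dil t J) = measure lebesgue (L + I t)" if "0 \<le> t" for t
    using that measure_sum_translation[of "- (t *\<^sub>R v)" "L + I t"] by (simp add: add.left_commute)
  show ?thesis using *[OF t] *[of 1] measure_sum_ray_segment[OF L t, of "2 *\<^sub>R v"] by (simp add: I_def)
qed

section \<open>Zonotopes and the polynomial in the scale\<close>

text \<open>Indexing by a family allows repeated and zero generators and makes sub-zonotopes
  correspond to subsets of the index set. Centred segments make the body symmetric about the
  origin.\<close>

definition zonotope :: "('i \<Rightarrow> 'a::real_vector) \<Rightarrow> 'i set \<Rightarrow> 'a set" where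
  "zonotope u S = (\<Sum>i\<in>S. closed_segment (- u i) (u i))"

lemma zonotope_empty [simp]: "zonotope u {} = {0}"
  by (simp add: zonotope_def set_zero)

lemma zonotope_insert:
  "finite S \<Longrightarrow> i \<notin> S \<Longrightarrow> zonotope u (insert i S) = closed_segment (- u i) (u i) + zonotope u S"
  by (simp add: zonotope_def)

lemma compact_zonotope: "finite S \<Longrightarrow> compact (zonotope (u :: 'i \<Rightarrow> 'a::euclidean_space) S)"
  by (induction S rule: finite_induct) (auto simp: zonotope_insert intro!: compact_set_plus)

lemma convex_zonotope: "convex (zonotope u S)"
  unfolding zonotope_def by (intro convex_set_sum) auto

lemma zonotope_symmetric:
  fixes u :: "'i \<Rightarrow> 'a::real_vector"
  assumes "finite S" shows "uminus ` zonotope u S = zonotope u S"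
  using assms
proof (induction S rule: finite_induct)
  case (insert i S)
  have "uminus ` closed_segment (- u i) (u i) = closed_segment (- u i) (u i)"
    by (simp add: closed_segment_linear_image[of uminus, symmetric] linear_iff closed_segment_commute)
  moreover have "uminus ` (A + B) = uminus ` A + uminus ` B" for A B :: "'a set"
    by (force simp: set_plus_def image_iff)
  ultimately show ?case using insert by (simp add: zonotope_insert)
qed simp

text \<open>Induction over the generators for all \<open>K\<close> at once: the volume is affine in
  the length of the new segment, and its slope involves \<open>K + ?J\<close> in the role of
  \<open>K\<close>. A single function \<open>a\<close> serves every \<open>S\<close>, which is what
  later identifies \<open>a S\<close> as a leading coefficient.\<close>

lemma measure_sum_zonotope_polynomial:
  fixes K :: "'a::euclidean_space set"
  assumes "finite M" "compact K" "convex K"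
  shows "\<exists>a. \<forall>S\<subseteq>M. \<forall>t\<ge>0. measure lebesgue (K + dil t (zonotope u S)) = (\<Sum>T\<in>Pow S. a T * t ^ card T)"
  using assms
proof (induction M arbitrary: K rule: finite_induct)
  case empty
  show ?case by (intro exI[of _ "\<lambda>_. measure lebesgue K"]) auto
next
  case (insert i M)
  let ?J = "closed_segment (- u i) (u i)"
  obtain a where a: "\<And>S t. S \<subseteq> M \<Longrightarrow> 0 \<le> t \<Longrightarrow> measure lebesgue (K + dil t (zonotope u S)) = (\<Sum>T\<in>Pow S. a T * t ^ card T)"
    using insert.IH[OF insert.prems] by blast
  obtain b where b: "\<And>S t. S \<subseteq> M \<Longrightarrow> 0 \<le> t \<Longrightarrow> measure lebesgue (K + ?J + dil t (zonotope u S)) = (\<Sum>T\<in>Pow S. b T * t ^ card T)"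
    using insert.IH[of "K + ?J"] insert.prems by (force intro: compact_set_plus convex_set_plus)
  \<comment> \<open>From vol(L + t J) = vol L + t (vol(L + J) - vol L): sets without
    \<open>i\<close> keep their coefficient, and sets containing \<open>i\<close> receive the slope
    together with one more power of t.\<close>
  define c where "c T = (if i \<in> T then b (T - {i}) - a (T - {i}) else a T)" for T
  have "measure lebesgue (K + dil t (zonotope u S)) = (\<Sum>T\<in>Pow S. c T * t ^ card T)"
    if S: "S \<subseteq> insert i M" and t: "0 \<le> t" for S t
  proof (cases "i \<in> S")
    case False
    then have "S \<subseteq> M" using S by auto
    moreover have "(\<Sum>T\<in>Pow S. a T * t ^ card T) = (\<Sum>T\<in>Pow S. c T * t ^ card T)"
      using False by (intro sum.cong) (auto simp: c_def)
    ultimately show ?thesis using a t by simp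
  next
    case True
    define R where "R = S - {i}"
    have R: "S = insert i R" "R \<subseteq> M" "i \<notin> R" using True S insert.hyps by (auto simp: R_def)
    have fR: "finite R" using R(2) insert.hyps(1) finite_subset by blast
    define L where "L = K + dil t (zonotope u R)"
    have L: "compact L" "convex L" unfolding L_def
      by (intro compact_set_plus convex_set_plus compact_scaling convex_scaling insert.prems compact_zonotope convex_zonotope fR)+
    have "measure lebesgue (K + dil t (zonotope u S)) = measure lebesgue (L + dil t ?J)"
      using R fR by (simp add: L_def zonotope_insert dil_set_plus add_ac)
    also have "\<dots> = measure lebesgue L + t * (measure lebesgue (L + ?J) - measure lebesgue L)"
      by (rule measure_sum_segment[OF L t])
    also have "measure lebesgue L = (\<Sum>T\<in>Pow R. a T * t ^ card T)" using a R t by (simp add: L_def)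
    also have "L + ?J = K + ?J + dil t (zonotope u R)" by (simp add: L_def add_ac)
    also have "measure lebesgue \<dots> = (\<Sum>T\<in>Pow R. b T * t ^ card T)" using b R t by simp
    also have "(\<Sum>T\<in>Pow R. a T * t ^ card T) + t * ((\<Sum>T\<in>Pow R. b T * t ^ card T) - (\<Sum>T\<in>Pow R. a T * t ^ card T))
      = (\<Sum>T\<in>Pow R. c T * t ^ card T) + (\<Sum>T\<in>Pow R. c (insert i T) * t ^ card (insert i T))"
    proof -
      have "i \<notin> T \<and> finite T" if "T \<in> Pow R" for T using that R fR finite_subset by blast
      then have "(\<Sum>T\<in>Pow R. c T * t ^ card T) = (\<Sum>T\<in>Pow R. a T * t ^ card T)"
        "(\<Sum>T\<in>Pow R. c (insert i T) * t ^ card (insert i T)) = (\<Sum>T\<in>Pow R. t * (b T * t ^ card T - a T * t ^ card T))"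
        by (auto intro!: sum.cong simp: c_def algebra_simps)
      then show ?thesis by (simp add: sum_distrib_left sum_subtractf right_diff_distrib)
    qed
    also have "\<dots> = (\<Sum>T\<in>Pow S. c T * t ^ card T)"
    proof -
      have "inj_on (insert i) (Pow R)" using R(3) by (auto simp: inj_on_def)
      moreover have "Pow R \<inter> insert i ` Pow R = {}" using R(3) by auto
      ultimately show ?thesis unfolding R(1) Pow_insert using fR by (simp add: sum.union_disjoint sum.reindex)
    qed
    finally show ?thesis .
  qed
  then show ?case by blast
qed

section \<open>Rogers--Shephard inequality for leading coefficients\<close>

lemma emeasure_compact:
  fixes A :: "'a::euclidean_space set"
  assumes "compact A" shows "emeasure lborel A = ennreal (measure lebesgue A)"
proof -
  have "emeasure lborel A \<noteq> \<infinity>" using emeasure_compact_finite[OF assms] by simp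
  then show ?thesis using assms by (simp add: borel_compact emeasure_eq_ennreal_measure)
qed

text \<open>Tonelli: for fixed \<open>y\<close> in \<open>P\<close>, the \<open>x\<close> with
  \<open>y - x\<close> in \<open>Q\<close> form a translate of the reflection of \<open>Q\<close>,
  whose measure does not depend on \<open>y\<close>.\<close>

lemma nn_integral_covariogram:
  fixes P Q :: "'a::euclidean_space set"
  assumes "compact P" "compact Q"
  shows "(\<integral>\<^sup>+x. emeasure lborel (P \<inter> ({x} + Q)) \<partial>lborel) = emeasure lborel P * emeasure lborel Q"
proof -
  have [measurable]: "P \<in> sets borel" "Q \<in> sets borel" using assms by (auto simp: borel_compact)
  have "emeasure lborel (P \<inter> ({x} + Q)) = (\<integral>\<^sup>+y. indicator P y * indicator Q (y - x) \<partial>lborel)" for x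
  proof -
    have "P \<inter> ({x} + Q) \<in> sets borel"
      using assms by (intro borel_compact compact_Int compact_set_plus) auto
    then have "emeasure lborel (P \<inter> ({x} + Q)) = (\<integral>\<^sup>+y. indicator (P \<inter> ({x} + Q)) y \<partial>lborel)" by simp
    also have "\<dots> = (\<integral>\<^sup>+y. indicator P y * indicator Q (y - x) \<partial>lborel)"
      by (intro nn_integral_cong) (auto simp: indicator_def set_plus_def)
    finally show ?thesis .
  qed
  then have "(\<integral>\<^sup>+x. emeasure lborel (P \<inter> ({x} + Q)) \<partial>lborel) =
    (\<integral>\<^sup>+x. (\<integral>\<^sup>+y. indicator P y * indicator Q (y - x) \<partial>lborel) \<partial>lborel)" by simp
  also have "\<dots> = (\<integral>\<^sup>+y. (\<integral>\<^sup>+x. indicator P y * indicator Q (y - x) \<partial>lborel) \<partial>lborel)"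
    by (rule lborel_pair.Fubini') measurable
  also have "\<dots> = (\<integral>\<^sup>+y. indicator P y * emeasure lborel Q \<partial>lborel)"
  proof (rule nn_integral_cong)
    fix y :: 'a
    have "emeasure lborel Q = (\<integral>\<^sup>+x. indicator Q x \<partial>lborel)" by simp
    also have "\<dots> = (\<integral>\<^sup>+x. indicator Q x \<partial>density (distr lborel borel (\<lambda>x. y + (-1) *\<^sub>R x)) (\<lambda>_. \<bar>-1::real\<bar>^DIM('a)))"
      by (subst lborel_affine[of "-1" y]) auto
    also have "\<dots> = (\<integral>\<^sup>+x. indicator Q (y - x) \<partial>lborel)"
      by (simp add: nn_integral_density nn_integral_distr del: nn_integral_indicator)
    finally show "(\<integral>\<^sup>+x. indicator P y * indicator Q (y - x) \<partial>lborel) = indicator P y * emeasure lborel Q"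
      by (simp add: nn_integral_cmult)
  qed
  also have "\<dots> = emeasure lborel P * emeasure lborel Q"
    by (simp add: nn_integral_multc)
  finally show ?thesis .
qed

section \<open>Integration over layers with a Beta weight\<close>

text \<open>Minus the derivative of (1 - r)^k, cut off to the unit interval: integrating it from q
  to 1 gives (1 - q)^k, the factor by which a k-dimensional volume shrinks under dilation by 1 -
  q.\<close>

definition layer_weight :: "nat \<Rightarrow> real \<Rightarrow> ennreal" where
  "layer_weight k r = ennreal (real k * (1 - r) ^ (k - 1)) * indicator {0..1} r"

lemma layer_weight_measurable [measurable]: "layer_weight k \<in> borel_measurable borel"
  unfolding layer_weight_def by measurable

lemma nn_integral_layer_weight_tail:
  assumes "0 < k" "0 \<le> q" "q \<le> 1"
  shows "(\<integral>\<^sup>+r. layer_weight k r * indicator {q..1} r \<partial>lborel) = ennreal ((1 - q) ^ k)"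
proof -
  have "((\<lambda>r. real k * (1 - r) ^ (k - 1)) has_integral (- ((1 - 1) ^ k) - (- ((1 - q) ^ k)))) {q..1}"
  proof (rule fundamental_theorem_of_calculus[OF assms(3)])
    fix x :: real assume "x \<in> {q..1}"
    have "((\<lambda>r. - ((1 - r) ^ k)) has_real_derivative real k * (1 - x) ^ (k - 1)) (at x within {q..1})"
      by (auto intro!: derivative_eq_intros)
    then show "((\<lambda>r. - ((1 - r) ^ k)) has_vector_derivative real k * (1 - x) ^ (k - 1)) (at x within {q..1})"
      by (simp add: has_real_derivative_iff_has_vector_derivative)
  qed
  then have "((\<lambda>r. real k * (1 - r) ^ (k - 1)) has_integral (1 - q) ^ k) {q..1}"
    using assms(1) by (simp add: zero_power)
  then have "(\<integral>\<^sup>+r. ennreal (real k * (1 - r) ^ (k - 1)) * indicator {q..1} r \<partial>lborel) = ennreal ((1 - q) ^ k)"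
    by (intro nn_integral_has_integral_lebesgue') auto
  moreover have "layer_weight k r * indicator {q..1} r = ennreal (real k * (1 - r) ^ (k - 1)) * indicator {q..1} r" for r
    using assms(2) by (auto simp: layer_weight_def indicator_def)
  ultimately show ?thesis by simp
qed

text \<open>The origin of the central binomial coefficient: the integral is k B(k+1, k) = k! k! /
  (2k)!.\<close>

lemma nn_integral_layer_weight_power:
  assumes "0 < k"
  shows "(\<integral>\<^sup>+r. layer_weight k r * ennreal (r ^ k) \<partial>lborel) = ennreal (1 / real ((2 * k) choose k))"
proof -
  have "((\<lambda>t. t powr (real (Suc k) - 1) * (1 - t) powr (real k - 1)) has_integral Beta (real (Suc k)) (real k)) {0..1}"
    using assms by (intro has_integral_Beta_real) auto
  then have "((\<lambda>t. t ^ k * (1 - t) ^ (k - 1)) has_integral Beta (real (Suc k)) (real k)) {0..1}"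
  \<comment> \<open>The endpoints are excepted because for k = 1 the last factor at t = 1 is
    \<open>0 powr 0 = 0\<close> on one side and \<open>0 ^ 0 = 1\<close> on the other.\<close>
  proof (rule has_integral_spike_finite[rotated 2])
    show "finite {0, 1 :: real}" by simp
    fix t :: real assume "t \<in> {0..1} - {0, 1}"
    then have "t powr (real (Suc k) - 1) = t ^ k" "(1 - t) powr (real k - 1) = (1 - t) ^ (k - 1)"
      using assms by (simp_all add: powr_realpow[symmetric] of_nat_diff)
    then show "t ^ k * (1 - t) ^ (k - 1) = t powr (real (Suc k) - 1) * (1 - t) powr (real k - 1)" by simp
  qed
  from has_integral_mult_right[OF this, of "real k"]
  have 1: "((\<lambda>t. real k * (1 - t) ^ (k - 1) * t ^ k) has_integral real k * Beta (real (Suc k)) (real k)) {0..1}"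
    by (simp add: mult_ac)
  have "Gamma (real (Suc k)) = fact k" "Gamma (real k) = fact (k - 1)" "Gamma (real (Suc k) + real k) = fact (2 * k)"
    using Gamma_fact[of k, where 'a = real] Gamma_fact[of "k - 1", where 'a = real] Gamma_fact[of "2 * k", where 'a = real] assms
    by (simp_all add: of_nat_diff add_ac)
  then have "real k * Beta (real (Suc k)) (real k) = fact k * (real k * fact (k - 1)) / fact (2 * k)"
    unfolding Beta_def by simp
  also have "real k * fact (k - 1) = fact k" using assms by (simp add: fact_reduce)
  also have "fact k * fact k / fact (2 * k) = 1 / real ((2 * k) choose k)"
    using binomial_fact[of k "2 * k", where 'a = real] by simp
  finally have 2: "real k * Beta (real (Suc k)) (real k) = 1 / real ((2 * k) choose k)" .
  have "(\<integral>\<^sup>+r. layer_weight k r * ennreal (r ^ k) \<partial>lborel) =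
    (\<integral>\<^sup>+r. ennreal (real k * (1 - r) ^ (k - 1) * r ^ k) * indicator {0..1} r \<partial>lborel)"
    by (intro nn_integral_cong) (auto simp: layer_weight_def indicator_def ennreal_mult)
  also have "\<dots> = ennreal (real k * Beta (real (Suc k)) (real k))"
    by (rule nn_integral_has_integral_lebesgue'[OF _ 1]) auto
  finally show ?thesis by (simp only: 2)
qed

text \<open>Tonelli for the pair of level and point; compactness of \<open>S\<close> supplies the
  joint measurability.\<close>

lemma nn_integral_layers:
  fixes S :: "(real \<times> 'a::euclidean_space) set"
  assumes "compact S"
  shows "(\<integral>\<^sup>+x. (\<integral>\<^sup>+r. layer_weight k r * indicator S (r, x) \<partial>lborel) \<partial>lborel) =
    (\<integral>\<^sup>+r. layer_weight k r * emeasure lborel {x. (r, x) \<in> S} \<partial>lborel)"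
proof -
  have [measurable]: "S \<in> sets (borel \<Otimes>\<^sub>M borel)"
    unfolding borel_prod by (rule borel_compact[OF assms])
  have [measurable]: "S \<in> sets (lborel \<Otimes>\<^sub>M lborel)"
    using assms by (simp add: lborel_prod borel_compact)
  have "(\<integral>\<^sup>+x. (\<integral>\<^sup>+r. layer_weight k r * indicator S (r, x) \<partial>lborel) \<partial>lborel) =
    (\<integral>\<^sup>+r. (\<integral>\<^sup>+x. layer_weight k r * indicator S (r, x) \<partial>lborel) \<partial>lborel)"
    by (rule lborel_pair.Fubini') measurable
  also have "\<dots> = (\<integral>\<^sup>+r. layer_weight k r * emeasure lborel {x. (r, x) \<in> S} \<partial>lborel)"
  proof (rule nn_integral_cong)
    fix r :: real
    have "{x. (r, x) \<in> S} = Pair r -` S" by auto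
    then have m: "{x. (r, x) \<in> S} \<in> sets borel" by (simp add: sets_Pair1[of S borel borel])
    have "(\<integral>\<^sup>+x. layer_weight k r * indicator S (r, x) \<partial>lborel) = (\<integral>\<^sup>+x. layer_weight k r * indicator {x. (r, x) \<in> S} x \<partial>lborel)"
      by (intro nn_integral_cong) (auto simp: indicator_def)
    then show "(\<integral>\<^sup>+x. layer_weight k r * indicator S (r, x) \<partial>lborel) = layer_weight k r * emeasure lborel {x. (r, x) \<in> S}"
      using m by (simp add: nn_integral_cmult)
  qed
  finally show ?thesis .
qed

lemma compact_layers:
  fixes D Z :: "'a::euclidean_space set"
  assumes "compact D" "compact Z"
  shows "compact {(r, x). r \<in> {0..1} \<and> x \<in> dil r D + dil c Z}"
proof -
  let ?f = "\<lambda>(r::real, d, z). (r, r *\<^sub>R d + c *\<^sub>R z)"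
  have "{(r, x). r \<in> {0..1} \<and> x \<in> dil r D + dil c Z} = ?f ` ({0..1} \<times> D \<times> Z)"
    by (force simp: set_plus_def image_iff)
  moreover have "compact (?f ` ({0..1} \<times> D \<times> Z))"
    using assms by (intro compact_continuous_image compact_Times) (auto simp: case_prod_unfold intro!: continuous_intros)
  ultimately show ?thesis by simp
qed

text \<open>Write x = r (a - b) + (t - \<tau>) z and take v = r a + (t - \<tau>) z. By convexity (1
  - r) K + r a stays in K and (t - \<tau>) z + \<tau> Z stays in t Z. Subtracting x turns r a into r
  b and removes (t - \<tau>) z, which leaves a point of K + \<tau> Z.\<close>

lemma translates_of_sums_meet:
  fixes K Z :: "'a::euclidean_space set"
  assumes K: "convex K" and Z: "convex Z" and r: "0 \<le> r" "r \<le> 1" and t: "0 \<le> \<tau>" "\<tau> \<le> t"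
    and x: "x \<in> dil r (K + uminus ` K) + dil (t - \<tau>) Z"
  shows "\<exists>v. {v} + (dil (1 - r) K + dil \<tau> Z) \<subseteq> (K + dil t Z) \<inter> ({x} + (K + dil \<tau> Z))"
proof -
  obtain a b z where ab: "a \<in> K" "b \<in> K" "z \<in> Z" and xe: "x = r *\<^sub>R (a - b) + (t - \<tau>) *\<^sub>R z"
    using x by (auto simp: set_plus_def)
  have "{r *\<^sub>R a + (t - \<tau>) *\<^sub>R z} + (dil (1 - r) K + dil \<tau> Z) \<subseteq> (K + dil t Z) \<inter> ({x} + (K + dil \<tau> Z))"
  proof
    fix y assume "y \<in> {r *\<^sub>R a + (t - \<tau>) *\<^sub>R z} + (dil (1 - r) K + dil \<tau> Z)"
    then obtain c w where c: "c \<in> K" "w \<in> Z" and y: "y = r *\<^sub>R a + (t - \<tau>) *\<^sub>R z + ((1 - r) *\<^sub>R c + \<tau> *\<^sub>R w)"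
      by (auto simp: set_plus_def)
    have mem: "(1 - r) *\<^sub>R c + r *\<^sub>R p \<in> K" if "p \<in> K" for p
      using K c(1) that r by (simp add: convex_alt)
    have "(t - \<tau>) *\<^sub>R z + \<tau> *\<^sub>R w \<in> dil (t - \<tau>) Z + dil \<tau> Z" using ab c by blast
    then have zw: "(t - \<tau>) *\<^sub>R z + \<tau> *\<^sub>R w \<in> dil t Z" using dil_add_convex[OF Z, of "t - \<tau>" \<tau>] t by simp
    have "y = ((1 - r) *\<^sub>R c + r *\<^sub>R a) + ((t - \<tau>) *\<^sub>R z + \<tau> *\<^sub>R w)" by (simp add: y)
    then have 1: "y \<in> K + dil t Z" using mem[OF ab(1)] zw by blast
    have "y = x + (((1 - r) *\<^sub>R c + r *\<^sub>R b) + \<tau> *\<^sub>R w)" by (simp add: y xe algebra_simps)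
    then have "y \<in> {x} + (K + dil \<tau> Z)" using mem[OF ab(2)] c(2) by blast
    with 1 show "y \<in> (K + dil t Z) \<inter> ({x} + (K + dil \<tau> Z))" by blast
  qed
  then show ?thesis by blast
qed

text \<open>
  If \<open>q\<close> is the least \<open>r\<close> with \<open>x \<in> r (K - K) + (t - \<tau>) Z\<close>, the covariogram at \<open>x\<close> is at least
  \<open>\<alpha> (1 - q)\<^sup>k\<close>, which is the layer weight integrated over \<open>[q, 1]\<close>.
\<close>

lemma rogers_shephard_layered:
  fixes K Z :: "'a::euclidean_space set"
  assumes K: "compact K" "convex K" and Z: "compact Z" "convex Z" and k: "0 < k"
    and nonneg: "0 \<le> \<alpha>" "0 \<le> \<beta>" and t: "0 \<le> \<tau>" "\<tau> \<le> t"
    and lowK: "\<And>s. 0 \<le> s \<Longrightarrow> s \<le> 1 \<Longrightarrow> \<alpha> * s ^ k \<le> measure lebesgue (dil s K + dil \<tau> Z)"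
    and lowD: "\<And>r. 0 \<le> r \<Longrightarrow> r \<le> 1 \<Longrightarrow> \<beta> * r ^ k \<le> measure lebesgue (dil r (K + uminus ` K) + dil (t - \<tau>) Z)"
  shows "\<alpha> * \<beta> \<le> real ((2 * k) choose k) * (measure lebesgue (K + dil t Z) * measure lebesgue (K + dil \<tau> Z))"
proof -
  define P where "P = K + dil t Z"
  define Q where "Q = K + dil \<tau> Z"
  define D where "D = K + uminus ` K"
  define E where "E r = dil r D + dil (t - \<tau>) Z" for r
  define S where "S = {(r, x). r \<in> {0..1} \<and> x \<in> E r}"
  have cD: "compact D" unfolding D_def by (intro compact_set_plus compact_negations K)
  have cPQ: "compact P" "compact Q" unfolding P_def Q_def by (intro compact_set_plus compact_scaling K Z)+
  have cE: "compact (E r)" for r unfolding E_def by (intro compact_set_plus compact_scaling cD Z)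
  have cS: "compact S" unfolding S_def E_def by (rule compact_layers[OF cD Z(1)])
  have f: "ennreal \<alpha> * (\<integral>\<^sup>+r. layer_weight k r * indicator S (r, x) \<partial>lborel) \<le> emeasure lborel (P \<inter> ({x} + Q))" for x
  proof (cases "\<exists>r. (r, x) \<in> S")
    case False
    then have "(\<integral>\<^sup>+r. layer_weight k r * indicator S (r, x) \<partial>lborel) = 0" by simp
    then show ?thesis by simp
  next
    case True
    \<comment> \<open>The set of levels containing \<open>x\<close> is compact, as a projection of a
      section of \<open>S\<close>, so its least element is attained.\<close>
    define R where "R = {r. (r, x) \<in> S}"
    have "R = fst ` (S \<inter> UNIV \<times> {x})" by (force simp: R_def)
    moreover have "compact (S \<inter> UNIV \<times> {x})" by (intro compact_Int_closed cS closed_Times) auto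
    ultimately have "compact R" using compact_continuous_image[OF continuous_on_fst[OF continuous_on_id]] by metis
    moreover have "R \<noteq> {}" using True by (auto simp: R_def)
    ultimately have "\<exists>q\<in>R. \<forall>r\<in>R. q \<le> r" by (rule compact_attains_inf)
    then obtain q where q: "q \<in> R" "\<And>r. r \<in> R \<Longrightarrow> q \<le> r" by blast
    have q01: "0 \<le> q" "q \<le> 1" and xq: "x \<in> E q" using q(1) by (auto simp: R_def S_def)
    have "(\<integral>\<^sup>+r. layer_weight k r * indicator S (r, x) \<partial>lborel) \<le> (\<integral>\<^sup>+r. layer_weight k r * indicator {q..1} r \<partial>lborel)"
      using q(2) by (intro nn_integral_mono mult_left_mono) (auto simp: indicator_def R_def S_def)
    also have "\<dots> = ennreal ((1 - q) ^ k)" by (rule nn_integral_layer_weight_tail[OF k q01])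
    finally have "ennreal \<alpha> * (\<integral>\<^sup>+r. layer_weight k r * indicator S (r, x) \<partial>lborel) \<le> ennreal \<alpha> * ennreal ((1 - q) ^ k)"
      by (rule mult_left_mono) simp
    also have "\<dots> = ennreal (\<alpha> * (1 - q) ^ k)" using nonneg q01 by (simp add: ennreal_mult)
    also have "\<dots> \<le> ennreal (measure lebesgue (dil (1 - q) K + dil \<tau> Z))"
      using lowK q01 by (intro ennreal_leI) simp
    also have "\<dots> = emeasure lborel (dil (1 - q) K + dil \<tau> Z)"
      by (intro emeasure_compact[symmetric] compact_set_plus compact_scaling K Z)
    also have "\<dots> \<le> emeasure lborel (P \<inter> ({x} + Q))"
    proof -
      obtain v where v: "{v} + (dil (1 - q) K + dil \<tau> Z) \<subseteq> P \<inter> ({x} + Q)"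
        using translates_of_sums_meet[OF K(2) Z(2) q01 t] xq unfolding E_def D_def P_def Q_def by blast
      have c: "compact (dil (1 - q) K + dil \<tau> Z)" by (intro compact_set_plus compact_scaling K Z)
      have "emeasure lborel (dil (1 - q) K + dil \<tau> Z) = emeasure lborel ({v} + (dil (1 - q) K + dil \<tau> Z))"
        using c by (simp add: emeasure_compact compact_set_plus measure_sum_translation del: measure_completion)
      also have "\<dots> \<le> emeasure lborel (P \<inter> ({x} + Q))"
        using cPQ by (intro emeasure_mono v) (auto intro!: borel_compact compact_Int compact_set_plus)
      finally show ?thesis .
    qed
    finally show ?thesis .
  qed
  \<comment> \<open>The pointwise bound is integrated over \<open>x\<close>: \<beta> r^k bounds each
    layer from below, exchanging the integrals turns layers into weights at \<open>x\<close>, and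
    the covariogram dominates those.\<close>
  have "ennreal (\<alpha> * \<beta> / real ((2 * k) choose k)) = ennreal \<alpha> * (ennreal \<beta> * ennreal (1 / real ((2 * k) choose k)))"
    using nonneg by (simp add: ennreal_mult[symmetric])
  also have "\<dots> = ennreal \<alpha> * (\<integral>\<^sup>+r. ennreal \<beta> * (layer_weight k r * ennreal (r ^ k)) \<partial>lborel)"
    unfolding nn_integral_layer_weight_power[OF k, symmetric] by (simp add: nn_integral_cmult)
  also have "\<dots> \<le> ennreal \<alpha> * (\<integral>\<^sup>+r. layer_weight k r * emeasure lborel {x. (r, x) \<in> S} \<partial>lborel)"
  proof (intro mult_left_mono nn_integral_mono)
    fix r :: real
    show "ennreal \<beta> * (layer_weight k r * ennreal (r ^ k)) \<le> layer_weight k r * emeasure lborel {x. (r, x) \<in> S}"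
    proof (cases "r \<in> {0..1}")
      case True
      then have "{x. (r, x) \<in> S} = E r" by (auto simp: S_def)
      then have "emeasure lborel {x. (r, x) \<in> S} = ennreal (measure lebesgue (E r))" using emeasure_compact[OF cE] by simp
      moreover have "ennreal \<beta> * ennreal (r ^ k) \<le> ennreal (measure lebesgue (E r))"
        using lowD[of r] True nonneg unfolding E_def D_def by (simp add: ennreal_mult[symmetric] ennreal_leI del: measure_completion)
      ultimately show ?thesis by (metis mult.left_commute mult_left_mono zero_le)
    qed (simp add: layer_weight_def)
  qed simp
  also have "\<dots> = (\<integral>\<^sup>+x. ennreal \<alpha> * (\<integral>\<^sup>+r. layer_weight k r * indicator S (r, x) \<partial>lborel) \<partial>lborel)"
  proof -
    have [measurable]: "S \<in> sets (borel \<Otimes>\<^sub>M borel)" unfolding borel_prod by (rule borel_compact[OF cS])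
    show ?thesis unfolding nn_integral_layers[OF cS, symmetric] by (rule nn_integral_cmult[symmetric]) measurable
  qed
  also have "\<dots> \<le> (\<integral>\<^sup>+x. emeasure lborel (P \<inter> ({x} + Q)) \<partial>lborel)" by (intro nn_integral_mono f)
  also have "\<dots> = ennreal (measure lebesgue P * measure lebesgue Q)"
    unfolding nn_integral_covariogram[OF cPQ] emeasure_compact[OF cPQ(1)] emeasure_compact[OF cPQ(2)]
    by (simp add: ennreal_mult del: measure_completion)
  finally have "\<alpha> * \<beta> / real ((2 * k) choose k) \<le> measure lebesgue P * measure lebesgue Q"
    by (subst (asm) ennreal_le_iff) auto
  moreover have "0 < real ((2 * k) choose k)" by simp
  ultimately show ?thesis unfolding P_def Q_def by (simp add: field_simps)
qed

section \<open>Comparing the leading coefficients of a body and its difference body\<close>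

text \<open>Pull out the factor \<open>s\<close>: s K + t Z = s (K + (t/s) Z) and s^(j+k) (t/s)^j =
  t^j s^k. Of the n dimensions, only the k not taken up by \<open>Z\<close> contribute powers of
  \<open>s\<close>.\<close>

lemma measure_dil_sum_ge:
  fixes K Z :: "'a::euclidean_space set"
  assumes low: "\<And>t. 0 \<le> t \<Longrightarrow> \<alpha> * t ^ j \<le> measure lebesgue (K + dil t Z)"
    and jk: "j + k = DIM('a)" "0 < k" and s: "0 \<le> s" "0 \<le> t"
  shows "(\<alpha> * t ^ j) * s ^ k \<le> measure lebesgue (dil s K + dil t Z)"
proof (cases "s = 0")
  case True
  then show ?thesis using jk by (simp add: zero_power del: measure_completion)
next
  case False
  then have "0 < s" using s by simp
  have "dil s K + dil t Z = dil s (K + dil (t / s) Z)" using False by (simp add: dil_set_plus dil_dil)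
  then have "measure lebesgue (dil s K + dil t Z) = s ^ (j + k) * measure lebesgue (K + dil (t / s) Z)"
    using s by (simp add: measure_dil jk del: measure_completion)
  moreover have "s ^ (j + k) * (\<alpha> * (t / s) ^ j) \<le> s ^ (j + k) * measure lebesgue (K + dil (t / s) Z)"
    using low[of "t / s"] s by (intro mult_left_mono) auto
  moreover have "s ^ (j + k) * (\<alpha> * (t / s) ^ j) = (\<alpha> * t ^ j) * s ^ k"
    using \<open>0 < s\<close> by (simp add: power_add power_divide)
  ultimately show ?thesis by simp
qed

text \<open>A ball inside \<open>K\<close>, sufficiently enlarged, swallows the bounded difference
  body. This crude comparison serves the case of a vanishing leading coefficient.\<close>

lemma difference_body_subset_dil:
  fixes K :: "'a::euclidean_space set"
  assumes "compact K" "interior K \<noteq> {}"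
  obtains R v where "0 < R" "K + uminus ` K \<subseteq> {v} + dil R K"
proof -
  obtain c e where e: "0 < e" "cball c e \<subseteq> K" using assms(2) mem_interior_cball by blast
  have "bounded (K + uminus ` K)" by (intro compact_imp_bounded compact_set_plus compact_negations assms)
  then obtain d where d: "0 < d" "\<And>x. x \<in> K + uminus ` K \<Longrightarrow> norm x \<le> d" by (auto simp: bounded_pos)
  define R where "R = d / e"
  have R: "0 < R" "R * e = d" using d e by (auto simp: R_def)
  have "K + uminus ` K \<subseteq> {- (R *\<^sub>R c)} + dil R K"
  proof
    fix x assume "x \<in> K + uminus ` K"
    then have "norm x \<le> R * e" using d R by simp
    then have "c + (1 / R) *\<^sub>R x \<in> cball c e" using R by (simp add: dist_norm field_simps)
    then have "c + (1 / R) *\<^sub>R x \<in> K" using e by blast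
    then have "- (R *\<^sub>R c) + R *\<^sub>R (c + (1 / R) *\<^sub>R x) \<in> {- (R *\<^sub>R c)} + dil R K" by blast
    moreover have "- (R *\<^sub>R c) + R *\<^sub>R (c + (1 / R) *\<^sub>R x) = x" using R by (simp add: algebra_simps)
    ultimately show "x \<in> {- (R *\<^sub>R c)} + dil R K" by simp
  qed
  then show ?thesis using that R(1) by blast
qed

text \<open>In the limit the layered inequality reads \<alpha> \<beta> <= binom(2k, k) \<alpha>^2,
  which is void for \<alpha> = 0. In that case K - K lies in a translate of R K, which gives \<beta>
  <= R^k \<alpha> = 0.\<close>

theorem leading_coefficient_difference_body:
  fixes K Z :: "'a::euclidean_space set"
  assumes K: "compact K" "convex K" "interior K \<noteq> {}" and Z: "compact Z" "convex Z"
    and jk: "j + k = DIM('a)" "0 < k" and nonneg: "0 \<le> \<alpha>" "0 \<le> \<beta>"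
    and low: "\<And>t. 0 \<le> t \<Longrightarrow> \<alpha> * t ^ j \<le> measure lebesgue (K + dil t Z)"
    and lim: "((\<lambda>t. measure lebesgue (K + dil t Z) / t ^ j) \<longlongrightarrow> \<alpha>) at_top"
    and low': "\<And>t. 0 \<le> t \<Longrightarrow> \<beta> * t ^ j \<le> measure lebesgue (K + uminus ` K + dil t Z)"
  shows "\<beta> \<le> real ((2 * k) choose k) * \<alpha>"
proof (cases "\<alpha> = 0")
  case True
  obtain R v where R: "0 < R" "K + uminus ` K \<subseteq> {v} + dil R K" using difference_body_subset_dil[OF K(1,3)] .
  have "\<beta> \<le> R ^ k * (measure lebesgue (K + dil (t / R) Z) / (t / R) ^ j)" if t: "0 < t" for t
  proof -
    have "\<beta> * t ^ j \<le> measure lebesgue (K + uminus ` K + dil t Z)" using low' t by simp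
    also have "\<dots> \<le> measure lebesgue ({v} + dil R K + dil t Z)"
      by (intro measure_mono_compact set_plus_mono2 R compact_set_plus compact_negations compact_scaling K Z) auto
    also have "{v} + dil R K + dil t Z = {v} + dil R (K + dil (t / R) Z)"
      using R(1) by (simp add: dil_set_plus dil_dil add.assoc)
    also have "measure lebesgue \<dots> = R ^ (j + k) * measure lebesgue (K + dil (t / R) Z)"
      unfolding measure_sum_translation using R by (simp add: measure_dil jk del: measure_completion)
    finally show ?thesis using t R by (simp add: power_add power_divide field_simps del: measure_completion)
  qed
  then have ev: "\<forall>\<^sub>F t in at_top. \<beta> \<le> R ^ k * (measure lebesgue (K + dil (t / R) Z) / (t / R) ^ j)"
    by (rule eventually_mono[OF eventually_gt_at_top[of 0]])
  have "filterlim (\<lambda>t. t / R) at_top at_top" using R(1) by real_asymp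
  from filterlim_compose[OF lim this]
  have "((\<lambda>t. R ^ k * (measure lebesgue (K + dil (t / R) Z) / (t / R) ^ j)) \<longlongrightarrow> R ^ k * \<alpha>) at_top"
    by (rule tendsto_mult_left)
  then have "\<beta> \<le> R ^ k * \<alpha>" by (rule tendsto_lowerbound[OF _ ev]) simp
  then show ?thesis using True by simp
next
  case False
  define C where "C = real ((2 * k) choose k)"
  define g where "g t = measure lebesgue (K + dil t Z) / t ^ j" for t
  \<comment> \<open>the scales \<open>t\<^sup>2\<close> and \<open>t\<close> make \<open>(t\<^sup>2 - t) / t\<^sup>2\<close> tend to 1\<close>
  have "\<alpha> * \<beta> * (1 - 1 / t) ^ j \<le> C * (g (t\<^sup>2) * g t)" if t: "1 < t" for t
  proof -
    have tt: "t \<le> t\<^sup>2" "0 < t" using t by (auto simp: power2_eq_square)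
    have "(\<alpha> * t ^ j) * (\<beta> * (t\<^sup>2 - t) ^ j) \<le> C * (measure lebesgue (K + dil (t\<^sup>2) Z) * measure lebesgue (K + dil t Z))"
      unfolding C_def
    proof (rule rogers_shephard_layered[OF K(1,2) Z jk(2)])
      show "0 \<le> \<alpha> * t ^ j" "0 \<le> \<beta> * (t\<^sup>2 - t) ^ j" using nonneg tt by simp_all
      show "\<alpha> * t ^ j * s ^ k \<le> measure lebesgue (dil s K + dil t Z)" if "0 \<le> s" "s \<le> 1" for s
        using measure_dil_sum_ge[OF low jk] that tt by simp
      show "\<beta> * (t\<^sup>2 - t) ^ j * s ^ k \<le> measure lebesgue (dil s (K + uminus ` K) + dil (t\<^sup>2 - t) Z)" if "0 \<le> s" "s \<le> 1" for s
        using measure_dil_sum_ge[OF low' jk] that tt by simp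
    qed (use tt in auto)
    also have "\<dots> = C * (g (t\<^sup>2) * g t) * (t ^ j * (t\<^sup>2) ^ j)" using tt by (simp add: g_def del: measure_completion)
    also have "t\<^sup>2 - t = t\<^sup>2 * (1 - 1 / t)" using tt by (simp add: power2_eq_square field_simps)
    finally have "(\<alpha> * \<beta> * (1 - 1 / t) ^ j) * (t ^ j * (t\<^sup>2) ^ j) \<le> C * (g (t\<^sup>2) * g t) * (t ^ j * (t\<^sup>2) ^ j)"
      by (simp add: power_mult_distrib mult_ac)
    moreover have "0 < t ^ j * (t\<^sup>2) ^ j" using tt by simp
    ultimately show ?thesis by (rule mult_right_le_imp_le)
  qed
  then have ev: "\<forall>\<^sub>F t in at_top. \<alpha> * \<beta> * (1 - 1 / t) ^ j \<le> C * (g (t\<^sup>2) * g t)"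
    by (rule eventually_mono[OF eventually_gt_at_top[of 1]])
  have g: "(g \<longlongrightarrow> \<alpha>) at_top" using lim by (simp add: g_def[abs_def])
  have "filterlim (\<lambda>t::real. t\<^sup>2) at_top at_top" by real_asymp
  then have "((\<lambda>t. C * (g (t\<^sup>2) * g t)) \<longlongrightarrow> C * (\<alpha> * \<alpha>)) at_top"
    by (intro tendsto_mult_left tendsto_mult g filterlim_compose[OF g])
  moreover have "((\<lambda>t. \<alpha> * \<beta> * (1 - 1 / t) ^ j) \<longlongrightarrow> \<alpha> * \<beta> * (1 - 0) ^ j) at_top"
    by (intro tendsto_intros) real_asymp
  ultimately have "\<alpha> * \<beta> * (1 - 0) ^ j \<le> C * (\<alpha> * \<alpha>)" using ev by (intro tendsto_le[of at_top]) auto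
  then have "\<alpha> * \<beta> \<le> \<alpha> * (C * \<alpha>)" by (simp add: mult_ac)
  moreover have "0 < \<alpha>" using nonneg False by simp
  ultimately have "\<beta> \<le> C * \<alpha>" by (rule mult_left_le_imp_le)
  then show ?thesis by (simp add: C_def)
qed

section \<open>Steiner polynomials with respect to zonotopes\<close>

lemma top_coefficient_tendsto:
  fixes a :: "'i set \<Rightarrow> real"
  assumes "finite S"
  shows "((\<lambda>t. (\<Sum>T\<in>Pow S. a T * t ^ card T) / t ^ card S) \<longlongrightarrow> a S) at_top"
proof -
  have "((\<lambda>t. \<Sum>T\<in>Pow S. a T * (t ^ card T / t ^ card S)) \<longlongrightarrow> (\<Sum>T\<in>Pow S. a T * (if T = S then 1 else 0))) at_top"
  proof (intro tendsto_sum tendsto_mult_left)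
    fix T assume T: "T \<in> Pow S"
    show "((\<lambda>t::real. t ^ card T / t ^ card S) \<longlongrightarrow> (if T = S then 1 else 0)) at_top"
    proof (cases "T = S")
      case True
      have "\<forall>\<^sub>F t::real in at_top. t ^ card S / t ^ card S = 1"
        by (rule eventually_mono[OF eventually_gt_at_top[of 0]]) auto
      then show ?thesis using True by (simp add: tendsto_eventually)
    next
      case False
      then have lt: "card T < card S" using T assms by (intro psubset_card_mono) auto
      have "\<forall>\<^sub>F t::real in at_top. inverse t ^ (card S - card T) = t ^ card T / t ^ card S"
      proof (rule eventually_mono[OF eventually_gt_at_top[of 0]])
        fix t :: real assume "0 < t"
        then show "inverse t ^ (card S - card T) = t ^ card T / t ^ card S"
          using lt power_add[of t "card T" "card S - card T"] by (simp add: field_simps power_inverse)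
      qed
      moreover have "((\<lambda>t::real. inverse t ^ (card S - card T)) \<longlongrightarrow> 0 ^ (card S - card T)) at_top"
        by (intro tendsto_power tendsto_inverse_0_at_top filterlim_ident)
      then have "((\<lambda>t::real. inverse t ^ (card S - card T)) \<longlongrightarrow> 0) at_top"
        using lt by (simp add: zero_power)
      ultimately show ?thesis using False by (simp add: tendsto_cong)
    qed
  qed
  moreover have "(\<Sum>T\<in>Pow S. a T * (if T = S then 1 else 0)) = a S"
    using assms by (subst sum.mono_neutral_right[of _ "{S}"]) auto
  moreover have "(\<Sum>T\<in>Pow S. a T * (t ^ card T / t ^ card S)) = (\<Sum>T\<in>Pow S. a T * t ^ card T) / t ^ card S" for t :: real
    by (simp add: sum_divide_distrib)
  ultimately show ?thesis by simp
qed

lemma measure_sum_growth: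
  fixes K Z :: "'a::euclidean_space set"
  assumes "compact K" "compact Z"
  obtains c where "\<And>t. 1 \<le> t \<Longrightarrow> measure lebesgue (K + dil t Z) \<le> c * t ^ DIM('a)"
proof -
  obtain p where p: "\<And>x. x \<in> K \<Longrightarrow> norm x \<le> p" using compact_imp_bounded[OF assms(1)] by (auto simp: bounded_iff)
  obtain q where q: "\<And>x. x \<in> Z \<Longrightarrow> norm x \<le> q" using compact_imp_bounded[OF assms(2)] by (auto simp: bounded_iff)
  define c where "c = measure lebesgue (cball (0::'a) (\<bar>p\<bar> + q))"
  have "measure lebesgue (K + dil t Z) \<le> c * t ^ DIM('a)" if t: "1 \<le> t" for t
  proof -
    have "K + dil t Z \<subseteq> dil t (cball 0 (\<bar>p\<bar> + q))"
    proof
      fix x assume "x \<in> K + dil t Z"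
      then obtain k z where x: "x = k + t *\<^sub>R z" "k \<in> K" "z \<in> Z" by (auto simp: set_plus_def)
      have "norm ((1 / t) *\<^sub>R x) \<le> norm ((1 / t) *\<^sub>R k) + norm z"
        using t norm_triangle_ineq[of "(1 / t) *\<^sub>R k" z] by (simp add: x scaleR_add_right)
      also have "norm ((1 / t) *\<^sub>R k) \<le> \<bar>p\<bar>"
      proof -
        have "norm k \<le> \<bar>p\<bar> * t" using p[OF x(2)] t mult_left_mono[of 1 t "\<bar>p\<bar>"] by linarith
        then show ?thesis using t by (simp add: field_simps)
      qed
      finally have "(1 / t) *\<^sub>R x \<in> cball 0 (\<bar>p\<bar> + q)" using q[OF x(3)] by simp
      then have "t *\<^sub>R ((1 / t) *\<^sub>R x) \<in> dil t (cball 0 (\<bar>p\<bar> + q))" by blast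
      then show "x \<in> dil t (cball 0 (\<bar>p\<bar> + q))" using t by simp
    qed
    then have "measure lebesgue (K + dil t Z) \<le> measure lebesgue (dil t (cball (0::'a) (\<bar>p\<bar> + q)))"
      by (rule measure_mono_compact) (intro compact_set_plus compact_scaling assms compact_cball)+
    then show ?thesis using t by (simp add: measure_dil c_def mult.commute del: measure_completion)
  qed
  then show ?thesis using that by blast
qed

lemma difference_body_half:
  fixes K :: "'a::euclidean_space set"
  shows "dil 2 (dil (1/2) (K + uminus ` K)) = K + uminus ` K"
  by (simp add: image_image)

lemma compact_convex_half_difference:
  fixes K :: "'a::euclidean_space set"
  assumes "compact K" "convex K"
  shows "compact (dil (1/2) (K + uminus ` K))" "convex (dil (1/2) (K + uminus ` K))"
  using assms by (auto intro!: compact_scaling compact_set_plus compact_negations convex_scaling convex_set_plus convex_negations)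

text \<open>The symmetric summand \<open>Z\<close> is absorbed: \<open>C + Z\<close> is the symmetrization of \<open>K + Z\<close>.\<close>

lemma measure_half_difference_sum_ge:
  fixes K Z :: "'a::euclidean_space set"
  assumes K: "compact K" "convex K" and Z: "compact Z" "convex Z" "uminus ` Z = Z"
  shows "measure lebesgue (K + Z) \<le> measure lebesgue (dil (1/2) (K + uminus ` K) + Z)"
proof -
  have "uminus ` (K + Z) = uminus ` K + uminus ` Z" by (force simp: set_plus_def image_iff)
  also have "\<dots> = uminus ` K + Z" by (simp add: Z(3))
  finally have neg: "uminus ` (K + Z) = uminus ` K + Z" .
  have "dil (1/2) ((K + Z) + (uminus ` K + Z)) = dil (1/2) (K + uminus ` K) + (dil (1/2) Z + dil (1/2) Z)"
    by (simp add: dil_set_plus add_ac)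
  also have "dil (1/2) Z + dil (1/2) Z = Z" using dil_add_convex[OF Z(2), of "1/2" "1/2"] by simp
  finally have eq: "dil (1/2) ((K + Z) + (uminus ` K + Z)) = dil (1/2) (K + uminus ` K) + Z" .
  have "(\<lambda>x. (-1) *\<^sub>R x + 0) ` (K + Z) = uminus ` (K + Z)" by (intro image_cong) auto
  then have m: "measure lebesgue (uminus ` (K + Z)) = measure lebesgue (K + Z)"
    using measure_lebesgue_affine[of "-1" 0 "K + Z"] by (simp del: measure_completion)
  have "measure lebesgue (K + Z) = sqrt (measure lebesgue (K + Z) * measure lebesgue (uminus ` (K + Z)))"
    unfolding m by (simp del: measure_completion)
  also have "\<dots> \<le> measure lebesgue (dil (1/2) ((K + Z) + uminus ` (K + Z)))"
    by (rule brunn_minkowski_half) (intro compact_set_plus convex_set_plus compact_negations convex_negations K Z)+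
  finally show ?thesis unfolding neg eq .
qed

lemma zonotope_steiner_coefficients:
  fixes K :: "'a::euclidean_space set" and u :: "'i \<Rightarrow> 'a"
  assumes K: "compact K" "convex K" "interior K \<noteq> {}" and M: "finite M"
  defines "C \<equiv> dil (1/2) (K + uminus ` K)"
  shows "\<exists>a a'. (\<forall>t\<ge>0. measure lebesgue (K + dil t (zonotope u M)) = (\<Sum>j\<le>DIM('a). a j * t ^ j)) \<and>
    (\<forall>t\<ge>0. measure lebesgue (C + dil t (zonotope u M)) = (\<Sum>j\<le>DIM('a). a' j * t ^ j)) \<and>
    (\<forall>j k. j + k = DIM('a) \<longrightarrow> 0 < k \<longrightarrow> a j \<le> a' j \<and> a' j \<le> real ((2 * k) choose k) / 2 ^ k * a j)"
proof -
  have C: "compact C" "convex C" unfolding C_def using compact_convex_half_difference[OF K(1,2)] by auto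
  \<comment> \<open>One coefficient function covers all sub-zonotopes, so \<open>B S\<close> is both
    a term of the polynomial for \<open>M\<close> and the leading coefficient of the polynomial for
    \<open>S\<close>.\<close>
  define expands where "expands L B \<longleftrightarrow> (\<forall>S\<subseteq>M. \<forall>t\<ge>0. measure lebesgue (L + dil t (zonotope u S)) = (\<Sum>T\<in>Pow S. B T * t ^ card T))"
    for L B
  have expandsD: "measure lebesgue (L + dil t (zonotope u S)) = (\<Sum>T\<in>Pow S. B T * t ^ card T)"
    if "expands L B" "S \<subseteq> M" "0 \<le> t" for L B S t
    using that unfolding expands_def by blast
  have "\<exists>A. expands K A" unfolding expands_def by (rule measure_sum_zonotope_polynomial[OF M K(1,2)])
  then obtain A where A: "expands K A" ..
  have "\<exists>A. expands C A" unfolding expands_def by (rule measure_sum_zonotope_polynomial[OF M C])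
  then obtain A' where A': "expands C A'" ..
  have fin: "finite S" if "S \<subseteq> M" for S using that M finite_subset by blast
  have gen: "((\<lambda>t. measure lebesgue (L + dil t (zonotope u S)) / t ^ card S) \<longlongrightarrow> B S) at_top \<and> 0 \<le> B S \<and> (DIM('a) < card S \<longrightarrow> B S = 0)"
    if B: "expands L B"
      and S: "S \<subseteq> M" and L: "compact L" for L B S
  proof -
    have ev: "\<forall>\<^sub>F t in at_top. (\<Sum>T\<in>Pow S. B T * t ^ card T) / t ^ card S = measure lebesgue (L + dil t (zonotope u S)) / t ^ card S"
      by (rule eventually_mono[OF eventually_gt_at_top[of 0]]) (use expandsD[OF B S] in auto)
    have lim: "((\<lambda>t. measure lebesgue (L + dil t (zonotope u S)) / t ^ card S) \<longlongrightarrow> B S) at_top"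
      by (rule Lim_transform_eventually[OF top_coefficient_tendsto[OF fin[OF S]] ev])
    have nn: "0 \<le> B S"
      by (rule tendsto_lowerbound[OF lim eventually_mono[OF eventually_gt_at_top[of 0]]]) auto
    \<comment> \<open>With more segments than dimensions, volume growth of order n is too slow for
      the power t^|S|. Hence the polynomial ends at degree n although \<open>M\<close> may be
      large.\<close>
    have "B S \<le> 0" if "DIM('a) < card S"
    proof -
      obtain c where c: "\<And>t. 1 \<le> t \<Longrightarrow> measure lebesgue (L + dil t (zonotope u S)) \<le> c * t ^ DIM('a)"
        using measure_sum_growth[OF L compact_zonotope[OF fin[OF S]]] by blast
      have "\<forall>\<^sub>F t in at_top. measure lebesgue (L + dil t (zonotope u S)) / t ^ card S \<le> c * inverse t ^ (card S - DIM('a))"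
      proof (rule eventually_mono[OF eventually_ge_at_top[of 1]])
        fix t :: real assume t: "1 \<le> t"
        have "measure lebesgue (L + dil t (zonotope u S)) / t ^ card S \<le> c * t ^ DIM('a) / t ^ card S"
          using c[OF t] t by (intro divide_right_mono) auto
        also have "\<dots> = c * inverse t ^ (card S - DIM('a))"
          using t that power_add[of t "DIM('a)" "card S - DIM('a)"] by (simp add: field_simps power_inverse)
        finally show "measure lebesgue (L + dil t (zonotope u S)) / t ^ card S \<le> c * inverse t ^ (card S - DIM('a))" .
      qed
      moreover have "((\<lambda>t. c * inverse t ^ (card S - DIM('a))) \<longlongrightarrow> c * 0 ^ (card S - DIM('a))) at_top"
        by (intro tendsto_mult_left tendsto_power tendsto_inverse_0_at_top filterlim_ident)
      ultimately have "B S \<le> c * 0 ^ (card S - DIM('a))"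
        by (intro tendsto_le[OF _ _ lim]) auto
      also have "\<dots> = 0" using that by (simp add: zero_power)
      finally show ?thesis .
    qed
    then show ?thesis using lim nn by force
  qed
  note gK = gen[OF A _ K(1)]
  note gC = gen[OF A' _ C(1)]
  have lower: "B S * t ^ card S \<le> measure lebesgue (L + dil t (zonotope u S))"
    if B: "expands L B"
      and nn: "\<And>S. S \<subseteq> M \<Longrightarrow> 0 \<le> B S" and S: "S \<subseteq> M" and t: "0 \<le> t" for L B S t
  proof -
    have "B S * t ^ card S \<le> (\<Sum>T\<in>Pow S. B T * t ^ card T)"
      using nn S t fin[OF S] by (intro member_le_sum) auto
    then show ?thesis using expandsD[OF B S t] by simp
  qed
  have le: "A S \<le> A' S" if S: "S \<subseteq> M" for S
  proof (rule tendsto_le[of at_top])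
    show "\<forall>\<^sub>F t in at_top. measure lebesgue (K + dil t (zonotope u S)) / t ^ card S \<le> measure lebesgue (C + dil t (zonotope u S)) / t ^ card S"
    proof (rule eventually_mono[OF eventually_gt_at_top[of 0]])
      fix t :: real assume "0 < t"
      have "uminus ` dil t (zonotope u S) = dil t (uminus ` zonotope u S)" by (simp add: image_image)
      then have "uminus ` dil t (zonotope u S) = dil t (zonotope u S)" by (simp add: zonotope_symmetric[OF fin[OF S]])
      then have "measure lebesgue (K + dil t (zonotope u S)) \<le> measure lebesgue (C + dil t (zonotope u S))"
        unfolding C_def using K S fin
        by (intro measure_half_difference_sum_ge compact_scaling convex_scaling compact_zonotope convex_zonotope) auto
      then show "measure lebesgue (K + dil t (zonotope u S)) / t ^ card S \<le> measure lebesgue (C + dil t (zonotope u S)) / t ^ card S"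
        using \<open>0 < t\<close> by (intro divide_right_mono) auto
    qed
  qed (use gK[OF S] gC[OF S] in auto)
  have up: "A' S \<le> real ((2 * k) choose k) / 2 ^ k * A S" if S: "S \<subseteq> M" and jk: "card S + k = DIM('a)" "0 < k" for S k
  proof -
    have "2 ^ k * A' S \<le> real ((2 * k) choose k) * A S"
    proof (rule leading_coefficient_difference_body[OF K compact_zonotope[OF fin[OF S]] convex_zonotope jk])
      show "0 \<le> A S" "0 \<le> 2 ^ k * A' S" using gK[OF S] gC[OF S] by auto
      show "((\<lambda>t. measure lebesgue (K + dil t (zonotope u S)) / t ^ card S) \<longlongrightarrow> A S) at_top" using gK[OF S] by simp
      show "A S * t ^ card S \<le> measure lebesgue (K + dil t (zonotope u S))" if "0 \<le> t" for t
        by (rule lower[OF A _ S that]) (use gK in auto)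
      show "2 ^ k * A' S * t ^ card S \<le> measure lebesgue (K + uminus ` K + dil t (zonotope u S))" if t: "0 \<le> t" for t
      proof -
        \<comment> \<open>Doubling \<open>C\<close> while the zonotope stays fixed scales only k
          dimensions; this is where 2^k enters.\<close>
        have "(A' S * t ^ card S) * 2 ^ k \<le> measure lebesgue (dil 2 C + dil t (zonotope u S))"
        proof (rule measure_dil_sum_ge[OF _ jk _ t])
          show "A' S * t ^ card S \<le> measure lebesgue (C + dil t (zonotope u S))" if "0 \<le> t" for t
            by (rule lower[OF A' _ S that]) (use gC in auto)
        qed simp
        then show ?thesis unfolding C_def difference_body_half by (simp add: mult_ac del: measure_completion)
      qed
    qed
    then show ?thesis by (simp add: field_simps)
  qed
  \<comment> \<open>Both inequalities hold subset by subset with a constant depending only on the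
    cardinality, so they pass to the sums over subsets of equal size.\<close>
  define coef where "coef B j = (\<Sum>T | T \<in> Pow M \<and> card T = j. B T)" for B :: "'i set \<Rightarrow> real" and j
  have regroup: "(\<Sum>T\<in>Pow M. B T * t ^ card T) = (\<Sum>j\<le>DIM('a). coef B j * t ^ j)"
    if B: "\<And>S. S \<subseteq> M \<Longrightarrow> DIM('a) < card S \<Longrightarrow> B S = 0" for B and t :: real
  proof -
    let ?P = "{T \<in> Pow M. card T \<le> DIM('a)}"
    have fM: "finite (Pow M)" using M by simp
    have "(\<Sum>T\<in>Pow M. B T * t ^ card T) = (\<Sum>T\<in>?P. B T * t ^ card T)"
      by (rule sum.mono_neutral_right) (use fM B in \<open>auto simp: not_le\<close>)
    also have "\<dots> = (\<Sum>j\<le>DIM('a). \<Sum>T\<in>{T \<in> ?P. card T = j}. B T * t ^ card T)"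
      by (rule sum.group[symmetric]) (use fM in auto)
    also have "\<dots> = (\<Sum>j\<le>DIM('a). coef B j * t ^ j)"
    proof (rule sum.cong[OF refl])
      fix j assume "j \<in> {..DIM('a)}"
      then have "{T \<in> ?P. card T = j} = {T. T \<in> Pow M \<and> card T = j}" by auto
      then show "(\<Sum>T\<in>{T \<in> ?P. card T = j}. B T * t ^ card T) = coef B j * t ^ j"
        unfolding coef_def sum_distrib_right by (intro sum.cong) auto
    qed
    finally show ?thesis .
  qed
  show ?thesis
  proof (rule exI[of _ "coef A"], rule exI[of _ "coef A'"], intro conjI allI impI)
    fix t :: real assume t: "0 \<le> t"
    show "measure lebesgue (K + dil t (zonotope u M)) = (\<Sum>j\<le>DIM('a). coef A j * t ^ j)"
      using expandsD[OF A order_refl t] regroup[of A t] gK by simp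
    show "measure lebesgue (C + dil t (zonotope u M)) = (\<Sum>j\<le>DIM('a). coef A' j * t ^ j)"
      using expandsD[OF A' order_refl t] regroup[of A' t] gC by simp
  next
    fix j k :: nat assume jk: "j + k = DIM('a)" "0 < k"
    show "coef A j \<le> coef A' j" unfolding coef_def by (intro sum_mono le) auto
    show "coef A' j \<le> real ((2 * k) choose k) / 2 ^ k * coef A j"
      unfolding coef_def sum_distrib_left by (intro sum_mono up) (use jk in auto)
  qed
qed

text \<open>For bounded degree the coefficients are fixed linear combinations of finitely many
  values, so convergence of the values carries over to them.\<close>

lemma polynomial_coefficients_converge:
  fixes b :: "nat \<Rightarrow> nat \<Rightarrow> real"
  assumes "\<And>t. 0 < t \<Longrightarrow> convergent (\<lambda>m. \<Sum>j\<le>N. b m j * t ^ j)" and "j \<le> N"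
  shows "convergent (\<lambda>m. b m j)"
  using assms
proof (induction N arbitrary: b j)
  case 0
  show ?case using "0.prems"(1)[of 1] "0.prems"(2) by simp
next
  case (Suc N)
  \<comment> \<open>the top term is eliminated by \<open>p(2t) - 2\<^sup>N\<^sup>+\<^sup>1 p(t)\<close>\<close>
  have low: "convergent (\<lambda>m. b m j)" if "j \<le> N" for j
  proof -
    define c :: "nat \<Rightarrow> real" where "c j = 2 ^ j - 2 ^ Suc N" for j
    have "convergent (\<lambda>m. c j * b m j)"
    proof (rule Suc.IH[OF _ that])
      fix t :: real assume t: "0 < t"
      have "(\<Sum>j\<le>N. c j * b m j * t ^ j) = (\<Sum>j\<le>Suc N. b m j * (2 * t) ^ j) - 2 ^ Suc N * (\<Sum>j\<le>Suc N. b m j * t ^ j)" for m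
        by (simp add: c_def sum_distrib_left sum_subtractf[symmetric] power_mult_distrib algebra_simps)
      moreover have "convergent (\<lambda>m. (\<Sum>j\<le>Suc N. b m j * (2 * t) ^ j) - 2 ^ Suc N * (\<Sum>j\<le>Suc N. b m j * t ^ j))"
        by (intro convergent_diff convergent_mult convergent_const Suc.prems(1)) (use t in auto)
      ultimately show "convergent (\<lambda>m. \<Sum>j\<le>N. c j * b m j * t ^ j)" by simp
    qed
    moreover have "c j \<noteq> 0" using that power_strict_increasing[of j "Suc N" "2::real"] by (simp add: c_def)
    ultimately show ?thesis by (simp add: convergent_mult_const_iff)
  qed
  show ?case
  proof (cases "j \<le> N")
    case False
    then have j: "j = Suc N" using Suc.prems(2) by simp
    have "convergent (\<lambda>m. (\<Sum>j\<le>Suc N. b m j * 1 ^ j) - (\<Sum>j\<le>N. b m j))"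
      by (intro convergent_diff convergent_sum Suc.prems(1) low) auto
    then show ?thesis by (simp add: j)
  qed (rule low)
qed

section \<open>Approximation of the ball by zonotopes\<close>

lemma nn_integral_lborel_translate:
  fixes f :: "'a::euclidean_space \<Rightarrow> ennreal"
  assumes [measurable]: "f \<in> borel_measurable borel"
  shows "(\<integral>\<^sup>+x. f (a + x) \<partial>lborel) = (\<integral>\<^sup>+x. f x \<partial>lborel)"
proof -
  have "(\<integral>\<^sup>+x. f x \<partial>lborel) = (\<integral>\<^sup>+x. f x \<partial>density (distr lborel borel (\<lambda>x. a + 1 *\<^sub>R x)) (\<lambda>_. \<bar>1::real\<bar>^DIM('a)))"
    by (subst lborel_affine[of 1 a]) auto
  then show ?thesis by (simp add: nn_integral_density nn_integral_distr)
qed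

lemma nn_integral_lborel_reflect:
  fixes f :: "'a::euclidean_space \<Rightarrow> ennreal"
  assumes [measurable]: "f \<in> borel_measurable borel"
  shows "(\<integral>\<^sup>+x. f (a - x) \<partial>lborel) = (\<integral>\<^sup>+x. f x \<partial>lborel)"
proof -
  have "(\<integral>\<^sup>+x. f x \<partial>lborel) = (\<integral>\<^sup>+x. f x \<partial>density (distr lborel borel (\<lambda>x. a + (-1) *\<^sub>R x)) (\<lambda>_. \<bar>-1::real\<bar>^DIM('a)))"
    by (subst lborel_affine[of "-1" a]) auto
  then show ?thesis by (simp add: nn_integral_density nn_integral_distr)
qed

text \<open>Uniqueness of Haar measure: compute \<open>\<integral>\<integral> 1\<^sub>A(Tx) 1\<^sub>B(y)\<close> in two ways.\<close>

lemma emeasure_linear_vimage_ratio: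
  fixes T :: "'a::euclidean_space \<Rightarrow> 'a"
  assumes T: "linear T" "bij T" and [measurable]: "A \<in> sets borel" "B \<in> sets borel"
  shows "emeasure lborel (T -` A) * emeasure lborel B = emeasure lborel (T -` B) * emeasure lborel A"
proof -
  have Tm [measurable]: "T \<in> borel_measurable borel"
    using T(1) by (intro borel_measurable_continuous_onI linear_continuous_on linear_conv_bounded_linear[THEN iffD1])
  have vm: "T -` X \<in> sets borel" if "X \<in> sets borel" for X
    using measurable_sets[OF Tm that] by simp
  have ind: "emeasure lborel (T -` X) = (\<integral>\<^sup>+x. indicator X (T x) \<partial>lborel)" if "X \<in> sets borel" for X
  proof -
    have "emeasure lborel (T -` X) = (\<integral>\<^sup>+x. indicator (T -` X) x \<partial>lborel)" using vm[OF that] by simp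
    then show ?thesis by (simp add: indicator_def vimage_def)
  qed
  have "emeasure lborel (T -` A) * emeasure lborel B = (\<integral>\<^sup>+x. indicator A (T x) * (\<integral>\<^sup>+y. indicator B y \<partial>lborel) \<partial>lborel)"
    by (simp add: ind nn_integral_multc)
  also have "\<dots> = (\<integral>\<^sup>+x. (\<integral>\<^sup>+y. indicator A (T x) * indicator B (T x + y) \<partial>lborel) \<partial>lborel)"
  proof (rule nn_integral_cong)
    fix x
    have "(\<integral>\<^sup>+y. indicator B (T x + y) \<partial>lborel) = (\<integral>\<^sup>+y. indicator B y \<partial>lborel)"
      by (rule nn_integral_lborel_translate) measurable
    then show "indicator A (T x) * (\<integral>\<^sup>+y. indicator B y \<partial>lborel) = (\<integral>\<^sup>+y. indicator A (T x) * indicator B (T x + y) \<partial>lborel)"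
      by (simp add: nn_integral_cmult)
  qed
  also have "\<dots> = (\<integral>\<^sup>+y. (\<integral>\<^sup>+x. indicator A (T x) * indicator B (T x + y) \<partial>lborel) \<partial>lborel)"
    by (rule lborel_pair.Fubini') measurable
  also have "\<dots> = (\<integral>\<^sup>+y. (\<integral>\<^sup>+x. indicator A (T x - y) * indicator B (T x) \<partial>lborel) \<partial>lborel)"
  proof (rule nn_integral_cong)
    fix y
    \<comment> \<open>Surjectivity of \<open>T\<close> turns the shift by \<open>y\<close> in the
      image into a shift of the integration variable.\<close>
    obtain v where v: "T v = y" using T(2) by (metis bij_pointE)
    have "(\<integral>\<^sup>+x. indicator A (T x) * indicator B (T x + y) \<partial>lborel) =
      (\<integral>\<^sup>+x. indicator A (T (- v + x)) * indicator B (T (- v + x) + y) \<partial>lborel)"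
      by (rule nn_integral_lborel_translate[symmetric, of "\<lambda>x. indicator A (T x) * indicator B (T x + y)"]) measurable
    also have "\<dots> = (\<integral>\<^sup>+x. indicator A (T x - y) * indicator B (T x) \<partial>lborel)"
    proof -
      have "T (- v + x) = T x - y" for x using v linear_diff[OF T(1), of x v] by simp
      then show ?thesis by simp
    qed
    finally show "(\<integral>\<^sup>+x. indicator A (T x) * indicator B (T x + y) \<partial>lborel) =
      (\<integral>\<^sup>+x. indicator A (T x - y) * indicator B (T x) \<partial>lborel)" .
  qed
  also have "\<dots> = (\<integral>\<^sup>+x. (\<integral>\<^sup>+y. indicator A (T x - y) * indicator B (T x) \<partial>lborel) \<partial>lborel)"
    by (rule lborel_pair.Fubini'[symmetric]) measurable
  also have "\<dots> = (\<integral>\<^sup>+x. indicator B (T x) * (\<integral>\<^sup>+y. indicator A y \<partial>lborel) \<partial>lborel)"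
  proof (rule nn_integral_cong)
    fix x
    have "(\<integral>\<^sup>+y. indicator A (T x - y) \<partial>lborel) = (\<integral>\<^sup>+y. indicator A y \<partial>lborel)"
      by (rule nn_integral_lborel_reflect) measurable
    moreover have "(\<integral>\<^sup>+y. indicator A (T x - y) * indicator B (T x) \<partial>lborel) = (\<integral>\<^sup>+y. indicator A (T x - y) \<partial>lborel) * indicator B (T x)"
      by (rule nn_integral_multc) measurable
    ultimately show "(\<integral>\<^sup>+y. indicator A (T x - y) * indicator B (T x) \<partial>lborel) = indicator B (T x) * (\<integral>\<^sup>+y. indicator A y \<partial>lborel)"
      by (simp only: mult.commute)
  qed
  also have "\<dots> = emeasure lborel (T -` B) * emeasure lborel A"
    by (simp add: ind nn_integral_multc)
  finally show ?thesis .
qed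

text \<open>The image of Lebesgue measure is a constant multiple of it, and the unit ball, which
  \<open>T\<close> preserves, shows that the constant is 1.\<close>

lemma distr_orthogonal_transformation:
  fixes T :: "'a::euclidean_space \<Rightarrow> 'a"
  assumes "orthogonal_transformation T"
  shows "distr lborel borel T = lborel"
proof (rule measure_eqI)
  have T: "linear T" "bij T" using assms by (auto simp: orthogonal_transformation_linear orthogonal_transformation_bij)
  have Tm [measurable]: "T \<in> borel_measurable borel"
    using T(1) by (intro borel_measurable_continuous_onI linear_continuous_on linear_conv_bounded_linear[THEN iffD1])
  show "sets (distr lborel borel T) = sets lborel" by simp
  fix A assume "A \<in> sets (distr lborel borel T)"
  then have A: "A \<in> sets borel" by simp
  let ?B = "cball (0::'a) 1"
  have "norm (T x) = norm x" for x using assms by (simp add: orthogonal_transformation_norm)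
  then have "T -` ?B = ?B" by auto
  then have "emeasure lborel (T -` A) * emeasure lborel ?B = emeasure lborel ?B * emeasure lborel A"
    using emeasure_linear_vimage_ratio[OF T A, of ?B] by simp
  moreover have "emeasure lborel ?B \<noteq> 0" "emeasure lborel ?B \<noteq> top"
  proof -
    have "0 < measure lebesgue ?B" using content_cball_pos[of 1 "0::'a"] by simp
    then show "emeasure lborel ?B \<noteq> 0" "emeasure lborel ?B \<noteq> top" unfolding emeasure_compact[OF compact_cball] by simp_all
  qed
  ultimately have "emeasure lborel (T -` A) = emeasure lborel A"
    by (metis ennreal_mult_cancel_left mult.commute)
  then show "emeasure (distr lborel borel T) A = emeasure lborel A" using A by (simp add: emeasure_distr)
qed

section \<open>The Euclidean norm as an integral of absolute linear forms\<close>

text \<open>The support function of a zonoid, the continuous sum of the segments from -x to x over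
  the unit ball. Rotation invariance makes it a multiple of the norm, the support function of the
  ball, and its Riemann sums are support functions of zonotopes.\<close>

definition mean_width_integral :: "'a::euclidean_space \<Rightarrow> real" where
  "mean_width_integral w = (\<integral>x. \<bar>w \<bullet> x\<bar> * indicator (cball 0 1) x \<partial>lborel)"

lemma integrable_abs_inner_ball:
  fixes w :: "'a::euclidean_space"
  shows "integrable lborel (\<lambda>x. \<bar>w \<bullet> x\<bar> * indicator (cball 0 1) x)"
proof -
  have "integrable lborel (\<lambda>x. indicator (cball 0 1) x *\<^sub>R \<bar>w \<bullet> x\<bar>)"
    by (rule borel_integrable_compact) (auto intro!: continuous_intros)
  then show ?thesis by (simp add: mult.commute)
qed

lemma mean_width_integral_scaleR:
  "mean_width_integral (c *\<^sub>R w) = \<bar>c\<bar> * mean_width_integral w"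
  unfolding mean_width_integral_def by (simp add: abs_mult mult.assoc)

lemma mean_width_integral_orthogonal:
  fixes T :: "'a::euclidean_space \<Rightarrow> 'a"
  assumes "orthogonal_transformation T"
  shows "mean_width_integral (T w) = mean_width_integral w"
proof -
  have Tm [measurable]: "T \<in> borel_measurable borel"
    using assms by (intro borel_measurable_continuous_onI linear_continuous_on linear_conv_bounded_linear[THEN iffD1] orthogonal_transformation_linear)
  have [measurable]: "cball (0::'a) 1 \<in> sets borel" by simp
  have "mean_width_integral (T w) = (\<integral>x. \<bar>T w \<bullet> x\<bar> * indicator (cball 0 1) x \<partial>distr lborel borel T)"
    unfolding mean_width_integral_def distr_orthogonal_transformation[OF assms] ..
  also have "\<dots> = (\<integral>x. \<bar>T w \<bullet> T x\<bar> * indicator (cball 0 1) (T x) \<partial>lborel)"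
    by (rule integral_distr) measurable
  also have "\<dots> = mean_width_integral w"
    using assms unfolding mean_width_integral_def
    by (intro Bochner_Integration.integral_cong) (auto simp: orthogonal_transformation_def indicator_def norm_eq_sqrt_inner)
  finally show ?thesis .
qed

text \<open>On the ball of radius 1/4 about e/2, points have norm at most 3/4 and inner product with
  \<open>e\<close> at least 1/4.\<close>

lemma mean_width_integral_pos:
  fixes e :: "'a::euclidean_space"
  assumes "norm e = 1" shows "0 < mean_width_integral e"
proof -
  let ?b = "cball ((1/2) *\<^sub>R e) (1/4)"
  have 1: "(1/4) * indicator ?b x \<le> \<bar>e \<bullet> x\<bar> * indicator (cball 0 1) x" for x
  proof (cases "x \<in> ?b")
    case True
    then have n: "norm ((1/2) *\<^sub>R e - x) \<le> 1/4" by (simp add: dist_norm)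
    have "norm x \<le> norm ((1/2) *\<^sub>R e) + norm ((1/2) *\<^sub>R e - x)"
      using norm_triangle_sub[of x "(1/2) *\<^sub>R e"] by (simp add: norm_minus_commute)
    then have x1: "x \<in> cball 0 1" using n assms by simp
    have "e \<bullet> ((1/2) *\<^sub>R e - x) \<le> 1/4"
      using norm_cauchy_schwarz[of e "(1/2) *\<^sub>R e - x"] n assms by simp
    moreover have "e \<bullet> e = 1" using assms by (simp add: norm_eq_1)
    ultimately have "1/4 \<le> e \<bullet> x" by (simp add: inner_diff_right)
    then show ?thesis using True x1 by simp
  qed simp
  have int: "integrable lborel (\<lambda>x. (1/4) * indicator ?b x :: real)"
    by (intro integrable_mult_right integrable_real_indicator) (use emeasure_compact_finite[OF compact_cball] in auto)
  have "0 < (1/4) * measure lborel ?b" using content_cball_pos[of "1/4" "(1/2) *\<^sub>R e"] by simp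
  also have "\<dots> = (\<integral>x. (1/4) * indicator ?b x \<partial>lborel)" by simp
  also have "\<dots> \<le> mean_width_integral e"
    unfolding mean_width_integral_def by (intro integral_mono int integrable_abs_inner_ball 1)
  finally show ?thesis .
qed

text \<open>Orthogonal maps act transitively on the unit sphere, so the function is constant there;
  homogeneity does the rest.\<close>

lemma mean_width_integral_norm:
  "\<exists>c>0. \<forall>w :: real^'n. mean_width_integral w = c * norm w"
proof -
  define e :: "real^'n" where "e = axis undefined 1"
  have e: "norm e = 1" by (simp add: e_def norm_axis_1)
  have "mean_width_integral w = mean_width_integral e * norm w" for w :: "real^'n"
  proof (cases "w = 0")
    case False
    then have "norm ((1 / norm w) *\<^sub>R w) = 1" by simp
    then obtain T where T: "orthogonal_transformation T" "T e = (1 / norm w) *\<^sub>R w"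
      using orthogonal_transformation_exists_1[OF e] by metis
    have "w = norm w *\<^sub>R T e" using False T(2) by simp
    then have "mean_width_integral w = norm w * mean_width_integral (T e)"
      using mean_width_integral_scaleR[of "norm w" "T e"] by simp
    then show ?thesis using mean_width_integral_orthogonal[OF T(1)] by simp
  qed (simp add: mean_width_integral_def)
  then show ?thesis using mean_width_integral_pos[OF e] by blast
qed

text \<open>The integrand is Lipschitz in \<open>x\<close> with constant \<open>norm w\<close>, so
  moving each piece of mass to a nearby sample point costs at most \<delta> times that. The error is
  uniform relative to \<open>norm w\<close>, as an inclusion between balls requires.\<close>

lemma mean_width_integral_riemann:
  fixes \<delta> :: real
  assumes "0 < \<delta>"
  shows "\<exists>(N::nat) m (p :: nat \<Rightarrow> 'a::euclidean_space). (\<forall>i. 0 \<le> m i) \<and>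
    (\<forall>w. \<bar>mean_width_integral w - (\<Sum>i<N. m i * \<bar>w \<bullet> p i\<bar>)\<bar> \<le> \<delta> * norm w * measure lborel (cball (0::'a) 1))"
proof -
  let ?B = "cball (0::'a) 1"
  obtain k where k: "finite k" "?B \<subseteq> (\<Union>x\<in>k. ball x \<delta>)"
    using seq_compact_imp_totally_bounded[of ?B] assms compact_imp_seq_compact[OF compact_cball] by metis
  obtain p :: "nat \<Rightarrow> 'a" and N where p: "k = p ` {i. i < N}" using k(1) finite_imp_nat_seg_image_inj_on by metis
  \<comment> \<open>Making the covering balls disjoint yields a measurable partition of the unit
    ball; pieces may be empty and then carry mass 0.\<close>
  define P where "P i = ?B \<inter> disjointed (\<lambda>i. ball (p i) \<delta>) i" for i
  have P_sets [measurable]: "P i \<in> sets borel" for i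
  proof -
    have "range (disjointed (\<lambda>i. ball (p i) \<delta>)) \<subseteq> sets borel" by (intro sets.range_disjointed_sets) auto
    then show ?thesis unfolding P_def by auto
  qed
  have P_sub: "P i \<subseteq> ?B" "P i \<subseteq> ball (p i) \<delta>" for i using disjointed_subset[of "\<lambda>i. ball (p i) \<delta>" i] by (auto simp: P_def)
  have disj: "i = j" if "x \<in> P i" "x \<in> P j" for x i j
    using that disjoint_family_disjointed[of "\<lambda>i. ball (p i) \<delta>"] by (auto simp: P_def disjoint_family_on_def)
  have cov: "\<exists>i<N. x \<in> P i" if "x \<in> ?B" for x
  proof -
    have "x \<in> (\<Union>i\<in>{0..<N}. ball (p i) \<delta>)" using that k(2) p by (auto simp: subset_eq atLeast0LessThan)
    then have "x \<in> (\<Union>i\<in>{0..<N}. disjointed (\<lambda>i. ball (p i) \<delta>) i)" by (simp add: finite_UN_disjointed_eq)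
    then show ?thesis using that by (auto simp: P_def)
  qed
  have fin: "emeasure lborel (P i) < \<infinity>" for i
    using P_sub(1)[of i] by (intro emeasure_bounded_finite bounded_subset[OF bounded_cball])
  have "\<bar>mean_width_integral w - (\<Sum>i<N. measure lborel (P i) * \<bar>w \<bullet> p i\<bar>)\<bar> \<le> \<delta> * norm w * measure lborel ?B" for w
  proof -
    define g where "g x = (\<Sum>i<N. \<bar>w \<bullet> p i\<bar> * indicator (P i) x)" for x
    have gi: "integrable lborel g" unfolding g_def
      using fin by (intro Bochner_Integration.integrable_sum integrable_mult_right integrable_real_indicator) auto
    have gI: "(\<integral>x. g x \<partial>lborel) = (\<Sum>i<N. measure lborel (P i) * \<bar>w \<bullet> p i\<bar>)"
      unfolding g_def using fin
      by (subst Bochner_Integration.integral_sum) (auto intro!: integrable_mult_right integrable_real_indicator simp: mult.commute)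
    have pt: "\<bar>\<bar>w \<bullet> x\<bar> * indicator ?B x - g x\<bar> \<le> \<delta> * norm w * indicator ?B x" for x
    proof (cases "x \<in> ?B")
      case True
      then obtain i where i: "i < N" "x \<in> P i" using cov by blast
      have "g x = (\<Sum>j<N. if j = i then \<bar>w \<bullet> p i\<bar> else 0)"
        unfolding g_def using disj i(2) by (intro sum.cong) (auto simp: indicator_def)
      then have "g x = \<bar>w \<bullet> p i\<bar>" using i(1) by simp
      moreover have "\<bar>\<bar>w \<bullet> x\<bar> - \<bar>w \<bullet> p i\<bar>\<bar> \<le> \<bar>w \<bullet> (x - p i)\<bar>" by (simp add: inner_diff_right)
      moreover have "\<bar>w \<bullet> (x - p i)\<bar> \<le> norm w * norm (x - p i)" by (rule Cauchy_Schwarz_ineq2)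
      moreover have "norm w * norm (x - p i) \<le> norm w * \<delta>"
        using P_sub(2)[of i] i(2) by (intro mult_left_mono) (auto simp: dist_norm norm_minus_commute subset_eq)
      ultimately show ?thesis using True by (simp add: mult.commute)
    next
      case False
      then have "x \<notin> P i" for i using P_sub(1)[of i] by blast
      then have "g x = 0" unfolding g_def by simp
      then show ?thesis using False by simp
    qed
    have Bi: "integrable lborel (\<lambda>x. \<delta> * norm w * indicator ?B x :: real)"
      by (intro integrable_mult_right integrable_real_indicator) (use emeasure_compact_finite[OF compact_cball] in auto)
    have "\<bar>mean_width_integral w - (\<integral>x. g x \<partial>lborel)\<bar> = \<bar>\<integral>x. \<bar>w \<bullet> x\<bar> * indicator ?B x - g x \<partial>lborel\<bar>"
      unfolding mean_width_integral_def by (simp add: integrable_abs_inner_ball gi)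
    also have "\<dots> \<le> (\<integral>x. \<delta> * norm w * indicator ?B x \<partial>lborel)"
      by (intro order_trans[OF integral_abs_bound] integral_mono integrable_abs Bochner_Integration.integrable_diff integrable_abs_inner_ball gi Bi pt)
    also have "\<dots> = \<delta> * norm w * measure lborel ?B" by simp
    finally show ?thesis unfolding gI .
  qed
  then show ?thesis
    by (intro exI[of _ N] exI[of _ "\<lambda>i. measure lborel (P i)"] exI[of _ p]) simp
qed

section \<open>Support functions of zonotopes\<close>

text \<open>Together with \<open>zonotope_inner_attained\<close> this computes the support function:
  each segment contributes at most |w . u i|, and exactly that at one of its endpoints.\<close>

lemma zonotope_inner_le:
  fixes u :: "'i \<Rightarrow> 'a::real_inner"
  assumes "finite S" "z \<in> zonotope u S" shows "w \<bullet> z \<le> (\<Sum>i\<in>S. \<bar>w \<bullet> u i\<bar>)"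
  using assms
proof (induction S arbitrary: z rule: finite_induct)
  case (insert i S)
  then obtain x y where xy: "x \<in> closed_segment (- u i) (u i)" "y \<in> zonotope u S" "z = x + y"
    by (auto simp: zonotope_insert elim: set_plus_elim)
  obtain c where c: "0 \<le> c" "c \<le> 1" "x = (1 - c) *\<^sub>R (- u i) + c *\<^sub>R u i" using xy(1) by (auto simp: in_segment)
  have "w \<bullet> x = (2 * c - 1) * (w \<bullet> u i)" by (simp add: c(3) inner_simps algebra_simps)
  also have "\<dots> \<le> \<bar>2 * c - 1\<bar> * \<bar>w \<bullet> u i\<bar>" using abs_ge_self[of "(2 * c - 1) * (w \<bullet> u i)"] by (simp add: abs_mult)
  also have "\<dots> \<le> 1 * \<bar>w \<bullet> u i\<bar>" using c by (intro mult_right_mono) auto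
  finally show ?case using insert xy by (simp add: inner_add_right add_mono)
qed simp

lemma zonotope_inner_attained:
  fixes u :: "'i \<Rightarrow> 'a::real_inner"
  assumes "finite S" shows "\<exists>z\<in>zonotope u S. w \<bullet> z = (\<Sum>i\<in>S. \<bar>w \<bullet> u i\<bar>)"
  using assms
proof (induction S rule: finite_induct)
  case (insert i S)
  then obtain y where y: "y \<in> zonotope u S" "w \<bullet> y = (\<Sum>i\<in>S. \<bar>w \<bullet> u i\<bar>)" by blast
  define x where "x = (if 0 \<le> w \<bullet> u i then u i else - u i)"
  have x: "x \<in> closed_segment (- u i) (u i)" "w \<bullet> x = \<bar>w \<bullet> u i\<bar>" by (auto simp: x_def)
  have "x + y \<in> zonotope u (insert i S)" using x y insert.hyps by (auto simp: zonotope_insert)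
  moreover have "w \<bullet> (x + y) = (\<Sum>i\<in>insert i S. \<bar>w \<bullet> u i\<bar>)" using x y insert.hyps by (simp add: inner_add_right)
  ultimately show ?case by blast
qed simp

text \<open>For the outer ball a point is tested against itself as direction. For the inner ball, a
  point outside is separated by some \<open>a\<close>, and in direction \<open>-a\<close> it would
  exceed the support function of the zonotope.\<close>

lemma zonotope_between_balls:
  fixes u :: "'i \<Rightarrow> 'a::euclidean_space"
  assumes S: "finite S" and h: "\<And>w. \<bar>(\<Sum>i\<in>S. \<bar>w \<bullet> u i\<bar>) - norm w\<bar> \<le> \<epsilon> * norm w"
  shows "cball 0 (1 - \<epsilon>) \<subseteq> zonotope u S" "zonotope u S \<subseteq> cball 0 (1 + \<epsilon>)"
proof -
  show "zonotope u S \<subseteq> cball 0 (1 + \<epsilon>)"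
  proof
    fix z assume z: "z \<in> zonotope u S"
    have "norm z * norm z = z \<bullet> z" by (simp add: norm_eq_sqrt_inner)
    also have "\<dots> \<le> (\<Sum>i\<in>S. \<bar>z \<bullet> u i\<bar>)" by (rule zonotope_inner_le[OF S z])
    also have "\<dots> \<le> (1 + \<epsilon>) * norm z" using h[of z] by (simp add: algebra_simps abs_le_iff)
    finally have "norm z * norm z \<le> (1 + \<epsilon>) * norm z" .
    \<comment> \<open>The sign is read off the hypothesis at a basis vector; it is needed for z = 0,
      where no factor \<open>norm z\<close> can be cancelled.\<close>
    moreover have "0 \<le> \<epsilon>"
    proof -
      obtain b :: 'a where "b \<in> Basis" using nonempty_Basis by blast
      then show ?thesis using order_trans[OF abs_ge_zero h[of b]] by simp
    qed
    ultimately have "norm z \<le> 1 + \<epsilon>" by (cases "z = 0") auto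
    then show "z \<in> cball 0 (1 + \<epsilon>)" by simp
  qed
  show "cball 0 (1 - \<epsilon>) \<subseteq> zonotope u S"
  proof (rule subsetI, rule ccontr)
    fix x assume x: "x \<in> cball 0 (1 - \<epsilon>)" "x \<notin> zonotope u S"
    obtain a b where ab: "a \<bullet> x < b" "\<And>z. z \<in> zonotope u S \<Longrightarrow> b < a \<bullet> z"
      using separating_hyperplane_closed_point[OF convex_zonotope compact_imp_closed[OF compact_zonotope[OF S]] x(2)] by blast
    obtain z where z: "z \<in> zonotope u S" "(- a) \<bullet> z = (\<Sum>i\<in>S. \<bar>(- a) \<bullet> u i\<bar>)"
      using zonotope_inner_attained[OF S] by blast
    have "(- a) \<bullet> z < (- a) \<bullet> x" using ab(1) ab(2)[OF z(1)] by simp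
    also have "\<dots> \<le> norm (- a) * norm x" by (rule norm_cauchy_schwarz)
    also have "\<dots> \<le> norm (- a) * (1 - \<epsilon>)" using x(1) by (intro mult_left_mono) auto
    also have "\<dots> \<le> (\<Sum>i\<in>S. \<bar>(- a) \<bullet> u i\<bar>)" using h[of "- a"] by (simp add: algebra_simps abs_le_iff)
    finally show False using z(2) by simp
  qed
qed

theorem ball_zonotope_approximation:
  assumes "0 < \<epsilon>"
  obtains N :: nat and u :: "nat \<Rightarrow> real^'n"
  where "cball 0 (1 - \<epsilon>) \<subseteq> zonotope u {..<N}" "zonotope u {..<N} \<subseteq> cball 0 (1 + \<epsilon>)"
proof -
  obtain c where c: "0 < c" "\<And>w :: real^'n. mean_width_integral w = c * norm w"
    using mean_width_integral_norm[where 'n = 'n] by blast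
  define V where "V = measure lborel (cball (0::real^'n) 1)"
  have V: "0 < V" unfolding V_def using content_cball_pos[of 1 "0::real^'n"] by simp
  \<comment> \<open>The mesh is chosen so that the Riemann error becomes \<epsilon> c |w|; dividing
    the weights by \<open>c\<close> then normalizes the limit to |w|.\<close>
  obtain N :: nat and m and p :: "nat \<Rightarrow> real^'n" where m: "\<And>i. 0 \<le> m i"
    and *: "\<And>w. \<bar>mean_width_integral w - (\<Sum>i<N. m i * \<bar>w \<bullet> p i\<bar>)\<bar> \<le> (\<epsilon> * c / V) * norm w * V"
    using mean_width_integral_riemann[where 'a = "real^'n", of "\<epsilon> * c / V"] assms c(1) V unfolding V_def
    by (auto simp del: times_divide_eq_left)
  define u where "u i = (m i / c) *\<^sub>R p i" for i
  have "\<bar>(\<Sum>i<N. \<bar>w \<bullet> u i\<bar>) - norm w\<bar> \<le> \<epsilon> * norm w" for w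
  proof -
    have "(\<Sum>i<N. \<bar>w \<bullet> u i\<bar>) = (\<Sum>i<N. m i * \<bar>w \<bullet> p i\<bar>) / c"
      using m c(1) by (simp add: u_def abs_mult sum_divide_distrib)
    then have "c * \<bar>(\<Sum>i<N. \<bar>w \<bullet> u i\<bar>) - norm w\<bar> = \<bar>c * norm w - (\<Sum>i<N. m i * \<bar>w \<bullet> p i\<bar>)\<bar>"
      using c(1) abs_mult[of c "(\<Sum>i<N. \<bar>w \<bullet> u i\<bar>) - norm w"] by (simp add: right_diff_distrib abs_minus_commute)
    also have "\<dots> \<le> c * (\<epsilon> * norm w)" using *[of w] V c(2) by (simp add: mult_ac)
    finally show ?thesis using c(1) by simp
  qed
  then show ?thesis using that zonotope_between_balls[of "{..<N}" u \<epsilon>] by blast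
qed

section \<open>Steiner polynomials and quermassintegrals\<close>

lemma dil_cball: "0 \<le> t \<Longrightarrow> 0 \<le> r \<Longrightarrow> dil t (cball 0 r) = cball (0::'a::real_normed_vector) (t * r)"
proof (cases "t = 0")
  case True
  assume "0 \<le> r"
  with True show ?thesis by (simp add: image_constant_conv)
qed (use cball_scale[of t 0 r] in auto)

text \<open>The factors 1 - e and 1 + e are applied to all of L + t B, with a shift by
  \<open>e m *\<^sub>R a\<close> for a point \<open>a\<close> of \<open>L\<close>; convexity absorbs
  the change of \<open>L\<close>. The volume is thus squeezed between (1 - e)^n V and (1 + e)^n
  V.\<close>

lemma measure_sum_near_ball_tendsto:
  fixes L :: "'a::euclidean_space set" and Z :: "nat \<Rightarrow> 'a set"
  assumes L: "compact L" "convex L" "L \<noteq> {}" and Z: "\<And>m. compact (Z m)"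
    and e: "\<And>m. 0 < e m" "\<And>m. e m < 1" "e \<longlonglongrightarrow> 0"
    and sub: "\<And>m. cball 0 (1 - e m) \<subseteq> Z m" "\<And>m. Z m \<subseteq> cball 0 (1 + e m)" and t: "0 \<le> t"
  shows "(\<lambda>m. measure lebesgue (L + dil t (Z m))) \<longlonglongrightarrow> measure lebesgue (L + dil t (cball 0 1))"
proof -
  obtain a where a: "a \<in> L" using L(3) by blast
  let ?B = "cball (0::'a) 1"
  define V where "V = measure lebesgue (L + dil t ?B)"
  have lo: "(1 - e m) ^ DIM('a) * V \<le> measure lebesgue (L + dil t (Z m))" for m
  proof -
    have "{e m *\<^sub>R a} + dil (1 - e m) (L + dil t ?B) \<subseteq> L + dil t (Z m)"
    proof
      fix x assume "x \<in> {e m *\<^sub>R a} + dil (1 - e m) (L + dil t ?B)"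
      then obtain l b where x: "l \<in> L" "b \<in> ?B" "x = e m *\<^sub>R a + (1 - e m) *\<^sub>R (l + t *\<^sub>R b)"
        by (auto simp: set_plus_def)
      have "(1 - e m) *\<^sub>R l + e m *\<^sub>R a \<in> L" using L(2) x(1) a e(1,2)[of m] by (simp add: convex_alt)
      moreover have "(1 - e m) *\<^sub>R b \<in> Z m" using sub(1)[of m] x(2) e(2)[of m] mult_left_mono[of "norm b" 1 "1 - e m"] by auto
      moreover have "x = ((1 - e m) *\<^sub>R l + e m *\<^sub>R a) + t *\<^sub>R ((1 - e m) *\<^sub>R b)" by (simp add: x(3) algebra_simps)
      ultimately show "x \<in> L + dil t (Z m)" by blast
    qed
    then have "measure lebesgue ({e m *\<^sub>R a} + dil (1 - e m) (L + dil t ?B)) \<le> measure lebesgue (L + dil t (Z m))"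
      by (rule measure_mono_compact) (intro compact_set_plus compact_scaling L Z compact_cball compact_sing)+
    then show ?thesis unfolding measure_sum_translation V_def using e(2)[of m] by (simp add: measure_dil del: measure_completion)
  qed
  have up: "measure lebesgue (L + dil t (Z m)) \<le> (1 + e m) ^ DIM('a) * V" for m
  proof -
    have "{e m *\<^sub>R a} + (L + dil t (Z m)) \<subseteq> dil (1 + e m) (L + dil t ?B)"
    proof
      fix x assume "x \<in> {e m *\<^sub>R a} + (L + dil t (Z m))"
      then obtain l z where x: "l \<in> L" "z \<in> Z m" "x = e m *\<^sub>R a + (l + t *\<^sub>R z)"
        by (auto simp: set_plus_def)
      have p: "0 < 1 + e m" using e(1)[of m] by simp
      have "1 *\<^sub>R l + e m *\<^sub>R a \<in> dil 1 L + dil (e m) L" using x(1) a by blast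
      also have "dil 1 L + dil (e m) L = dil (1 + e m) L" using e(1)[of m] by (intro dil_add_convex L) auto
      finally obtain l' where l': "l' \<in> L" "l + e m *\<^sub>R a = (1 + e m) *\<^sub>R l'" by auto
      have "norm z \<le> 1 + e m" using sub(2)[of m] x(2) by auto
      then have "(1 / (1 + e m)) *\<^sub>R z \<in> ?B" using p by (simp add: field_simps)
      then have "l' + t *\<^sub>R ((1 / (1 + e m)) *\<^sub>R z) \<in> L + dil t ?B" using l'(1) by blast
      moreover have "x = (1 + e m) *\<^sub>R (l' + t *\<^sub>R ((1 / (1 + e m)) *\<^sub>R z))"
      proof -
        have "(1 + e m) * (t * (1 / (1 + e m))) = t" using p by (simp add: field_simps)
        then have eq: "(1 + e m) *\<^sub>R (t *\<^sub>R ((1 / (1 + e m)) *\<^sub>R z)) = t *\<^sub>R z" by (simp only: scaleR_scaleR)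
        show ?thesis unfolding scaleR_add_right[of "1 + e m" l'] l'(2)[symmetric] eq by (simp add: x(3) ac_simps)
      qed
      ultimately show "x \<in> dil (1 + e m) (L + dil t ?B)" by blast
    qed
    then have "measure lebesgue ({e m *\<^sub>R a} + (L + dil t (Z m))) \<le> measure lebesgue (dil (1 + e m) (L + dil t ?B))"
      by (rule measure_mono_compact) (intro compact_set_plus compact_scaling L Z compact_cball compact_sing)+
    then show ?thesis unfolding measure_sum_translation V_def using e(1)[of m] by (simp add: measure_dil del: measure_completion)
  qed
  have "(\<lambda>m. (1 - e m) ^ DIM('a) * V) \<longlonglongrightarrow> (1 - 0) ^ DIM('a) * V" by (intro tendsto_intros e)
  moreover have "(\<lambda>m. (1 + e m) ^ DIM('a) * V) \<longlonglongrightarrow> (1 + 0) ^ DIM('a) * V" by (intro tendsto_intros e)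
  ultimately have "(\<lambda>m. (1 - e m) ^ DIM('a) * V) \<longlonglongrightarrow> V" "(\<lambda>m. (1 + e m) ^ DIM('a) * V) \<longlonglongrightarrow> V" by simp_all
  then have "(\<lambda>m. measure lebesgue (L + dil t (Z m))) \<longlonglongrightarrow> V"
    by (rule real_tendsto_sandwich[rotated 2]) (rule always_eventually, rule allI, rule lo up)+
  then show ?thesis unfolding V_def .
qed

theorem steiner_coefficients:
  fixes K :: "(real^'n) set"
  assumes K: "compact K" "convex K" "interior K \<noteq> {}"
  defines "C \<equiv> dil (1/2) (K + uminus ` K)"
  shows "\<exists>a a'. (\<forall>t\<ge>0. measure lebesgue (K + dil t (cball 0 1)) = (\<Sum>j\<le>CARD('n). a j * t ^ j)) \<and>
    (\<forall>t\<ge>0. measure lebesgue (C + dil t (cball 0 1)) = (\<Sum>j\<le>CARD('n). a' j * t ^ j)) \<and>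
    (\<forall>j k. j + k = CARD('n) \<longrightarrow> 0 < k \<longrightarrow> a j \<le> a' j \<and> a' j \<le> real ((2 * k) choose k) / 2 ^ k * a j)"
proof -
  let ?n = "CARD('n)"
  have C: "compact C" "convex C" unfolding C_def using compact_convex_half_difference[OF K(1,2)] by auto
  have "K \<noteq> {}" using K(3) by auto
  moreover from this have "C \<noteq> {}" unfolding C_def set_plus_def by blast
  ultimately have ne: "K \<noteq> {}" "C \<noteq> {}" by auto
  \<comment> \<open>The shift by 2 keeps the error below 1 already at m = 0.\<close>
  define e where "e m = 1 / (real m + 2)" for m
  have e: "0 < e m" "e m < 1" "e \<longlonglongrightarrow> 0" for m
    unfolding e_def by (simp_all) real_asymp
  have "\<exists>P :: nat \<times> (nat \<Rightarrow> real^'n). cball 0 (1 - e m) \<subseteq> zonotope (snd P) {..<fst P} \<and> zonotope (snd P) {..<fst P} \<subseteq> cball 0 (1 + e m)" for m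
  proof -
    obtain N and u :: "nat \<Rightarrow> real^'n"
      where "cball 0 (1 - e m) \<subseteq> zonotope u {..<N}" "zonotope u {..<N} \<subseteq> cball 0 (1 + e m)"
      by (rule ball_zonotope_approximation[OF e(1)[of m]])
    then show ?thesis by (intro exI[of _ "(N, u)"]) simp
  qed
  then have "\<forall>m. \<exists>P :: nat \<times> (nat \<Rightarrow> real^'n). cball 0 (1 - e m) \<subseteq> zonotope (snd P) {..<fst P} \<and> zonotope (snd P) {..<fst P} \<subseteq> cball 0 (1 + e m)"
    by blast
  from choice[OF this] obtain P :: "nat \<Rightarrow> nat \<times> (nat \<Rightarrow> real^'n)"
    where P: "\<And>m. cball 0 (1 - e m) \<subseteq> zonotope (snd (P m)) {..<fst (P m)}" "\<And>m. zonotope (snd (P m)) {..<fst (P m)} \<subseteq> cball 0 (1 + e m)"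
    by blast
  define Z where "Z m = zonotope (snd (P m)) {..<fst (P m)}" for m
  have Z: "cball 0 (1 - e m) \<subseteq> Z m" "Z m \<subseteq> cball 0 (1 + e m)" "compact (Z m)" for m
    using P[of m] by (simp_all add: Z_def compact_zonotope)
  have "\<exists>a a'. (\<forall>t\<ge>0. measure lebesgue (K + dil t (Z m)) = (\<Sum>j\<le>?n. a j * t ^ j)) \<and>
    (\<forall>t\<ge>0. measure lebesgue (C + dil t (Z m)) = (\<Sum>j\<le>?n. a' j * t ^ j)) \<and>
    (\<forall>j k. j + k = ?n \<longrightarrow> 0 < k \<longrightarrow> a j \<le> a' j \<and> a' j \<le> real ((2 * k) choose k) / 2 ^ k * a j)" for m
    using zonotope_steiner_coefficients[OF K, of "{..<fst (P m)}" "snd (P m)"] unfolding C_def Z_def by simp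
  then have "\<forall>m. \<exists>Q :: (nat \<Rightarrow> real) \<times> (nat \<Rightarrow> real). (\<forall>t\<ge>0. measure lebesgue (K + dil t (Z m)) = (\<Sum>j\<le>?n. fst Q j * t ^ j)) \<and>
    (\<forall>t\<ge>0. measure lebesgue (C + dil t (Z m)) = (\<Sum>j\<le>?n. snd Q j * t ^ j)) \<and>
    (\<forall>j k. j + k = ?n \<longrightarrow> 0 < k \<longrightarrow> fst Q j \<le> snd Q j \<and> snd Q j \<le> real ((2 * k) choose k) / 2 ^ k * fst Q j)"
    by simp
  from choice[OF this] obtain Q :: "nat \<Rightarrow> (nat \<Rightarrow> real) \<times> (nat \<Rightarrow> real)"
    where Q: "\<And>m. (\<forall>t\<ge>0. measure lebesgue (K + dil t (Z m)) = (\<Sum>j\<le>?n. fst (Q m) j * t ^ j)) \<and>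
    (\<forall>t\<ge>0. measure lebesgue (C + dil t (Z m)) = (\<Sum>j\<le>?n. snd (Q m) j * t ^ j)) \<and>
    (\<forall>j k. j + k = ?n \<longrightarrow> 0 < k \<longrightarrow> fst (Q m) j \<le> snd (Q m) j \<and> snd (Q m) j \<le> real ((2 * k) choose k) / 2 ^ k * fst (Q m) j)"
    by blast
  define b where "b m = fst (Q m)" for m
  define b' where "b' m = snd (Q m)" for m
  have bK: "\<And>m t. 0 \<le> t \<Longrightarrow> measure lebesgue (K + dil t (Z m)) = (\<Sum>j\<le>?n. b m j * t ^ j)"
    and bC: "\<And>m t. 0 \<le> t \<Longrightarrow> measure lebesgue (C + dil t (Z m)) = (\<Sum>j\<le>?n. b' m j * t ^ j)"
    and ineq: "\<And>m j k. j + k = ?n \<Longrightarrow> 0 < k \<Longrightarrow> b m j \<le> b' m j \<and> b' m j \<le> real ((2 * k) choose k) / 2 ^ k * b m j"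
    using Q unfolding b_def b'_def by blast+
  have lim: "(\<lambda>m. measure lebesgue (L + dil t (Z m))) \<longlonglongrightarrow> measure lebesgue (L + dil t (cball 0 1))"
    if "compact L" "convex L" "L \<noteq> {}" "0 \<le> t" for L t
    by (rule measure_sum_near_ball_tendsto[where e = e, OF that(1-3) Z(3) e Z(1,2) that(4)])
  have conv: "convergent (\<lambda>m. c m j)"
    if c: "\<And>m t. 0 \<le> t \<Longrightarrow> measure lebesgue (L + dil t (Z m)) = (\<Sum>j\<le>?n. c m j * t ^ j)"
      and L: "compact L" "convex L" "L \<noteq> {}" and j: "j \<le> ?n" for c L j
  proof (rule polynomial_coefficients_converge[OF _ j])
    fix t :: real assume "0 < t"
    then have "(\<lambda>m. \<Sum>j\<le>?n. c m j * t ^ j) \<longlonglongrightarrow> measure lebesgue (L + dil t (cball 0 1))"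
      using lim[OF L, of t] c[of t] by simp
    then show "convergent (\<lambda>m. \<Sum>j\<le>?n. c m j * t ^ j)" by (rule convergentI)
  qed
  define a where "a j = lim (\<lambda>m. b m j)" for j
  define a' where "a' j = lim (\<lambda>m. b' m j)" for j
  have a: "(\<lambda>m. b m j) \<longlonglongrightarrow> a j" and a': "(\<lambda>m. b' m j) \<longlonglongrightarrow> a' j" if "j \<le> ?n" for j
    using conv[of K b, OF bK K(1,2) ne(1) that] conv[of C b', OF bC C ne(2) that]
    unfolding a_def a'_def convergent_LIMSEQ_iff by auto
  show ?thesis
  proof (rule exI[of _ a], rule exI[of _ a'], intro conjI allI impI)
    fix t :: real assume t: "0 \<le> t"
    have "(\<lambda>m. \<Sum>j\<le>?n. b m j * t ^ j) \<longlonglongrightarrow> (\<Sum>j\<le>?n. a j * t ^ j)"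
      by (intro tendsto_sum tendsto_mult_right a) auto
    moreover have "(\<lambda>m. \<Sum>j\<le>?n. b m j * t ^ j) \<longlonglongrightarrow> measure lebesgue (K + dil t (cball 0 1))"
      using lim[OF K(1,2) ne(1) t] bK[OF t] by simp
    ultimately show "measure lebesgue (K + dil t (cball 0 1)) = (\<Sum>j\<le>?n. a j * t ^ j)" by (rule LIMSEQ_unique[symmetric])
    have "(\<lambda>m. \<Sum>j\<le>?n. b' m j * t ^ j) \<longlonglongrightarrow> (\<Sum>j\<le>?n. a' j * t ^ j)"
      by (intro tendsto_sum tendsto_mult_right a') auto
    moreover have "(\<lambda>m. \<Sum>j\<le>?n. b' m j * t ^ j) \<longlonglongrightarrow> measure lebesgue (C + dil t (cball 0 1))"
      using lim[OF C ne(2) t] bC[OF t] by simp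
    ultimately show "measure lebesgue (C + dil t (cball 0 1)) = (\<Sum>j\<le>?n. a' j * t ^ j)" by (rule LIMSEQ_unique[symmetric])
  next
    fix j k :: nat assume jk: "j + k = ?n" "0 < k"
    then have j: "j \<le> ?n" by simp
    show "a j \<le> a' j" by (rule LIMSEQ_le[OF a[OF j] a'[OF j]]) (use ineq[OF jk] in auto)
    show "a' j \<le> real ((2 * k) choose k) / 2 ^ k * a j"
      by (rule LIMSEQ_le[OF a'[OF j] tendsto_mult_left[OF a[OF j]]]) (use ineq[OF jk] in auto)
  qed
qed

text \<open>For s > 0 this is homogeneity. The expansion that defines mixed volumes also admits s =
  0, where \<open>K\<close> collapses to the origin and the claim becomes that the top coefficient
  is the volume of the ball.\<close>

lemma steiner_two_parameter:
  fixes K :: "'a::euclidean_space set"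
  assumes K: "compact K" "K \<noteq> {}"
    and a: "\<And>t. 0 \<le> t \<Longrightarrow> measure lebesgue (K + dil t (cball 0 1)) = (\<Sum>j\<le>DIM('a). a j * t ^ j)"
    and st: "0 \<le> s" "0 \<le> t"
  shows "measure lebesgue (dil s K + dil t (cball 0 1)) = (\<Sum>j\<le>DIM('a). a j * s ^ (DIM('a) - j) * t ^ j)"
proof (cases "s = 0")
  case False
  then have s: "0 < s" using st by simp
  have "dil s K + dil t (cball 0 1) = dil s (K + dil (t / s) (cball 0 1))" using s by (simp add: dil_set_plus dil_dil)
  then have "measure lebesgue (dil s K + dil t (cball 0 1)) = s ^ DIM('a) * (\<Sum>j\<le>DIM('a). a j * (t / s) ^ j)"
    using s st a[of "t / s"] by (simp add: measure_dil del: measure_completion)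
  also have "\<dots> = (\<Sum>j\<le>DIM('a). a j * s ^ (DIM('a) - j) * t ^ j)"
    unfolding sum_distrib_left
  proof (rule sum.cong[OF refl])
    fix j assume "j \<in> {..DIM('a)}"
    then have "s ^ DIM('a) = s ^ (DIM('a) - j) * s ^ j" by (simp add: power_add[symmetric])
    then show "s ^ DIM('a) * (a j * (t / s) ^ j) = a j * s ^ (DIM('a) - j) * t ^ j" using s by (simp add: power_divide)
  qed
  finally show ?thesis .
next
  case True
  obtain p where p: "0 < p" "\<And>x. x \<in> K \<Longrightarrow> norm x \<le> p" using compact_imp_bounded[OF K(1)] by (auto simp: bounded_pos)
  obtain q where q: "q \<in> K" using K(2) by blast
  let ?n = "DIM('a)" and ?B = "cball (0::'a) 1"
  define V where "V = measure lebesgue ?B"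
  \<comment> \<open>The value is found from growth at infinity: K + r B contains a translate of r B
    and lies in the ball of radius p + r.\<close>
  have top: "a ?n = V"
  proof -
    define f where "f r = (\<Sum>j\<le>?n. a j * r ^ j) / r ^ ?n" for r
    have "f r = (\<Sum>j\<le>?n. a j * inverse r ^ (?n - j))" if "0 < r" for r
      unfolding f_def sum_divide_distrib
    proof (rule sum.cong[OF refl])
      fix j assume "j \<in> {..?n}"
      then have "r ^ ?n = r ^ (?n - j) * r ^ j" by (simp add: power_add[symmetric])
      then show "a j * r ^ j / r ^ ?n = a j * inverse r ^ (?n - j)" using that by (simp add: field_simps power_inverse)
    qed
    then have ev: "\<forall>\<^sub>F r in at_top. (\<Sum>j\<le>?n. a j * inverse r ^ (?n - j)) = f r"
      by (intro eventually_mono[OF eventually_gt_at_top[of 0]]) auto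
    have "((\<lambda>r. \<Sum>j\<le>?n. a j * inverse r ^ (?n - j)) \<longlongrightarrow> (\<Sum>j\<le>?n. a j * 0 ^ (?n - j))) at_top"
      by (intro tendsto_sum tendsto_mult_left tendsto_power tendsto_inverse_0_at_top filterlim_ident)
    moreover have "(\<Sum>j\<le>?n. a j * 0 ^ (?n - j)) = a ?n"
      by (subst sum.mono_neutral_right[of _ "{?n}"]) (auto simp: zero_power)
    ultimately have fa: "(f \<longlongrightarrow> a ?n) at_top" using Lim_transform_eventually[OF _ ev] by simp
    have bd: "V \<le> f r \<and> f r \<le> (1 + p * inverse r) ^ ?n * V" if r: "0 < r" for r
    proof -
      have m: "measure lebesgue (K + dil r ?B) = f r * r ^ ?n" using a[of r] r by (simp add: f_def del: measure_completion)
      have "{q} + dil r ?B \<subseteq> K + dil r ?B" using q by (intro set_plus_mono2) auto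
      then have "measure lebesgue ({q} + dil r ?B) \<le> measure lebesgue (K + dil r ?B)"
        by (rule measure_mono_compact) (intro compact_set_plus compact_scaling K compact_cball compact_sing)+
      then have 1: "r ^ ?n * V \<le> f r * r ^ ?n" unfolding measure_sum_translation m V_def using r by (simp add: measure_dil del: measure_completion)
      have "K + dil r ?B \<subseteq> cball 0 (p + r)"
      proof
        fix x assume "x \<in> K + dil r ?B"
        then obtain k b where x: "k \<in> K" "norm b \<le> 1" "x = k + r *\<^sub>R b" by (auto simp: set_plus_def)
        have "norm x \<le> norm k + r * norm b" unfolding x(3) using r norm_triangle_ineq[of k "r *\<^sub>R b"] by simp
        also have "\<dots> \<le> p + r * 1" using r x p by (intro add_mono mult_left_mono) auto
        finally show "x \<in> cball 0 (p + r)" by simp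
      qed
      also have "cball (0::'a) (p + r) = dil (p + r) ?B" using p r by (simp add: dil_cball)
      finally have "measure lebesgue (K + dil r ?B) \<le> measure lebesgue (dil (p + r) ?B)"
        by (rule measure_mono_compact) (intro compact_set_plus compact_scaling K compact_cball)+
      then have "f r * r ^ ?n \<le> (p + r) ^ ?n * V" unfolding m V_def using r p by (simp add: measure_dil del: measure_completion)
      also have "p + r = (1 + p * inverse r) * r" using r by (simp add: field_simps)
      finally have 2: "f r * r ^ ?n \<le> ((1 + p * inverse r) ^ ?n * V) * r ^ ?n" by (simp add: power_mult_distrib mult_ac)
      have "0 < r ^ ?n" using r by simp
      then show ?thesis using 1 2 by (simp add: mult.commute)
    qed
    have "((\<lambda>r. (1 + p * inverse r) ^ ?n * V) \<longlongrightarrow> (1 + p * 0) ^ ?n * V) at_top"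
      by (intro tendsto_intros tendsto_inverse_0_at_top filterlim_ident)
    then have limV: "((\<lambda>r. (1 + p * inverse r) ^ ?n * V) \<longlongrightarrow> V) at_top" by simp
    have ev': "\<forall>\<^sub>F r in at_top. V \<le> f r" "\<forall>\<^sub>F r in at_top. f r \<le> (1 + p * inverse r) ^ ?n * V"
      by (rule eventually_mono[OF eventually_gt_at_top[of 0]], use bd in blast)+
    have "(f \<longlongrightarrow> V) at_top" by (rule real_tendsto_sandwich[OF ev' tendsto_const limV])
    then show ?thesis using tendsto_unique[OF _ fa] by simp
  qed
  have "dil 0 K = {0}" using K(2) by auto
  then have "dil s K + dil t ?B = dil t ?B" unfolding True by (simp only: set_add_0)
  then have "measure lebesgue (dil s K + dil t ?B) = t ^ ?n * V"
    unfolding V_def using measure_dil[OF st(2), of ?B] by (simp only:)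
  moreover have "(\<Sum>j\<le>?n. a j * s ^ (?n - j) * t ^ j) = a ?n * t ^ ?n"
    using True by (subst sum.mono_neutral_right[of _ "{?n}"]) (auto simp: zero_power)
  ultimately show ?thesis using top by simp
qed

section \<open>From Steiner coefficients to mixed volumes\<close>

text \<open>Letters below \<open>k\<close> will stand for the body, the others for the ball, and
  words with r ball letters contribute binom(m, r) s^(m-r) t^r. Induction on the first letter, with
  \<open>g\<close> arbitrary because a leading ball letter shifts it by one.\<close>

lemma sum_words_binomial:
  fixes l :: "nat \<Rightarrow> real" and g :: "nat \<Rightarrow> real"
  assumes "k \<le> N"
  shows "(\<Sum>ix | length ix = m \<and> set ix \<subseteq> {..<N}. g (length (filter (\<lambda>i. k \<le> i) ix)) * prod_list (map l ix)) =
    (\<Sum>r\<le>m. g r * real (m choose r) * (\<Sum>i<k. l i) ^ (m - r) * (\<Sum>i=k..<N. l i) ^ r)"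
proof (induction m arbitrary: g)
  case 0
  have "{ix::nat list. ix = [] \<and> set ix \<subseteq> {..<N}} = {[]}" by auto
  then show ?case by simp
next
  case (Suc m)
  let ?B = "{ix. length ix = m \<and> set ix \<subseteq> {..<N}}"
  let ?q = "\<lambda>ix :: nat list. length (filter (\<lambda>i. k \<le> i) ix)"
  define s where "s = (\<Sum>i<k. l i)"
  define t where "t = (\<Sum>i=k..<N. l i)"
  define F where "F g = (\<Sum>ix\<in>?B. g (?q ix) * prod_list (map l ix))" for g
  have "{ix. length ix = Suc m \<and> set ix \<subseteq> {..<N}} = (\<lambda>(i, ix). i # ix) ` ({..<N} \<times> ?B)"
    by (auto simp: length_Suc_conv image_iff)
  moreover have "inj_on (\<lambda>(i, ix). i # ix) ({..<N} \<times> ?B)" by (auto simp: inj_on_def)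
  ultimately have "(\<Sum>ix | length ix = Suc m \<and> set ix \<subseteq> {..<N}. g (?q ix) * prod_list (map l ix)) =
      (\<Sum>(i, ix)\<in>{..<N} \<times> ?B. g (?q (i # ix)) * (l i * prod_list (map l ix)))"
    by (simp add: sum.reindex case_prod_unfold)
  also have "\<dots> = (\<Sum>i<N. \<Sum>ix\<in>?B. g (?q (i # ix)) * (l i * prod_list (map l ix)))"
    by (simp add: sum.cartesian_product[symmetric])
  also have "\<dots> = (\<Sum>i<N. l i * F (if k \<le> i then (\<lambda>r. g (Suc r)) else g))"
    unfolding F_def sum_distrib_left by (intro sum.cong) auto
  also have "\<dots> = (\<Sum>i<k. l i * F (if k \<le> i then (\<lambda>r. g (Suc r)) else g)) + (\<Sum>i=k..<N. l i * F (if k \<le> i then (\<lambda>r. g (Suc r)) else g))"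
  proof -
    have "sum h {..<N} = sum h {..<k} + sum h {k..<N}" for h :: "nat \<Rightarrow> real"
      using sum.atLeastLessThan_concat[of 0 k N h] assms by (simp add: atLeast0LessThan)
    then show ?thesis .
  qed
  also have "(\<Sum>i<k. l i * F (if k \<le> i then (\<lambda>r. g (Suc r)) else g)) = s * F g"
    unfolding s_def sum_distrib_right by (intro sum.cong) auto
  also have "(\<Sum>i=k..<N. l i * F (if k \<le> i then (\<lambda>r. g (Suc r)) else g)) = t * F (\<lambda>r. g (Suc r))"
    unfolding t_def sum_distrib_right by (intro sum.cong) auto
  also have "F g = (\<Sum>r\<le>m. g r * real (m choose r) * s ^ (m - r) * t ^ r)"
    unfolding F_def s_def t_def by (rule Suc.IH)
  also have "F (\<lambda>r. g (Suc r)) = (\<Sum>r\<le>m. g (Suc r) * real (m choose r) * s ^ (m - r) * t ^ r)"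
    unfolding F_def s_def t_def by (rule Suc.IH)
  \<comment> \<open>The sum may be extended to \<open>Suc m\<close> because
    \<open>m choose Suc m\<close> is 0; after splitting off r = 0 both sums match term by term and
    Pascal's rule applies.\<close>
  also have "s * (\<Sum>r\<le>m. g r * real (m choose r) * s ^ (m - r) * t ^ r) = (\<Sum>r\<le>Suc m. g r * real (m choose r) * s ^ (Suc m - r) * t ^ r)"
    by (simp add: sum_distrib_left Suc_diff_le mult_ac)
  also have "\<dots> = g 0 * s ^ Suc m + (\<Sum>r\<le>m. g (Suc r) * real (m choose Suc r) * s ^ (m - r) * t ^ Suc r)"
    by (subst sum.atMost_Suc_shift) simp
  also have "t * (\<Sum>r\<le>m. g (Suc r) * real (m choose r) * s ^ (m - r) * t ^ r) = (\<Sum>r\<le>m. g (Suc r) * real (m choose r) * s ^ (m - r) * t ^ Suc r)"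
    by (simp add: sum_distrib_left mult_ac)
  also have "g 0 * s ^ Suc m + (\<Sum>r\<le>m. g (Suc r) * real (m choose Suc r) * s ^ (m - r) * t ^ Suc r) + (\<Sum>r\<le>m. g (Suc r) * real (m choose r) * s ^ (m - r) * t ^ Suc r)
     = g 0 * s ^ Suc m + (\<Sum>r\<le>m. g (Suc r) * real (Suc m choose Suc r) * s ^ (m - r) * t ^ Suc r)"
    by (simp add: sum.distrib[symmetric] algebra_simps)
  also have "\<dots> = (\<Sum>r\<le>Suc m. g r * real (Suc m choose r) * s ^ (Suc m - r) * t ^ r)"
    by (subst sum.atMost_Suc_shift) simp
  finally show ?case by (simp only: s_def t_def)
qed

text \<open>
  The coefficient of an index tuple in the expansion for \<open>K, \<dots>, K, B, \<dots>, B\<close> depends only on the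
  number of its entries that point to a ball.
\<close>

lemma quermassintegral_eq_coefficient:
  fixes K :: "(real^'n) set"
  assumes K: "compact K" "convex K" "K \<noteq> {}"
    and a: "\<And>t. 0 \<le> t \<Longrightarrow> measure lebesgue (K + dil t (cball 0 1)) = (\<Sum>j\<le>CARD('n). a j * t ^ j)"
    and j: "j \<le> CARD('n)"
  shows "quermassintegral j K = a j / real (CARD('n) choose j)"
proof -
  let ?n = "CARD('n)" and ?B = "cball (0 :: real^'n) 1"
  define k where "k = ?n - j"
  define q where "q ix = length (filter (\<lambda>i. k \<le> i) ix)" for ix :: "nat list"
  \<comment> \<open>There are \<open>?n choose r\<close> patterns of ball positions with r balls,
    and by symmetry they share the Steiner coefficient equally.\<close>
  define g where "g r = a r / real (?n choose r)" for r
  let ?Ks = "replicate (?n - j) K @ replicate j ?B"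
  have nth: "?Ks ! i = (if i < k then K else ?B)" if "i < ?n" for i
    using that j by (auto simp: nth_append k_def)
  have vc: "volume_coeffs ?Ks (\<lambda>ix. g (q ix))"
    unfolding volume_coeffs_def
  proof (intro conjI allI impI)
    fix ix jx :: "nat list" assume "mset ix = mset jx"
    then have "mset (filter (\<lambda>i. k \<le> i) ix) = mset (filter (\<lambda>i. k \<le> i) jx)" by simp
    then show "g (q ix) = g (q jx)" unfolding q_def by (metis size_mset)
  next
    fix l :: "nat \<Rightarrow> real" assume l: "\<forall>i. 0 \<le> l i"
    define s where "s = (\<Sum>i<k. l i)"
    define t where "t = (\<Sum>i=k..<?n. l i)"
    have st: "0 \<le> s" "0 \<le> t" using l by (auto simp: s_def t_def intro: sum_nonneg)
    have "(\<Sum>i<?n. dil (l i) (?Ks ! i)) = (\<Sum>i<k. dil (l i) (?Ks ! i)) + (\<Sum>i=k..<?n. dil (l i) (?Ks ! i))"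
      using sum.atLeastLessThan_concat[of 0 k ?n "\<lambda>i. dil (l i) (?Ks ! i)"] by (simp add: atLeast0LessThan k_def)
    also have "(\<Sum>i<k. dil (l i) (?Ks ! i)) = (\<Sum>i<k. dil (l i) K)"
    proof (rule sum.cong[OF refl])
      fix i assume "i \<in> {..<k}"
      then show "dil (l i) (?Ks ! i) = dil (l i) K" using nth[of i] by (simp add: k_def)
    qed
    also have "\<dots> = dil s K"
      unfolding s_def using sum_scaleR_convex[OF K(2,3), of "{..<k}" l] l by simp
    also have "(\<Sum>i=k..<?n. dil (l i) (?Ks ! i)) = (\<Sum>i=k..<?n. dil (l i) ?B)"
    proof (rule sum.cong[OF refl])
      fix i assume "i \<in> {k..<?n}"
      then show "dil (l i) (?Ks ! i) = dil (l i) ?B" using nth[of i] by simp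
    qed
    also have "\<dots> = dil t ?B"
      unfolding t_def using sum_scaleR_convex[of ?B "{k..<?n}" l] l by simp
    finally have "vol (\<Sum>i<?n. dil (l i) (?Ks ! i)) = measure lebesgue (dil s K + dil t ?B)" by simp
    also have "\<dots> = (\<Sum>j\<le>?n. a j * s ^ (?n - j) * t ^ j)"
      using steiner_two_parameter[OF K(1,3) _ st, of a] a by simp
    also have "\<dots> = (\<Sum>r\<le>?n. g r * real (?n choose r) * s ^ (?n - r) * t ^ r)"
      by (intro sum.cong) (auto simp: g_def)
    also have "\<dots> = (\<Sum>ix | length ix = ?n \<and> set ix \<subseteq> {..<?n}. g (q ix) * prod_list (map l ix))"
      unfolding s_def t_def q_def by (rule sum_words_binomial[symmetric]) (simp add: k_def)
    finally show "vol (\<Sum>i<?n. dil (l i) (?Ks ! i)) = (\<Sum>ix | length ix = ?n \<and> set ix \<subseteq> {..<?n}. g (q ix) * prod_list (map l ix))" .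
  qed
  have "quermassintegral j K = g (q [0..<?n])"
    unfolding quermassintegral_def by (rule mixed_volume_eq[OF vc])
  also have "q [0..<?n] = j"
  proof -
    have "[0..<?n] = [0..<k] @ [k..<?n]" using upt_add_eq_append[of 0 k "?n - k"] by (simp add: k_def)
    then have "filter (\<lambda>i. k \<le> i) [0..<?n] = [k..<?n]" by (simp add: filter_empty_conv filter_id_conv)
    then show ?thesis using j by (simp add: q_def k_def)
  qed
  finally show ?thesis by (simp add: g_def)
qed

theorem defect_bounds:
  fixes K :: "(real^'n) set"
  assumes K: "convex_body K" and k: "1 \<le> k" "k \<le> CARD('n)"
  shows "0 \<le> defect k K"
    "defect k K \<le> (real ((2 * k) choose k) / 2 ^ k - 1) * quermassintegral (CARD('n) - k) K"
proof -
  let ?n = "CARD('n)"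
  define C where "C = dil (1/2) (K + uminus ` K)"
  define j where "j = ?n - k"
  have j: "j \<le> ?n" "j + k = ?n" "0 < k" using k by (auto simp: j_def)
  have K': "compact K" "convex K" "interior K \<noteq> {}" using K by (auto simp: convex_body_def)
  have C: "compact C" "convex C" unfolding C_def using compact_convex_half_difference[OF K'(1,2)] by auto
  have "K \<noteq> {}" using K' by auto
  moreover from this have "C \<noteq> {}" unfolding C_def set_plus_def by blast
  ultimately have ne: "K \<noteq> {}" "C \<noteq> {}" by auto
  obtain a a' where a: "\<And>t. 0 \<le> t \<Longrightarrow> measure lebesgue (K + dil t (cball 0 1)) = (\<Sum>j\<le>?n. a j * t ^ j)"
    and a': "\<And>t. 0 \<le> t \<Longrightarrow> measure lebesgue (C + dil t (cball 0 1)) = (\<Sum>j\<le>?n. a' j * t ^ j)"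
    and ineq: "a j \<le> a' j" "a' j \<le> real ((2 * k) choose k) / 2 ^ k * a j"
    using steiner_coefficients[OF K', folded C_def] j(2,3) by blast
  let ?b = "real (?n choose j)"
  have W: "quermassintegral j K = a j / ?b" "quermassintegral j C = a' j / ?b"
    using quermassintegral_eq_coefficient[OF K'(1,2) ne(1) a j(1)] quermassintegral_eq_coefficient[OF C ne(2) a' j(1)] by auto
  have d: "defect k K = a' j / ?b - a j / ?b"
    unfolding defect_def symmetrization_def C_def[symmetric] j_def[symmetric] W ..
  have b: "0 < ?b" using j(1) by simp
  show "0 \<le> defect k K" unfolding d using ineq(1) b by (simp add: divide_right_mono)
  have "a' j / ?b \<le> real ((2 * k) choose k) / 2 ^ k * a j / ?b"
    using ineq(2) b by (intro divide_right_mono) auto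
  then show "defect k K \<le> (real ((2 * k) choose k) / 2 ^ k - 1) * quermassintegral (?n - k) K"
    unfolding d j_def[symmetric] W by (simp add: left_diff_distrib diff_divide_distrib)
qed

section \<open>Simplices\<close>

abbreviation std_simplex :: "'a::euclidean_space set" where
  "std_simplex \<equiv> convex hull (insert 0 Basis)"

text \<open>The coordinatewise lower bound for common points of \<open>std_simplex\<close> and its
  translate by \<open>y\<close>; it becomes the corner of their intersection.\<close>

definition pos_part :: "'a::euclidean_space \<Rightarrow> 'a" where
  "pos_part y = (\<Sum>b\<in>Basis. max 0 (y \<bullet> b) *\<^sub>R b)"

text \<open>The Minkowski functional of the difference body of \<open>std_simplex\<close> in closed
  form: positive coordinates are supplied by one copy of the simplex and negative ones by the
  reflected copy.\<close>

definition simplex_gauge :: "'a::euclidean_space \<Rightarrow> real" where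
  "simplex_gauge y = max (\<Sum>b\<in>Basis. max 0 (y \<bullet> b)) (\<Sum>b\<in>Basis. max 0 (- (y \<bullet> b)))"

lemma mem_std_simplex:
  "x \<in> std_simplex \<longleftrightarrow> (\<forall>b\<in>Basis. 0 \<le> x \<bullet> b) \<and> (\<Sum>b\<in>Basis. x \<bullet> b) \<le> 1"
  unfolding std_simplex by simp

lemma mem_dil_std_simplex:
  fixes x :: "'a::euclidean_space"
  assumes "0 \<le> r"
  shows "x \<in> dil r std_simplex \<longleftrightarrow> (\<forall>b\<in>Basis. 0 \<le> x \<bullet> b) \<and> (\<Sum>b\<in>Basis. x \<bullet> b) \<le> r"
proof (cases "r = 0")
  case True
  have "x = 0" if "\<forall>b\<in>Basis. 0 \<le> x \<bullet> b" "(\<Sum>b\<in>Basis. x \<bullet> b) \<le> 0"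
  proof -
    have "(\<Sum>b\<in>Basis. x \<bullet> b) = 0" using that sum_nonneg[of Basis "\<lambda>b. x \<bullet> b"] by simp
    then have "\<forall>b\<in>Basis. x \<bullet> b = 0" using that by (simp add: sum_nonneg_eq_0_iff)
    then show ?thesis by (simp add: euclidean_all_zero_iff)
  qed
  moreover have "dil r (std_simplex :: 'a set) = {0}"
    using True hull_inc[of 0 "insert (0::'a) Basis"] by (auto simp: image_constant_conv)
  ultimately show ?thesis using True by auto
next
  case False
  then have r: "0 < r" using assms by simp
  have "x \<in> dil r std_simplex \<longleftrightarrow> (1 / r) *\<^sub>R x \<in> std_simplex"
    using r by (auto simp: image_iff intro!: bexI[of _ "(1 / r) *\<^sub>R x"])
  also have "\<dots> \<longleftrightarrow> (\<forall>b\<in>Basis. 0 \<le> x \<bullet> b) \<and> (\<Sum>b\<in>Basis. x \<bullet> b) \<le> r"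
    unfolding mem_std_simplex using r by (simp add: sum_divide_distrib[symmetric] divide_le_eq zero_le_divide_iff)
  finally show ?thesis .
qed

lemma pos_part_inner: "b \<in> Basis \<Longrightarrow> pos_part y \<bullet> b = max 0 (y \<bullet> b)"
  by (simp add: pos_part_def)

lemma sum_inner_eq_diff: "(\<Sum>b\<in>Basis. y \<bullet> b) = (\<Sum>b\<in>Basis. max 0 (y \<bullet> b)) - (\<Sum>b\<in>Basis. max 0 (- (y \<bullet> b)))"
  unfolding sum_subtractf[symmetric] by (intro sum.cong) auto

text \<open>A common point dominates 0 and \<open>y\<close> in every coordinate, and its coordinate
  sum is at most 1 and at most 1 + (p - q), where p and q are the positive and negative masses of
  \<open>y\<close>. Relative to \<open>pos_part y\<close> the two bounds read 1 - p and 1 - q, so a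
  smaller simplex remains.\<close>

lemma std_simplex_Int_translate:
  fixes y :: "'a::euclidean_space"
  shows "std_simplex \<inter> ({y} + std_simplex) =
    (if simplex_gauge y \<le> 1 then {pos_part y} + dil (1 - simplex_gauge y) std_simplex else {})"
proof -
  let ?p = "\<Sum>b\<in>Basis. max 0 (y \<bullet> b)" and ?q = "\<Sum>b\<in>Basis. max 0 (- (y \<bullet> b))"
  have 1: "x \<in> {y} + std_simplex \<longleftrightarrow> x - y \<in> std_simplex" for x
    by (auto simp: set_plus_def algebra_simps) (metis add.commute diff_add_cancel)
  have 2: "x \<in> std_simplex \<inter> ({y} + std_simplex) \<longleftrightarrow>
    (\<forall>b\<in>Basis. 0 \<le> (x - pos_part y) \<bullet> b) \<and> (\<Sum>b\<in>Basis. (x - pos_part y) \<bullet> b) \<le> 1 - simplex_gauge y" for x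
  proof -
    have "x \<in> std_simplex \<inter> ({y} + std_simplex) \<longleftrightarrow>
      (\<forall>b\<in>Basis. 0 \<le> x \<bullet> b \<and> 0 \<le> (x - y) \<bullet> b) \<and> (\<Sum>b\<in>Basis. x \<bullet> b) \<le> 1 \<and> (\<Sum>b\<in>Basis. (x - y) \<bullet> b) \<le> 1"
      by (simp only: Int_iff 1 mem_std_simplex) blast
    also have "(\<forall>b\<in>Basis. 0 \<le> x \<bullet> b \<and> 0 \<le> (x - y) \<bullet> b) \<longleftrightarrow> (\<forall>b\<in>Basis. 0 \<le> (x - pos_part y) \<bullet> b)"
      by (intro ball_cong refl) (auto simp: inner_diff_left pos_part_inner)
    also have "(\<Sum>b\<in>Basis. x \<bullet> b) \<le> 1 \<and> (\<Sum>b\<in>Basis. (x - y) \<bullet> b) \<le> 1 \<longleftrightarrow> (\<Sum>b\<in>Basis. x \<bullet> b) - ?p \<le> 1 - simplex_gauge y"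
      unfolding inner_diff_left sum_subtractf sum_inner_eq_diff[of y] simplex_gauge_def by linarith
    also have "(\<Sum>b\<in>Basis. x \<bullet> b) - ?p = (\<Sum>b\<in>Basis. (x - pos_part y) \<bullet> b)"
      by (simp add: inner_diff_left sum_subtractf pos_part_inner)
    finally show ?thesis .
  qed
  show ?thesis
  proof (cases "simplex_gauge y \<le> 1")
    case True
    have "x \<in> {pos_part y} + dil (1 - simplex_gauge y) std_simplex \<longleftrightarrow> x - pos_part y \<in> dil (1 - simplex_gauge y) std_simplex" for x
      by (auto simp: set_plus_def) (metis add.commute diff_add_cancel)
    then show ?thesis using True by (auto simp only: set_eq_iff 2 mem_dil_std_simplex if_True)
  next
    case False
    have "\<not> (\<Sum>b\<in>Basis. (x - pos_part y) \<bullet> b) \<le> 1 - simplex_gauge y" if "\<forall>b\<in>Basis. 0 \<le> (x - pos_part y) \<bullet> b" for x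
      using sum_nonneg[of Basis "\<lambda>b. (x - pos_part y) \<bullet> b"] that False by simp
    then show ?thesis using False 2 by auto
  qed
qed

text \<open>Splitting \<open>y\<close> into positive and negative part is the cheapest way to write
  it as a difference of nonnegative vectors: any other splitting dominates it
  coordinatewise.\<close>

lemma mem_dil_std_simplex_difference:
  fixes y :: "'a::euclidean_space"
  assumes "0 \<le> r"
  shows "y \<in> dil r (std_simplex + uminus ` std_simplex) \<longleftrightarrow> simplex_gauge y \<le> r"
proof
  assume "y \<in> dil r (std_simplex + uminus ` std_simplex)"
  then obtain u v where uv: "u \<in> std_simplex" "v \<in> std_simplex" "y = r *\<^sub>R (u - v)" by (auto simp: set_plus_def)
  have u: "\<And>b. b \<in> Basis \<Longrightarrow> 0 \<le> r * (u \<bullet> b)" "r * (\<Sum>b\<in>Basis. u \<bullet> b) \<le> r"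
    and v: "\<And>b. b \<in> Basis \<Longrightarrow> 0 \<le> r * (v \<bullet> b)" "r * (\<Sum>b\<in>Basis. v \<bullet> b) \<le> r"
    using uv(1,2) assms unfolding mem_std_simplex by (auto intro: mult_left_le)
  have "(\<Sum>b\<in>Basis. max 0 (y \<bullet> b)) \<le> (\<Sum>b\<in>Basis. r * (u \<bullet> b))"
    using u(1) v(1) by (intro sum_mono) (simp add: uv(3) inner_diff_left right_diff_distrib)
  moreover have "(\<Sum>b\<in>Basis. max 0 (- (y \<bullet> b))) \<le> (\<Sum>b\<in>Basis. r * (v \<bullet> b))"
    using u(1) v(1) by (intro sum_mono) (simp add: uv(3) inner_diff_left right_diff_distrib)
  ultimately show "simplex_gauge y \<le> r" using u(2) v(2) by (simp add: simplex_gauge_def sum_distrib_left[symmetric])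
next
  assume g: "simplex_gauge y \<le> r"
  have "pos_part y \<in> dil r std_simplex" "pos_part (- y) \<in> dil r std_simplex"
    unfolding mem_dil_std_simplex[OF assms] using g by (simp_all add: pos_part_inner simplex_gauge_def)
  then have "pos_part y + - pos_part (- y) \<in> dil r std_simplex + uminus ` dil r std_simplex"
    by (intro set_plus_intro imageI)
  also have "pos_part y + - pos_part (- y) = y"
    by (rule euclidean_eqI) (auto simp: inner_diff_left inner_add_left pos_part_inner)
  finally have "y \<in> dil r std_simplex + uminus ` dil r std_simplex" .
  also have "uminus ` dil r std_simplex = dil r (uminus ` (std_simplex :: 'a set))" by (simp add: image_image)
  finally show "y \<in> dil r (std_simplex + uminus ` std_simplex)" by (simp add: dil_set_plus)
qed

section \<open>Arbitrary simplices\<close>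

text \<open>The edge vectors issuing from one vertex form a basis, and \<open>L\<close> carries the
  standard basis to it.\<close>

lemma simplex_affine_image:
  fixes S :: "'a::euclidean_space set"
  assumes "int DIM('a) simplex S"
  obtains a and L :: "'a \<Rightarrow> 'a" where "linear L" "inj L" "surj L" "S = {a} + L ` std_simplex"
proof -
  obtain C where C: "\<not> affine_dependent C" "int (card C) = int DIM('a) + 1" "S = convex hull C"
    using assms unfolding simplex_def by blast
  have fC: "finite C" using aff_independent_finite[OF C(1)] .
  have "C \<noteq> {}" using C(2) by auto
  then obtain a where a: "a \<in> C" by blast
  define B where "B = (\<lambda>x. - a + x) ` (C - {a})"
  have indep: "independent B" using C(1) a affine_dependent_iff_dependent2[of a C] by (simp add: B_def)
  have "card B = card (C - {a})" unfolding B_def by (intro card_image) (auto simp: inj_on_def)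
  then have cB: "card B = DIM('a)" using C(2) a fC by simp
  have fB: "finite B" using fC by (simp add: B_def)
  obtain f where f: "bij_betw f (Basis :: 'a set) B"
    using finite_same_card_bij[of "Basis :: 'a set" B] fB cB by auto
  obtain L where L: "linear L" "\<And>b. b \<in> Basis \<Longrightarrow> L b = f b"
    using linear_independent_extend[OF independent_Basis, of f] by blast
  have LB: "L ` Basis = B" using L(2) f by (auto simp: bij_betw_def image_iff)
  have "UNIV \<subseteq> span B" using indep fB cB by (intro card_ge_dim_independent) auto
  moreover have "range L = span B" using linear_span_image[OF L(1), of Basis] LB by simp
  ultimately have surj: "surj L" by auto
  then have inj: "inj L" using L(1) linear_surjective_imp_injective by blast
  have "insert 0 B = (\<lambda>x. - a + x) ` C" using a by (auto simp: B_def)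
  then have "(+) a ` insert 0 B = C" by (simp add: image_image)
  then have "S = (+) a ` (convex hull (insert 0 B))" unfolding C(3) by (metis convex_hull_translation)
  also have "insert 0 B = L ` insert 0 Basis" using LB linear_0[OF L(1)] by simp
  also have "convex hull (L ` insert 0 Basis) = L ` std_simplex" by (rule convex_hull_linear_image[OF L(1), symmetric])
  finally have "S = {a} + L ` std_simplex" by (auto simp: set_plus_def)
  then show ?thesis using that L(1) inj surj by blast
qed

lemma full_simplex_interior_nonempty:
  fixes S :: "'a::euclidean_space set"
  assumes "int DIM('a) simplex S" shows "interior S \<noteq> {}"
proof -
  have "aff_dim S = int DIM('a)" using assms by (rule aff_dim_simplex)
  then have "affine hull S = UNIV" by (simp add: aff_dim_eq_full)
  then have "rel_interior S = interior S" by (rule rel_interior_interior)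
  moreover have "S \<noteq> {}" using assms by auto
  ultimately show ?thesis using rel_interior_eq_empty[OF convex_simplex[OF assms]] by simp
qed

lemma measure_pos_interior:
  fixes S :: "'a::euclidean_space set"
  assumes "compact S" "interior S \<noteq> {}" shows "0 < measure lebesgue S"
proof -
  obtain c e where e: "0 < e" "cball c e \<subseteq> S" using assms(2) mem_interior_cball by blast
  have "0 < measure lebesgue (cball c e)" using content_cball_pos[OF e(1)] by simp
  also have "\<dots> \<le> measure lebesgue S" by (rule measure_mono_compact[OF e(2) compact_cball assms(1)])
  finally show ?thesis .
qed

text \<open>The covariogram of \<open>S\<close> is integrated twice: directly it gives vol(S)^2, and
  over the layers r D it gives vol(S) vol(D) / binom(2n, n).\<close>

theorem simplex_difference_body_volume:
  fixes S :: "'a::euclidean_space set"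
  assumes S: "int DIM('a) simplex S"
  shows "measure lebesgue (S + uminus ` S) = real ((2 * DIM('a)) choose DIM('a)) * measure lebesgue S"
proof -
  let ?n = "DIM('a)" and ?T = "std_simplex :: 'a set"
  obtain a L where L: "linear L" "inj L" "surj L" and SL: "S = {a} + L ` ?T" using simplex_affine_image[OF S] .
  have L_add: "L (x + y) = L x + L y" and L_diff: "L (x - y) = L x - L y" and L_scale: "L (c *\<^sub>R x) = c *\<^sub>R L x" for x y c
    using L(1) by (simp_all add: linear_add linear_diff linear_scale)
  have cS: "compact S" using compact_simplex[OF S] .
  define D where "D = S + uminus ` S"
  have cD: "compact D" unfolding D_def by (intro compact_set_plus compact_negations cS)
  have LD: "D = L ` (?T + uminus ` ?T)"
    unfolding D_def SL by (force simp: set_plus_def image_iff L_diff[symmetric])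
  have mem: "L y \<in> dil r D \<longleftrightarrow> simplex_gauge y \<le> r" if "0 \<le> r" for y r
  proof -
    have "dil r D = L ` dil r (?T + uminus ` ?T)" unfolding LD by (simp add: image_image L_scale)
    then have "L y \<in> dil r D \<longleftrightarrow> y \<in> dil r (?T + uminus ` ?T)" using L(2) by (auto simp: inj_image_mem_iff)
    then show ?thesis using mem_dil_std_simplex_difference[OF that] by simp
  qed
  have inter: "S \<inter> ({L y} + S) = {a} + L ` (?T \<inter> ({y} + ?T))" for y
  proof -
    have "{L y} + S = {a} + L ` ({y} + ?T)" unfolding SL by (force simp: set_plus_def image_iff L_add)
    moreover have "({a} + A) \<inter> ({a} + B) = {a} + (A \<inter> B)" for A B :: "'a set" by (auto simp: set_plus_def)
    ultimately show ?thesis unfolding SL using image_Int[OF L(2)] by metis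
  qed
  have meas: "measure lebesgue (S \<inter> ({L y} + S)) = (if simplex_gauge y \<le> 1 then (1 - simplex_gauge y) ^ ?n * measure lebesgue S else 0)" for y
  proof (cases "simplex_gauge y \<le> 1")
    case True
    define c where "c = 1 - simplex_gauge y"
    have "L ` ({pos_part y} + dil c ?T) = {L (pos_part y)} + dil c (L ` ?T)"
      by (force simp: set_plus_def image_iff L_add L_scale)
    then have "S \<inter> ({L y} + S) = {a} + ({L (pos_part y)} + dil c (L ` ?T))"
      unfolding inter std_simplex_Int_translate using True by (simp add: c_def)
    then have "measure lebesgue (S \<inter> ({L y} + S)) = c ^ ?n * measure lebesgue (L ` ?T)"
      using True by (simp add: measure_sum_translation measure_dil c_def del: measure_completion)
    also have "measure lebesgue (L ` ?T) = measure lebesgue S" unfolding SL by (rule measure_sum_translation[symmetric])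
    finally show ?thesis using True by (simp add: c_def)
  next
    case False
    then have "S \<inter> ({L y} + S) = {}" unfolding inter std_simplex_Int_translate by (simp add: set_plus_def)
    then show ?thesis using False by simp
  qed
  define F where "F = {(r, x). r \<in> {0..1} \<and> x \<in> dil r D}"
  \<comment> \<open>The trivial summand puts the layers into the form for which compactness is
    known.\<close>
  have "{(r, x). r \<in> {0..1::real} \<and> x \<in> dil r D + dil 0 {0}} = F"
    unfolding F_def image_insert image_empty scaleR_zero_left set_add_0_right ..
  then have cF: "compact F" using compact_layers[OF cD, of "{0}" 0] by simp
  have n: "0 < ?n" by simp
  have cov: "emeasure lborel (S \<inter> ({z} + S)) = ennreal (measure lebesgue S) * (\<integral>\<^sup>+r. layer_weight ?n r * indicator F (r, z) \<partial>lborel)" for z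
  proof -
    obtain y where y: "z = L y" using L(3) by blast
    have g0: "0 \<le> simplex_gauge y" unfolding simplex_gauge_def by (simp add: le_max_iff_disj sum_nonneg)
    \<comment> \<open>The levels in the unit interval whose dilate of \<open>D\<close> contains
      \<open>z\<close> are exactly those from the gauge up to 1, so the tail integral equals the
      intersection ratio instead of merely bounding it.\<close>
    have ind: "layer_weight ?n r * indicator F (r, z) = (if simplex_gauge y \<le> 1 then layer_weight ?n r * indicator {simplex_gauge y..1} r else 0)" for r
      using mem[of r y] g0 by (auto simp: F_def y indicator_def)
    have "(\<integral>\<^sup>+r. layer_weight ?n r * indicator F (r, z) \<partial>lborel) = ennreal (if simplex_gauge y \<le> 1 then (1 - simplex_gauge y) ^ ?n else 0)"
      unfolding ind using nn_integral_layer_weight_tail[OF n g0] by simp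
    moreover have "emeasure lborel (S \<inter> ({z} + S)) = ennreal (measure lebesgue (S \<inter> ({z} + S)))"
      by (intro emeasure_compact compact_Int compact_set_plus cS compact_sing)
    ultimately show ?thesis using meas[of y] unfolding y
      by (auto simp: ennreal_mult[symmetric] mult.commute simp del: measure_completion)
  qed
  have [measurable]: "F \<in> sets (borel \<Otimes>\<^sub>M borel)" unfolding borel_prod by (rule borel_compact[OF cF])
  have "ennreal (measure lebesgue S * measure lebesgue S) = emeasure lborel S * emeasure lborel S"
    unfolding emeasure_compact[OF cS] by (simp add: ennreal_mult del: measure_completion)
  also have "\<dots> = (\<integral>\<^sup>+z. ennreal (measure lebesgue S) * (\<integral>\<^sup>+r. layer_weight ?n r * indicator F (r, z) \<partial>lborel) \<partial>lborel)"
    unfolding nn_integral_covariogram[OF cS cS, symmetric] cov ..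
  also have "\<dots> = ennreal (measure lebesgue S) * (\<integral>\<^sup>+z. (\<integral>\<^sup>+r. layer_weight ?n r * indicator F (r, z) \<partial>lborel) \<partial>lborel)"
    by (rule nn_integral_cmult) measurable
  also have "(\<integral>\<^sup>+z. (\<integral>\<^sup>+r. layer_weight ?n r * indicator F (r, z) \<partial>lborel) \<partial>lborel) = (\<integral>\<^sup>+r. layer_weight ?n r * emeasure lborel {z. (r, z) \<in> F} \<partial>lborel)"
    by (rule nn_integral_layers[OF cF])
  also have "\<dots> = (\<integral>\<^sup>+r. ennreal (measure lebesgue D) * (layer_weight ?n r * ennreal (r ^ ?n)) \<partial>lborel)"
  proof (rule nn_integral_cong)
    fix r :: real
    show "layer_weight ?n r * emeasure lborel {z. (r, z) \<in> F} = ennreal (measure lebesgue D) * (layer_weight ?n r * ennreal (r ^ ?n))"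
    proof (cases "r \<in> {0..1}")
      case True
      then have "{z. (r, z) \<in> F} = dil r D" by (auto simp: F_def)
      then have "emeasure lborel {z. (r, z) \<in> F} = ennreal (r ^ ?n * measure lebesgue D)"
        using True emeasure_compact[OF compact_scaling[OF cD, of r]] by (simp add: measure_dil del: measure_completion)
      also have "\<dots> = ennreal (measure lebesgue D) * ennreal (r ^ ?n)"
        using True by (simp add: ennreal_mult[symmetric] mult.commute del: measure_completion)
      finally show ?thesis by (simp add: mult.left_commute)
    qed (simp add: layer_weight_def)
  qed
  also have "\<dots> = ennreal (measure lebesgue D) * ennreal (1 / real ((2 * ?n) choose ?n))"
    unfolding nn_integral_layer_weight_power[OF n, symmetric] by (rule nn_integral_cmult) measurable
  also have "ennreal (measure lebesgue S) * \<dots> = ennreal (measure lebesgue S * (measure lebesgue D * (1 / real ((2 * ?n) choose ?n))))"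
    by (simp add: ennreal_mult[symmetric] del: measure_completion)
  finally have "measure lebesgue S * measure lebesgue S = measure lebesgue S * (measure lebesgue D * (1 / real ((2 * ?n) choose ?n)))"
    by (subst (asm) ennreal_inj) auto
  moreover have "0 < measure lebesgue S"
    by (rule measure_pos_interior[OF cS full_simplex_interior_nonempty[OF S]])
  ultimately have "measure lebesgue S = measure lebesgue D * (1 / real ((2 * ?n) choose ?n))"
    by (metis less_irrefl mult_left_cancel)
  moreover have "0 < real ((2 * ?n) choose ?n)" by simp
  ultimately show ?thesis unfolding D_def by (simp add: field_simps del: measure_completion)
qed

lemma std_simplex_simplex: "int DIM('a) simplex (std_simplex :: 'a::euclidean_space set)"
proof (rule simplex_convex_hull, intro conjI)
  have "(0::'a) \<notin> Basis" by auto
  then show "\<not> affine_dependent (insert (0::'a) Basis)"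
    using affine_dependent_iff_dependent[of "0::'a" Basis] independent_Basis by simp
  show "int (card (insert (0::'a) Basis)) = int DIM('a) + 1" using \<open>(0::'a) \<notin> Basis\<close> by simp
qed

lemma quermassintegral_0:
  fixes K :: "(real^'n) set"
  assumes "convex K" "K \<noteq> {}" shows "quermassintegral 0 K = vol K"
  using mixed_volume_diag[OF assms] by (simp add: quermassintegral_def)

text \<open>For k = n there are no balls among the arguments, so both quermassintegrals are volumes
  and the halved difference body contributes the factor 2^-n.\<close>

lemma defect_simplex:
  fixes S :: "(real^'n) set"
  assumes "int CARD('n) simplex S"
  shows "defect CARD('n) S = (real ((2 * CARD('n)) choose CARD('n)) / 2 ^ CARD('n) - 1) * quermassintegral 0 S"
proof -
  have S: "int DIM(real^'n) simplex S" using assms by simp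
  have cS: "compact S" "convex S" using compact_simplex[OF S] convex_simplex[OF S] by auto
  have ne: "S \<noteq> {}" using S by auto
  then have ne': "dil (1/2) (S + uminus ` S) \<noteq> {}" unfolding set_plus_def by blast
  have "defect CARD('n) S = vol (dil (1/2) (S + uminus ` S)) - vol S"
    unfolding defect_def symmetrization_def diff_self_eq_0
    using quermassintegral_0[OF cS(2) ne] quermassintegral_0[OF compact_convex_half_difference(2)[OF cS] ne'] by simp
  also have "vol (dil (1/2) (S + uminus ` S)) = (1/2) ^ CARD('n) * (real ((2 * CARD('n)) choose CARD('n)) * vol S)"
    using simplex_difference_body_volume[OF S] measure_dil[of "1/2" "S + uminus ` S"] by simp
  finally show ?thesis
    unfolding quermassintegral_0[OF cS(2) ne] by (simp add: left_diff_distrib power_divide)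
qed

theorem proposition4p2:
  shows "(\<forall>(K :: (real^'n) set) k. convex_body K \<and> 1 \<le> k \<and> k \<le> CARD('n) \<longrightarrow>
            0 \<le> defect k K \<and>
            defect k K \<le> (real ((2 * k) choose k) / 2 ^ k - 1)
                            * quermassintegral (CARD('n) - k) K)
       \<and> (\<forall>S :: (real^'n) set. int CARD('n) simplex S \<longrightarrow>
            defect CARD('n) S = (real ((2 * CARD('n)) choose CARD('n)) / 2 ^ CARD('n) - 1)
                            * quermassintegral 0 S)
       \<and> (\<forall>c :: real. (\<forall>K :: (real^'n) set. convex_body K \<longrightarrow>
                          defect CARD('n) K \<le> c * quermassintegral 0 K) \<longrightarrow>
            real ((2 * CARD('n)) choose CARD('n)) / 2 ^ CARD('n) - 1 \<le> c)"
proof (intro conjI allI impI)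
  fix K :: "(real^'n) set" and k
  assume "convex_body K \<and> 1 \<le> k \<and> k \<le> CARD('n)"
  then show "0 \<le> defect k K"
    "defect k K \<le> (real ((2 * k) choose k) / 2 ^ k - 1) * quermassintegral (CARD('n) - k) K"
    using defect_bounds[of K k] by auto
next
  fix S :: "(real^'n) set"
  assume "int CARD('n) simplex S"
  then show "defect CARD('n) S = (real ((2 * CARD('n)) choose CARD('n)) / 2 ^ CARD('n) - 1) * quermassintegral 0 S"
    by (rule defect_simplex)
next
  fix c :: real
  assume c: "\<forall>K :: (real^'n) set. convex_body K \<longrightarrow> defect CARD('n) K \<le> c * quermassintegral 0 K"
  \<comment> \<open>Any admissible constant is tested on one simplex, where equality holds and the
    positive volume can be cancelled.\<close>
  let ?S = "std_simplex :: (real^'n) set"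
  have S: "int DIM(real^'n) simplex ?S" by (rule std_simplex_simplex)
  have body: "convex_body ?S"
    unfolding convex_body_def
    using compact_simplex[OF S] convex_simplex[OF S] full_simplex_interior_nonempty[OF S] by blast
  have "0 < vol ?S" using measure_pos_interior body unfolding convex_body_def by blast
  moreover have "quermassintegral 0 ?S = vol ?S"
    using body by (intro quermassintegral_0) (auto simp: convex_body_def)
  ultimately have pos: "0 < quermassintegral 0 ?S" by simp
  have "defect CARD('n) ?S \<le> c * quermassintegral 0 ?S" using c body by blast
  then show "real ((2 * CARD('n)) choose CARD('n)) / 2 ^ CARD('n) - 1 \<le> c"
    using defect_simplex[of ?S] S pos by simp
qed

end
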